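(* Suppose $d\mu$ is a nontrivial probability measure on $\partial\mathbb{D}$ with Verblunsky coefficients $\{\alpha_j\}_{j=0}^\infty$, and there exists a sequence $\{\beta_j\}_{j=0}^\infty$ in $\mathbb{D}$ with $\beta_{j+p}=\beta_j$ for all $j$, for some positive integer $p$, and $$\sum_{j=0}^\infty j\,|\alpha_j-\beta_j|<\infty .$$ Then $d\mu$ has an essential support whose complement in $\partial\mathbb{D}$ has at most $p$ gaps (connected components), and each gap has only finitely many mass points of $d\mu$.
   Context: $\mathbb{D}=\{|z|<1\}$. A probability measure on $\partial\mathbb{D}$ is nontrivial if it is not a finite combination of delta functions. For such $\mu$, $\Phi_n$ is the monic orthogonal polynomial of degree $n$ in $L^2(\partial\mathbb{D},d\mu)$ and the Verblunsky coefficients are $\alpha_n=-\overline{\Phi_{n+1}(0)}\in\mathbb{D}$, $n\ge0$. The essential support of $d\mu$ is the set of points $z_0$ such that $\{z\mid|z-z_0|<\varepsilon\}\cap\operatorname{supp}(d\mu)$ is an infinite set for all $\varepsilon>0$. *)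

theory Defs
  imports "HOL-Probability.Probability" "HOL-Computational_Algebra.Polynomial"
begin

abbreviation unit_circle :: "complex set" where
  "unit_circle \<equiv> sphere 0 1"

abbreviation circle_borel :: "complex measure" where
  "circle_borel \<equiv> restrict_space borel unit_circle"

definition circle_prob :: "complex measure \<Rightarrow> bool" where
  "circle_prob M \<longleftrightarrow> prob_space M \<and> sets M = sets circle_borel"

definition nontrivial_measure :: "complex measure \<Rightarrow> bool" where
  "nontrivial_measure M \<longleftrightarrow>
     \<not> (\<exists>S w. finite S \<and> S \<subseteq> space M \<and>
          (\<forall>A\<in>sets M. emeasure M A = (\<Sum>s\<in>S. w s * emeasure (return M s) A)))"

(* The description determines the polynomial uniquely when M is a nontrivial
   probability measure on the circle; otherwise the value may be meaningless. *)
definition monic_OP :: "complex measure \<Rightarrow> nat \<Rightarrow> complex poly" where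
  "monic_OP M n =
     (THE P. degree P = n \<and> lead_coeff P = 1 \<and>
        (\<forall>Q. degree Q < n \<longrightarrow> (LINT z|M. cnj (poly Q z) * poly P z) = 0))"

definition verblunsky :: "complex measure \<Rightarrow> nat \<Rightarrow> complex" where
  "verblunsky M n = - cnj (poly (monic_OP M (Suc n)) 0)"

(* The intersection with the space of M is needed because a ball in the plane is
   not itself a measurable set of a measure living on the circle. *)
definition measure_support :: "complex measure \<Rightarrow> complex set" where
  "measure_support M = {z \<in> space M. \<forall>e>0. emeasure M (ball z e \<inter> space M) > 0}"

definition essential_support :: "complex measure \<Rightarrow> complex set" where
  "essential_support M = {z0. \<forall>e>0. infinite (ball z0 e \<inter> measure_support M)}"

definition mass_points :: "complex measure \<Rightarrow> complex set" where
  "mass_points M = {z \<in> space M. emeasure M {z} > 0}"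

definition gaps :: "complex measure \<Rightarrow> complex set set" where
  "gaps M = components (unit_circle - essential_support M)"

end

theory Submission
  imports Defs
begin

text \<open>Multiplying the orthonormal polynomial \<open>\<phi>\<^sub>n\<close> at \<open>z = exp(i\<theta>)\<close> by \<open>exp(-in\<theta>/2)\<close> turns the Szego recursion into an
  area-preserving real-linear recursion on the plane, whose polar angle increases with \<open>\<theta>\<close>.
  The bands are where the half-trace of the monodromy of \<open>\<beta>\<close> is less than 1 in modulus.
  In a band all solutions are bounded, and comparison with the polynomials
  \<open>((1 + z/\<zeta>)/2)\<^sup>n\<close> in the Christoffel variational principle then forces every band
  point \<open>\<zeta>\<close> into the support.
  Each support point in a gap attracts a zero of a paraorthogonal polynomial, and zeros correspond
  to increments \<open>\<pi>\<close> of the angle; so the number of support points in a gap is bounded by the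
  difference of the angles at its two edges. For \<open>\<beta>\<close> this difference stays bounded since the
  rotation number is constant on the gap. At an edge the unperturbed solutions grow at most linearly,
  and finiteness of the first moment of the perturbation yields a solution asymptotic to the bounded
  one, so the angles for \<open>\<alpha>\<close> and \<open>\<beta>\<close> also differ by a bounded amount.
  The edges of distinct gaps are distinct zeros of a polynomial of degree \<open>2p\<close>, whence at most
  \<open>p\<close> gaps.\<close>

section \<open>Normalized Szego recursion and lifted phases\<close>

text \<open>On the circle the reversed polynomial is \<open>z^n\<close> times the conjugate of the
  polynomial. Removing the half-angle factor turns reversal into plain conjugation, which is why a
  single real-linear map replaces the usual two-component recursion. The price is that raising
  \<theta> by 2 pi changes the sign of each step, so the half-trace is 2 pi-periodic only up to
  sign. The angle is kept as a real number because its total growth is what counts zeros. That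
  growth depends on the initial angle only up to 2 pi, so an eigenvector or a Jost-type solution may
  stand in for the polynomials, even though its initial value changes with the time horizon. The
  obstacle at an edge is that comparison through the wronskian bounds only the sine of an angle
  difference, that is, the difference modulo pi. The right branch must be followed step by step,
  using uniform continuity of one step.\<close>

definition szego_rho :: "complex \<Rightarrow> real" where
  "szego_rho a = sqrt (1 - (cmod a)\<^sup>2)"

definition szego_step :: "complex \<Rightarrow> real \<Rightarrow> complex \<Rightarrow> complex" where
  "szego_step a \<theta> f = (cis (\<theta>/2) * f - cnj (a * cis (\<theta>/2) * f)) / of_real (szego_rho a)"

primrec sol :: "(nat \<Rightarrow> complex) \<Rightarrow> real \<Rightarrow> complex \<Rightarrow> nat \<Rightarrow> complex" where
  "sol a \<theta> f 0 = f"
| "sol a \<theta> f (Suc n) = szego_step (a n) \<theta> (sol a \<theta> f n)"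

text \<open>The oriented area spanned by \<open>f\<close> and \<open>g\<close> in the real
  plane.\<close>

definition wronskian :: "complex \<Rightarrow> complex \<Rightarrow> real" where
  "wronskian f g = Im (cnj f * g)"

text \<open>Factoring \<open>cis t\<close> out of \<open>cis t - cnj (a * cis t)\<close> leaves a
  number in the right half-plane when |a| < 1. There the principal \<open>Arg\<close> is continuous,
  so this is a continuous branch of the argument.\<close>

definition turn :: "complex \<Rightarrow> real \<Rightarrow> real" where
  "turn a t = t + Arg (1 - cnj a * cis (- 2 * t))"

primrec ang :: "(nat \<Rightarrow> complex) \<Rightarrow> real \<Rightarrow> real \<Rightarrow> nat \<Rightarrow> real" where
  "ang a \<theta> x 0 = x"
| "ang a \<theta> x (Suc n) = turn (a n) (\<theta>/2 + ang a \<theta> x n)"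

lemma szego_rho_pos: "cmod a < 1 \<Longrightarrow> szego_rho a > 0"
  by (simp add: szego_rho_def power_less_one_iff abs_square_less_1)

lemma szego_rho_sq: "cmod a < 1 \<Longrightarrow> (szego_rho a)\<^sup>2 = 1 - (cmod a)\<^sup>2"
  by (simp add: szego_rho_def abs_square_le_1)

lemma szego_rho_le_1: "szego_rho a \<le> 1"
  by (simp add: szego_rho_def)

text \<open>The map \<open>h - cnj (a * h)\<close> is real-linear with determinant
  \<open>1 - |a|^2\<close>; division by \<open>szego_rho a\<close> normalizes it to 1, and the
  rotation by \<theta>/2 preserves area.\<close>

lemma wronskian_step:
  assumes "cmod a < 1"
  shows "wronskian (szego_step a \<theta> f) (szego_step a \<theta> g) = wronskian f g"
proof -
  define r where "r = szego_rho a"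
  define h k where "h = cis (\<theta>/2) * f" and "k = cis (\<theta>/2) * g"
  have r: "r > 0" "r\<^sup>2 = 1 - (cmod a)\<^sup>2"
    using assms szego_rho_pos szego_rho_sq by (auto simp: r_def)
  have ee: "cnj (cis (\<theta>/2)) * cis (\<theta>/2) = 1"
    by (simp add: cis_cnj cis_mult)
  have "cnj h * k = (cnj (cis (\<theta>/2)) * cis (\<theta>/2)) * (cnj f * g)"
    by (simp add: h_def k_def mult_ac)
  hence hk: "Im (cnj h * k) = wronskian f g"
    by (simp only: ee wronskian_def mult_1)
  have "wronskian (szego_step a \<theta> f) (szego_step a \<theta> g)
      = Im (cnj (h - cnj (a * h)) * (k - cnj (a * k)) / of_real (r\<^sup>2))"
    by (simp add: wronskian_def szego_step_def h_def k_def r_def power2_eq_square mult_ac)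
  also have "\<dots> = Im (cnj (h - cnj (a * h)) * (k - cnj (a * k))) / r\<^sup>2"
    by (simp only: Im_divide_of_real)
  also have "Im (cnj (h - cnj (a * h)) * (k - cnj (a * k))) = (1 - (cmod a)\<^sup>2) * Im (cnj h * k)"
    unfolding cmod_power2 by (simp add: algebra_simps power2_eq_square)
  also have "(1 - (cmod a)\<^sup>2) * Im (cnj h * k) / r\<^sup>2 = wronskian f g"
    unfolding hk r(2)[symmetric] using r(1) by simp
  finally show ?thesis .
qed

lemma wronskian_sol: "(\<And>n. cmod (a n) < 1) \<Longrightarrow> wronskian (sol a \<theta> f n) (sol a \<theta> g n) = wronskian f g"
  by (induction n) (auto simp: wronskian_step)

lemma norm_pos_if_Re_pos: "Re z > 0 \<Longrightarrow> cmod z > 0"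
  by auto

lemma step_diff_Re_pos:
  assumes "cmod a < 1"
  shows "Re (1 - cnj a * cis t) > 0"
proof -
  have "Re (cnj a * cis t) \<le> cmod (cnj a * cis t)" by (rule complex_Re_le_cmod)
  also have "\<dots> < 1" using assms by (simp add: norm_mult)
  finally show ?thesis by simp
qed

lemma szego_step_polar:
  assumes "cmod a < 1"
  shows "szego_step a \<theta> (of_real r * cis x)
    = of_real (r * cmod (1 - cnj a * cis (- 2 * (\<theta>/2 + x))) / szego_rho a) * cis (turn a (\<theta>/2 + x))"
proof -
  define t where "t = \<theta>/2 + x"
  define w where "w = 1 - cnj a * cis (- 2 * t)"
  have w: "w = of_real (cmod w) * cis (Arg w)"
    by (metis cis_rcis_eq mult.right_neutral rcis_cmod_Arg rcis_def)
  have "cis t * cis (- 2 * t) = cis (-t)" by (simp add: cis_mult)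
  hence e: "cis t * w = cis t - cnj a * cis (-t)"
    unfolding w_def by (simp add: right_diff_distrib mult_ac)
  have "szego_step a \<theta> (of_real r * cis x)
      = (of_real r * cis t - cnj (a * (of_real r * cis t))) / of_real (szego_rho a)"
    by (simp add: szego_step_def t_def cis_mult mult_ac flip: cis_mult)
  also have "\<dots> = of_real r * (cis t * w) / of_real (szego_rho a)"
    unfolding e by (simp add: cis_cnj algebra_simps)
  also have "\<dots> = of_real r * (cis t * (of_real (cmod w) * cis (Arg w))) / of_real (szego_rho a)"
    using w by simp
  also have "\<dots> = of_real (r * cmod w / szego_rho a) * cis (turn a t)"
    by (simp add: turn_def w_def cis_mult mult_ac flip: cis_mult)
  finally show ?thesis by (simp add: t_def w_def)
qed

lemma turn_pi: "turn a (t + pi) = turn a t + pi"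
proof -
  have "cis (- 2 * (t + pi)) = cis (- 2 * t)"
    by (simp add: cis.ctr cos_diff sin_diff distrib_left)
  thus ?thesis by (simp add: turn_def del: mult_minus_left)
qed

lemma Arg_step_bound: "cmod a < 1 \<Longrightarrow> \<bar>Arg (1 - cnj a * cis t)\<bar> < pi/2"
  using step_diff_Re_pos Arg_Re_pos by blast

lemma wronskian_polar: "wronskian (of_real r * cis x) (of_real s * cis y) = r * s * sin (y - x)"
proof -
  have "cnj (of_real r * cis x) * (of_real s * cis y) = of_real (r * s) * cis (y - x)"
    by (simp add: cis_cnj cis_mult mult_ac flip: cis_mult)
       (simp add: cis_mult)
  thus ?thesis by (simp only: wronskian_def) simp
qed

text \<open>Area preservation keeps the sign of the sine of the angle between two vectors, so order
  can fail only if the lifted difference drops to a different positive lobe of the sine.\<close>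

lemma turn_less_aux:
  assumes "cmod a < 1" "x < y" "y < x + pi"
  shows "turn a x < turn a y"
proof -
  define w where "w = (\<lambda>t. cmod (1 - cnj a * cis (- 2 * t)) / szego_rho a)"
  have st: "szego_step a 0 (of_real 1 * cis t) = of_real (w t) * cis (turn a t)" for t
    using szego_step_polar[OF assms(1), of 0 1 t] by (simp add: w_def)
  have wpos: "w t > 0" for t
    using step_diff_Re_pos[OF assms(1), of "-2*t"] szego_rho_pos[OF assms(1)]
    unfolding w_def by (intro divide_pos_pos norm_pos_if_Re_pos)
  have "w x * w y * sin (turn a y - turn a x) = sin (y - x)"
    using wronskian_step[OF assms(1), of 0 "of_real 1 * cis x" "of_real 1 * cis y"]
    unfolding st wronskian_polar by simp
  moreover have "sin (y - x) > 0" using assms by (intro sin_gt_zero) auto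
  ultimately have sp: "sin (turn a y - turn a x) > 0"
    using wpos by (metis mult_pos_pos zero_less_mult_pos)
  \<comment> \<open>Each \<open>Arg\<close> term is below pi/2 in modulus. This excludes the lobe
    (-2 pi, -pi) and everything to its left.\<close>
  have b: "turn a y - turn a x > - pi"
    using Arg_step_bound[OF assms(1), of "-2*x"] Arg_step_bound[OF assms(1), of "-2*y"] assms(2)
    unfolding turn_def by linarith
  show ?thesis
  proof (rule ccontr)
    assume "\<not> turn a x < turn a y"
    hence "sin (turn a x - turn a y) \<ge> 0" using b by (intro sin_ge_zero) auto
    moreover have "sin (turn a x - turn a y) = - sin (turn a y - turn a x)"
      by (metis minus_diff_eq sin_minus)
    ultimately show False using sp by linarith
  qed
qed

lemma turn_pi_nat: "turn a (t + pi * real n) = turn a t + pi * real n"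
proof (induction n)
  case (Suc n)
  have "turn a (t + pi * real (Suc n)) = turn a ((t + pi * real n) + pi)"
    by (simp add: algebra_simps)
  thus ?case unfolding turn_pi Suc by (simp add: algebra_simps)
qed simp

lemma turn_pi_int: "turn a (t + pi * of_int k) = turn a t + pi * of_int k"
proof (cases "k \<ge> 0")
  case True
  thus ?thesis using turn_pi_nat[of a t "nat k"] by simp
next
  case False
  thus ?thesis using turn_pi_nat[of a "t + pi * of_int k" "nat (-k)"] by simp
qed

lemma strict_mono_turn:
  assumes "cmod a < 1"
  shows "strict_mono (turn a)"
proof (rule strict_monoI)
  fix x y :: real assume "x < y"
  define n where "n = nat \<lfloor>(y - x) / pi\<rfloor>"
  have n: "real n \<le> (y - x) / pi" "(y - x) / pi < real n + 1"
    using \<open>x < y\<close> by (auto simp: n_def)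
  hence n': "x + pi * real n \<le> y" "y < x + pi * real n + pi"
    by (simp_all add: field_simps)
  show "turn a x < turn a y"
  proof (cases "x + pi * real n = y")
    case True
    hence "turn a y = turn a x + pi * real n" using turn_pi_nat by metis
    moreover have "pi * real n > 0" using True \<open>x < y\<close> by linarith
    ultimately show ?thesis by linarith
  next
    case False
    hence "turn a (x + pi * real n) < turn a y"
      using n' by (intro turn_less_aux[OF assms]) auto
    thus ?thesis unfolding turn_pi_nat by (smt (verit) pi_ge_zero mult_nonneg_nonneg of_nat_0_le_iff)
  qed
qed

section \<open>Dependence of lifted angles on the initial angle and on \<theta>\<close>

lemma ang_pi_int: "ang a \<theta> (x + pi * of_int k) n = ang a \<theta> x n + pi * of_int k"
  by (induction n) (simp_all add: turn_pi_int flip: add.assoc)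

lemma turn_less_iff: "cmod a < 1 \<Longrightarrow> turn a x < turn a y \<longleftrightarrow> x < y"
  using strict_mono_turn strict_mono_less by blast

lemma ang_less_iff:
  "(\<And>n. cmod (a n) < 1) \<Longrightarrow> ang a \<theta> x n < ang a \<theta> y n \<longleftrightarrow> x < y"
  by (induction n) (auto simp: turn_less_iff)

lemma ang_le_iff:
  "(\<And>n. cmod (a n) < 1) \<Longrightarrow> ang a \<theta> x n \<le> ang a \<theta> y n \<longleftrightarrow> x \<le> y"
  using ang_less_iff[of a \<theta> y n x] by (auto simp: not_less[symmetric])

lemma ang_mono_theta:
  assumes "\<And>n. cmod (a n) < 1" "\<theta> < \<theta>'"
  shows "ang a \<theta> x (Suc n) < ang a \<theta>' x (Suc n)"
proof (induction n)
  case (Suc n)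
  have "\<theta>/2 + ang a \<theta> x (Suc n) < \<theta>'/2 + ang a \<theta>' x (Suc n)"
    using Suc assms(2) by (simp del: ang.simps)
  thus ?case using assms(1) turn_less_iff by simp
qed (use assms in \<open>auto simp: turn_less_iff\<close>)

lemma ang_mono_theta_weak:
  assumes "\<And>n. cmod (a n) < 1" "\<theta> \<le> \<theta>'"
  shows "ang a \<theta> x n \<le> ang a \<theta>' x n"
  using ang_mono_theta[of a \<theta> \<theta>' x] assms by (cases n; cases "\<theta> = \<theta>'") (auto intro: less_imp_le)

text \<open>A shift of \<theta> by 2 pi multiplies each step by -1 and so adds pi to the lifted
  angle. The total of n pi accounts for the n zeros of a paraorthogonal polynomial of degree
  n.\<close>

lemma ang_theta_2pi: "ang a (\<theta> + 2 * pi) x n = ang a \<theta> x n + pi * real n"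
proof (induction n)
  case (Suc n)
  have "(\<theta> + 2 * pi)/2 + ang a (\<theta> + 2 * pi) x n = (\<theta>/2 + ang a \<theta> x n) + pi * real (Suc n)"
    unfolding Suc by (simp add: algebra_simps add_divide_distrib)
  hence "ang a (\<theta> + 2 * pi) x (Suc n) = turn (a n) ((\<theta>/2 + ang a \<theta> x n) + pi * real (Suc n))"
    by (simp only: ang.simps)
  thus ?case by (simp only: turn_pi_nat ang.simps)
qed simp

lemma ang_diff_le_pi:
  assumes "\<And>n. cmod (a n) < 1" "\<bar>x - y\<bar> \<le> pi"
  shows "\<bar>ang a \<theta> x n - ang a \<theta> y n\<bar> \<le> pi"
proof -
  have "ang a \<theta> (y + pi * of_int (-1)) n \<le> ang a \<theta> x n" "ang a \<theta> x n \<le> ang a \<theta> (y + pi * of_int 1) n"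
    using assms(2) unfolding ang_le_iff[OF assms(1)] by auto
  thus ?thesis unfolding ang_pi_int by simp
qed

text \<open>A shift by a multiple of pi commutes with the recursion and brings the initial angles
  within pi, where order preservation keeps them. Phase growth can thus be computed along whichever
  solution is convenient.\<close>

lemma ang_increment_diff:
  assumes "\<And>n. cmod (a n) < 1"
  shows "\<bar>(ang a \<theta> x m - ang a \<theta> x n) - (ang a \<theta> y m - ang a \<theta> y n)\<bar> \<le> 2 * pi"
proof -
  define k where "k = \<lfloor>(x - y) / pi\<rfloor>"
  have "of_int k \<le> (x - y) / pi" "(x - y) / pi < of_int k + 1"
    by (auto simp: k_def)
  hence "pi * of_int k \<le> x - y" "x - y \<le> pi * of_int k + pi"
    by (simp_all add: field_simps)
  hence "\<bar>x - (y + pi * of_int k)\<bar> \<le> pi" by simp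
  from ang_diff_le_pi[where a=a and \<theta>=\<theta> and n=m, OF assms this]
    ang_diff_le_pi[where a=a and \<theta>=\<theta> and n=n, OF assms this]
  show ?thesis unfolding ang_pi_int by linarith
qed

lemma sol_polar:
  assumes "\<And>n. cmod (a n) < 1" "r > 0"
  shows "\<exists>s>0. sol a \<theta> (of_real r * cis x) n = of_real s * cis (ang a \<theta> x n)"
proof (induction n)
  case (Suc n)
  then obtain s where s: "s > 0" "sol a \<theta> (of_real r * cis x) n = of_real s * cis (ang a \<theta> x n)"
    by blast
  define s' where "s' = s * cmod (1 - cnj (a n) * cis (- 2 * (\<theta>/2 + ang a \<theta> x n))) / szego_rho (a n)"
  have "s' > 0"
    unfolding s'_def
    using s(1) szego_rho_pos[OF assms(1)]
      step_diff_Re_pos[OF assms(1), of n "- 2 * (\<theta>/2 + ang a \<theta> x n)"]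
    by (intro divide_pos_pos mult_pos_pos norm_pos_if_Re_pos)
  moreover have "sol a \<theta> (of_real r * cis x) (Suc n) = of_real s' * cis (ang a \<theta> x (Suc n))"
    by (simp only: sol.simps s(2) szego_step_polar[OF assms(1)] s'_def ang.simps)
  ultimately show ?case by blast
qed (use assms in auto)

lemma continuous_on_turn:
  assumes "\<And>x. x \<in> S \<Longrightarrow> cmod (f x) < 1" "continuous_on S f" "continuous_on S g"
  shows "continuous_on S (\<lambda>x. turn (f x) (g x))"
  unfolding turn_def
proof (intro continuous_intros continuous_on_Arg' assms)
  fix z assume "z \<in> S"
  thus "1 - cnj (f z) * cis (- 2 * g z) \<notin> \<real>\<^sub>\<le>\<^sub>0"
    using step_diff_Re_pos[OF assms(1)[OF \<open>z \<in> S\<close>], of "- 2 * g z"]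
    by (auto simp only: complex_nonpos_Reals_iff)
qed

section \<open>Transfer matrices and rotation numbers\<close>

lemma szego_step_add: "szego_step a \<theta> (f + g) = szego_step a \<theta> f + szego_step a \<theta> g"
  by (simp add: szego_step_def distrib_left add_divide_distrib diff_divide_distrib)

lemma szego_step_scale: "szego_step a \<theta> (of_real r * f) = of_real r * szego_step a \<theta> f"
  by (simp add: szego_step_def algebra_simps)

lemma sol_add: "sol a \<theta> (f + g) n = sol a \<theta> f n + sol a \<theta> g n"
  by (induction n) (simp_all add: szego_step_add)

lemma sol_scale: "sol a \<theta> (of_real r * f) n = of_real r * sol a \<theta> f n"
  by (induction n) (simp_all add: szego_step_scale)

text \<open>Every real-linear map of the plane has the form \<open>A * f + B * cnj f\<close>;
  \<open>tm_diag\<close> and \<open>tm_off\<close> are these two parts of the n-step map. Its trace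
  is \<open>2 * Re A\<close> and its determinant \<open>|A|^2 - |B|^2\<close>.\<close>

definition tm_diag :: "(nat \<Rightarrow> complex) \<Rightarrow> real \<Rightarrow> nat \<Rightarrow> complex" where
  "tm_diag a \<theta> n = (sol a \<theta> 1 n - \<i> * sol a \<theta> \<i> n) / 2"

definition tm_off :: "(nat \<Rightarrow> complex) \<Rightarrow> real \<Rightarrow> nat \<Rightarrow> complex" where
  "tm_off a \<theta> n = (sol a \<theta> 1 n + \<i> * sol a \<theta> \<i> n) / 2"

lemma sol_eq_tm: "sol a \<theta> f n = tm_diag a \<theta> n * f + tm_off a \<theta> n * cnj f"
proof -
  have "sol a \<theta> f n = sol a \<theta> (of_real (Re f) * 1 + of_real (Im f) * \<i>) n"
    by (rule arg_cong[where f = "\<lambda>f. sol a \<theta> f n"]) (simp add: complex_eq_iff)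
  also have "\<dots> = of_real (Re f) * sol a \<theta> 1 n + of_real (Im f) * sol a \<theta> \<i> n"
    by (simp only: sol_add sol_scale)
  also have "\<dots> = tm_diag a \<theta> n * (of_real (Re f) + \<i> * of_real (Im f))
      + tm_off a \<theta> n * (of_real (Re f) - \<i> * of_real (Im f))"
    by (simp add: tm_diag_def tm_off_def field_simps)
  also have "of_real (Re f) + \<i> * of_real (Im f) = f" by (rule complex_eq[symmetric])
  also have "of_real (Re f) - \<i> * of_real (Im f) = cnj f" by (simp add: complex_eq_iff)
  finally show ?thesis .
qed

lemma tm_det:
  assumes "\<And>n. cmod (a n) < 1"
  shows "(cmod (tm_diag a \<theta> n))\<^sup>2 - (cmod (tm_off a \<theta> n))\<^sup>2 = 1"
proof -
  have "wronskian (sol a \<theta> 1 n) (sol a \<theta> \<i> n) = 1"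
    using wronskian_sol[of a \<theta> 1 n \<i>] assms by (simp add: wronskian_def)
  thus ?thesis unfolding sol_eq_tm wronskian_def cmod_power2
    by (simp add: algebra_simps power2_eq_square)
qed

text \<open>Where the half-trace of the unimodular transfer matrix is at least 1 in modulus, the
  eigenvalues are real, and an eigenvector \<^term>\<open>u\<close> is determined by \<^term>\<open>u\<^sup>2\<close>
  because diagonal and off-diagonal part of the eigenvalue equation have equal modulus.\<close>

lemma tm_eigenvector:
  assumes "\<And>n. cmod (a n) < 1" "\<bar>Re (tm_diag a \<theta> p)\<bar> \<ge> 1"
  obtains u l where "u \<noteq> 0" "sol a \<theta> u p = of_real l * u"
    "\<bar>Re (tm_diag a \<theta> p)\<bar> = 1 \<Longrightarrow> \<bar>l\<bar> = 1"
proof -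
  define A B where "A = tm_diag a \<theta> p" and "B = tm_off a \<theta> p"
  define l where "l = Re A + sqrt ((Re A)\<^sup>2 - 1)"
  have ge: "(Re A)\<^sup>2 \<ge> 1" using assms(2) by (simp add: A_def abs_square_less_1 flip: not_less)
  have det: "(cmod A)\<^sup>2 - (cmod B)\<^sup>2 = 1" using tm_det[of a \<theta> p] assms(1) by (simp add: A_def B_def)
  have l: "l\<^sup>2 = 2 * Re A * l - 1"
  proof -
    have "(l - Re A)\<^sup>2 = (Re A)\<^sup>2 - 1" using ge by (simp add: l_def)
    thus ?thesis by (simp add: power2_eq_square algebra_simps)
  qed
  have "(cmod (A - of_real l))\<^sup>2 = (cmod A)\<^sup>2 - 2 * Re A * l + l\<^sup>2"
    unfolding cmod_power2 by (simp add: power2_eq_square algebra_simps)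
  hence "(cmod (A - of_real l))\<^sup>2 = (cmod B)\<^sup>2" using det l by simp
  hence eq: "cmod (A - of_real l) = cmod B" by simp
  have l1: "\<bar>l\<bar> = 1" if "\<bar>Re A\<bar> = 1"
  proof -
    have "(Re A)\<^sup>2 = 1" using that by (metis power2_abs one_power2)
    thus ?thesis using that by (simp add: l_def)
  qed
  have "\<exists>u. u \<noteq> 0 \<and> A * u + B * cnj u = of_real l * u"
  proof (cases "B = 0")
    case True
    thus ?thesis using eq by (intro exI[of _ 1]) simp
  next
    case False
    define w where "w = - B / (A - of_real l)"
    define u where "u = csqrt w"
    have nz: "A - of_real l \<noteq> 0" using False eq by (metis norm_eq_zero)
    have w: "cmod w = 1" using False eq by (simp add: w_def norm_divide)
    have u2: "u\<^sup>2 = w" by (simp add: u_def)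
    have "(cmod u)\<^sup>2 = 1" unfolding norm_power[symmetric] u2 w ..
    hence "u * cnj u = 1" by (simp add: complex_norm_square[symmetric])
    hence "u = w * cnj u" unfolding u2[symmetric] by (simp add: power2_eq_square mult.assoc)
    hence "(A - of_real l) * u = (A - of_real l) * w * cnj u" by simp
    also have "(A - of_real l) * w = - B" using nz by (simp add: w_def)
    finally have "A * u + B * cnj u = of_real l * u" by (simp add: algebra_simps)
    moreover have "u \<noteq> 0" using u2 w by auto
    ultimately show ?thesis by blast
  qed
  thus ?thesis using that[of _ l] l1 unfolding sol_eq_tm A_def B_def by blast
qed

lemma continuous_on_sol [continuous_intros]: "continuous_on S (\<lambda>\<theta>. sol a \<theta> f n)"
proof (induction n)
  case (Suc n)
  show ?case
    unfolding sol.simps szego_step_def divide_inverse by (intro continuous_intros Suc)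
qed simp

lemma continuous_on_ang:
  assumes "\<And>n. cmod (a n) < 1"
  shows "continuous_on S (\<lambda>\<theta>. ang a \<theta> x n)"
proof (induction n)
  case (Suc n)
  show ?case
    unfolding ang.simps divide_inverse by (intro continuous_on_turn continuous_intros Suc assms)
qed simp

section \<open>Periodic coefficients and the rotation number in a gap\<close>

locale periodic_coefficients =
  fixes b :: "nat \<Rightarrow> complex" and p :: nat
  assumes b_less_1: "cmod (b n) < 1"
    and p_pos: "p > 0"
    and b_periodic: "b (n + p) = b n"
begin

definition half_trace :: "real \<Rightarrow> real" where
  "half_trace \<theta> = Re (tm_diag b \<theta> p)"

lemma b_periodic_mult: "b (n + k * p) = b n"
proof (induction k)
  case (Suc k)
  have "b (n + Suc k * p) = b ((n + k * p) + p)" by (simp add: ac_simps)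
  thus ?case using Suc b_periodic by simp
qed simp

lemma sol_shift: "sol b \<theta> f (n + k * p) = sol b \<theta> (sol b \<theta> f (k * p)) n"
  by (induction n) (simp_all add: b_periodic_mult)

lemma ang_shift: "ang b \<theta> x (n + p) = ang b \<theta> (ang b \<theta> x p) n"
  by (induction n) (simp_all add: b_periodic)

lemma continuous_on_half_trace: "continuous_on S half_trace"
  unfolding half_trace_def[abs_def] tm_diag_def by (intro continuous_intros) simp

text \<open>A real eigenvector returns to its own line after one period, so its lifted angle grows
  by exactly pi k per period; the initial angle 0 follows within 2 pi.\<close>

lemma rotation_exists:
  assumes "\<bar>half_trace \<theta>\<bar> \<ge> 1"
  shows "\<exists>k::int. \<forall>n. \<bar>ang b \<theta> 0 (n * p) - pi * of_int k * real n\<bar> \<le> 2 * pi"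
proof -
  obtain u l where u: "u \<noteq> 0" "sol b \<theta> u p = of_real l * u"
    using tm_eigenvector[of b \<theta> p] b_less_1 assms unfolding half_trace_def by blast
  define x where "x = Arg u"
  have up: "u = of_real (cmod u) * cis x"
    unfolding x_def by (metis rcis_cmod_Arg rcis_def)
  obtain s where s: "s > 0" "sol b \<theta> u p = of_real s * cis (ang b \<theta> x p)"
    using sol_polar[where a=b and r="cmod u" and \<theta>=\<theta> and x=x and n=p, OF b_less_1] u(1)
    by (auto simp flip: up)
  have "wronskian u (of_real l * u) = 0" by (simp add: wronskian_def algebra_simps)
  hence "wronskian (of_real (cmod u) * cis x) (of_real s * cis (ang b \<theta> x p)) = 0"
    using s(2) u(2) by (simp flip: up)
  hence "sin (ang b \<theta> x p - x) = 0"
    unfolding wronskian_polar using u(1) s(1) by simp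
  then obtain k :: int where "ang b \<theta> x p - x = of_int k * pi"
    by (auto simp: sin_zero_iff_int2)
  hence k: "ang b \<theta> x p = x + pi * of_int k" by (simp add: algebra_simps)
  have an: "ang b \<theta> x (n * p) = x + pi * of_int k * real n" for n
  proof (induction n)
    case (Suc n)
    have "ang b \<theta> x (Suc n * p) = ang b \<theta> (x + pi * of_int k) (n * p)"
      using ang_shift[of \<theta> x "n * p"] k by (simp add: add.commute)
    thus ?case unfolding ang_pi_int Suc by (simp add: algebra_simps)
  qed simp
  have "\<bar>ang b \<theta> 0 (n * p) - pi * of_int k * real n\<bar> \<le> 2 * pi" for n
    using ang_increment_diff[where a=b and \<theta>=\<theta> and x=x and y=0 and m="n*p" and n=0, OF b_less_1]
    unfolding an by simp
  thus ?thesis by blast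
qed

text \<open>The integer rotation number is trapped within 2/5 of a continuous function of \<theta>.
  An increase would force that function through a half-integer, and a decrease contradicts
  monotonicity in \<theta>.\<close>

lemma rotation_locally_constant:
  assumes "s \<le> t" "\<And>\<theta>. \<theta> \<in> {s..t} \<Longrightarrow> \<bar>half_trace \<theta>\<bar> \<ge> 1"
  shows "\<bar>ang b t 0 (n * p) - ang b s 0 (n * p)\<bar> \<le> 4 * pi"
proof -
  have "\<forall>\<theta>\<in>{s..t}. \<exists>k::int. \<forall>n. \<bar>ang b \<theta> 0 (n * p) - pi * of_int k * real n\<bar> \<le> 2 * pi"
    using rotation_exists assms(2) by blast
  then obtain k :: "real \<Rightarrow> int" where
    k: "\<And>\<theta> n. \<theta> \<in> {s..t} \<Longrightarrow> \<bar>ang b \<theta> 0 (n * p) - pi * of_int (k \<theta>) * real n\<bar> \<le> 2 * pi"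
    by metis
  \<comment> \<open>Five is the least number of periods for which the error
    \<open>2 * pi / (5 * pi)\<close> is below 1/2.\<close>
  define g where "g = (\<lambda>\<theta>. ang b \<theta> 0 (5 * p) / (5 * pi))"
  have g: "\<bar>g \<theta> - of_int (k \<theta>)\<bar> \<le> 2 / 5" if "\<theta> \<in> {s..t}" for \<theta>
  proof -
    have "g \<theta> - of_int (k \<theta>) = (ang b \<theta> 0 (5 * p) - pi * of_int (k \<theta>) * 5) / (5 * pi)"
      by (simp add: g_def field_simps)
    also have "\<bar>\<dots>\<bar> = \<bar>ang b \<theta> 0 (5 * p) - pi * of_int (k \<theta>) * 5\<bar> / (5 * pi)"
      by (simp add: abs_divide)
    also have "\<dots> \<le> 2 * pi / (5 * pi)"
      using k[OF that, of 5] by (intro divide_right_mono) simp_all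
    finally show ?thesis by simp
  qed
  have cont: "continuous_on {s..t} g"
    unfolding g_def by (intro continuous_intros continuous_on_ang b_less_1) simp
  have "k s = k t"
  proof (rule linorder_cases[of "k s" "k t"])
    assume "k s < k t"
    hence "of_int (k s) + 1 \<le> (of_int (k t) :: real)" by linarith
    moreover have "\<bar>g s - of_int (k s)\<bar> \<le> 2/5" "\<bar>g t - of_int (k t)\<bar> \<le> 2/5"
      using g assms(1) by auto
    ultimately have "g s \<le> of_int (k s) + 1/2" "of_int (k s) + 1/2 \<le> g t"
      by linarith+
    from IVT'[OF this assms(1) cont] obtain \<theta> where
      "\<theta> \<in> {s..t}" "g \<theta> = of_int (k s) + 1/2" by auto
    with g[of \<theta>] have "\<bar>of_int (k s) + 1/2 - of_int (k \<theta>)\<bar> \<le> (2/5::real)" by simp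
    hence "\<bar>of_int (k s - k \<theta>) + 1/2\<bar> \<le> (2/5::real)" by (simp add: diff_add_eq)
    moreover have "k s - k \<theta> \<ge> 0 \<or> k s - k \<theta> \<le> - 1"
      by linarith
    hence "of_int (k s - k \<theta>) \<ge> (0::real) \<or> of_int (k s - k \<theta>) \<le> real_of_int (-1)"
      by (simp only: of_int_le_iff of_int_0_le_iff)
    ultimately show ?thesis by linarith
  next
    assume "k t < k s"
    hence "of_int (k t) + 1 \<le> (of_int (k s) :: real)" by linarith
    moreover have "g s \<le> g t"
      unfolding g_def using ang_mono_theta_weak[where a=b, OF b_less_1 assms(1)]
      by (intro divide_right_mono) auto
    moreover have "\<bar>g s - of_int (k s)\<bar> \<le> 2/5" "\<bar>g t - of_int (k t)\<bar> \<le> 2/5"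
      using g assms(1) by auto
    ultimately show ?thesis by linarith
  qed
  thus ?thesis using k[of s n] k[of t n] assms(1) by auto
qed

text \<open>Otherwise the whole circle would behave like one gap, on which angles differ by at most
  4 pi, whereas one full turn adds pi for each of the \<open>5 * p\<close> steps.\<close>

lemma band_nonempty: "\<exists>\<theta>. \<bar>half_trace \<theta>\<bar> < 1"
proof (rule ccontr)
  assume "\<not> ?thesis"
  hence "\<bar>ang b (0 + 2 * pi) 0 (5 * p) - ang b 0 0 (5 * p)\<bar> \<le> 4 * pi"
    using rotation_locally_constant[of 0 "2 * pi" 5] by (simp add: not_less)
  hence "pi * real (5 * p) \<le> pi * 4"
    unfolding ang_theta_2pi by simp
  thus False using p_pos by (simp del: of_nat_mult)
qed

end

section \<open>Perturbation in the interior of a band\<close>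

lemma abs_wronskian_le: "\<bar>wronskian f g\<bar> \<le> cmod f * cmod g"
  unfolding wronskian_def by (metis abs_Im_le_cmod complex_mod_cnj norm_mult)

lemma wronskian_diff_right: "wronskian f (g - h) = wronskian f g - wronskian f h"
  by (simp add: wronskian_def algebra_simps)

lemma wronskian_swap: "wronskian f g = - wronskian g f"
  by (simp add: wronskian_def algebra_simps)

lemma wronskian_expand:
  assumes "wronskian u w = 1"
  shows "Y = of_real (wronskian Y w) * u + of_real (wronskian u Y) * w"
proof -
  have 1: "Re u * Im w - Im u * Re w = 1" using assms by (simp add: wronskian_def)
  have "Re Y = Re Y * (Re u * Im w - Im u * Re w)" "Im Y = Im Y * (Re u * Im w - Im u * Re w)"
    unfolding 1 by simp_all
  thus ?thesis by (simp add: complex_eq_iff wronskian_def algebra_simps)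
qed

lemma szego_rho_ge:
  assumes "cmod a \<le> r" "r < 1"
  shows "sqrt (1 - r\<^sup>2) \<le> szego_rho a"
  unfolding szego_rho_def using assms by (simp add: power_mono)

lemma cmod_szego_step_le:
  assumes "cmod a \<le> r" "r < 1"
  shows "cmod (szego_step a \<theta> f) \<le> 2 / sqrt (1 - r\<^sup>2) * cmod f"
proof -
  have r0: "0 \<le> r" using assms norm_ge_zero order_trans by blast
  have s: "sqrt (1 - r\<^sup>2) > 0" using assms r0 by (simp add: abs_square_less_1)
  have "cmod (cis (\<theta>/2) * f - cnj (a * cis (\<theta>/2) * f)) \<le> cmod f + cmod a * cmod f"
    using norm_triangle_ineq4[of "cis (\<theta>/2) * f" "cnj (a * cis (\<theta>/2) * f)"]
    by (simp add: norm_mult)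
  also have "\<dots> \<le> 1 * cmod f + 1 * cmod f"
    using assms by (intro add_mono mult_right_mono) auto
  finally have "cmod (cis (\<theta>/2) * f - cnj (a * cis (\<theta>/2) * f)) \<le> 2 * cmod f" by simp
  hence "cmod (szego_step a \<theta> f) \<le> 2 * cmod f / sqrt (1 - r\<^sup>2)"
    unfolding szego_step_def norm_divide norm_of_real
    using s szego_rho_ge[OF assms] by (intro frac_le) auto
  thus ?thesis by simp
qed

text \<open>The factor 3 collects 2 from the change of the normalization and 1 from the change of
  the coefficient; a uniform distance from the unit circle controls the denominators.\<close>

lemma cmod_szego_step_diff_le:
  assumes "cmod a \<le> r" "cmod b \<le> r" "r < 1"
  shows "cmod (szego_step a \<theta> f - szego_step b \<theta> f) \<le> 3 / sqrt (1 - r\<^sup>2) ^ 3 * cmod (a - b) * cmod f"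
proof -
  define S where "S = sqrt (1 - r\<^sup>2)"
  define A B where "A = szego_rho a" and "B = szego_rho b"
  define h where "h = cis (\<theta>/2) * f"
  have r0: "0 \<le> r" using assms norm_ge_zero order_trans by blast
  have S: "S > 0" "S \<le> 1" using assms r0 by (simp_all add: S_def abs_square_less_1)
  have AB: "S \<le> A" "S \<le> B" "B \<le> 1"
    using assms szego_rho_ge szego_rho_le_1 by (auto simp: A_def B_def S_def)
  have sq: "A\<^sup>2 = 1 - (cmod a)\<^sup>2" "B\<^sup>2 = 1 - (cmod b)\<^sup>2"
    using assms by (simp_all add: A_def B_def szego_rho_sq)
  \<comment> \<open>Difference of squares, from \<open>B^2 - A^2 = |a|^2 - |b|^2\<close>: dividing
    by \<open>A + B \<ge> 2 * S\<close> gives a Lipschitz bound for the square roots.\<close>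
  have "(B - A) * (A + B) = (cmod a - cmod b) * (cmod a + cmod b)"
    using sq by (simp add: power2_eq_square algebra_simps)
  hence "\<bar>(B - A) * (A + B)\<bar> = \<bar>(cmod a - cmod b) * (cmod a + cmod b)\<bar>" by (rule arg_cong)
  hence "\<bar>B - A\<bar> * (A + B) = \<bar>cmod a - cmod b\<bar> * (cmod a + cmod b)"
    using AB S by (simp add: abs_mult)
  also have "\<dots> \<le> cmod (a - b) * 2"
    using assms by (intro mult_mono norm_triangle_ineq3) auto
  finally have "\<bar>B - A\<bar> * (A + B) \<le> cmod (a - b) * 2" .
  moreover have "\<bar>B - A\<bar> * (2 * S) \<le> \<bar>B - A\<bar> * (A + B)"
    using AB by (intro mult_left_mono) auto
  ultimately have BA: "\<bar>B - A\<bar> * S \<le> cmod (a - b)" by simp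
  have hf: "cmod h = cmod f" by (simp add: h_def norm_mult)
  have num: "cmod (of_real (B - A) * (h - cnj (a * h)) - of_real A * cnj ((a - b) * h))
      \<le> \<bar>B - A\<bar> * (2 * cmod f) + 1 * (cmod (a - b) * cmod f)"
  proof -
    have "cmod (h - cnj (a * h)) \<le> cmod h + cmod a * cmod h"
      using norm_triangle_ineq4[of h "cnj (a * h)"] by (simp add: norm_mult)
    also have "\<dots> \<le> 1 * cmod h + 1 * cmod h"
      using assms by (intro add_mono mult_right_mono) auto
    finally have h: "cmod (h - cnj (a * h)) \<le> 2 * cmod f" by (simp add: hf)
    have "cmod (of_real (B - A) * (h - cnj (a * h)) - of_real A * cnj ((a - b) * h))
        \<le> \<bar>B - A\<bar> * cmod (h - cnj (a * h)) + \<bar>A\<bar> * (cmod (a - b) * cmod f)"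
      using norm_triangle_ineq4[of "of_real (B - A) * (h - cnj (a * h))" "of_real A * cnj ((a - b) * h)"]
      by (simp only: norm_mult norm_of_real complex_mod_cnj hf)
    also have "\<dots> \<le> \<bar>B - A\<bar> * (2 * cmod f) + 1 * (cmod (a - b) * cmod f)"
      using h AB S szego_rho_le_1[of a] by (intro add_mono mult_left_mono mult_right_mono) (auto simp: A_def)
    finally show ?thesis .
  qed
  have "szego_step a \<theta> f - szego_step b \<theta> f
      = (of_real (B - A) * (h - cnj (a * h)) - of_real A * cnj ((a - b) * h)) / of_real (A * B)"
    unfolding szego_step_def A_def[symmetric] B_def[symmetric]
    using AB S by (simp add: h_def field_simps)
  also have "cmod \<dots> = cmod (of_real (B - A) * (h - cnj (a * h)) - of_real A * cnj ((a - b) * h)) / (A * B)"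
    unfolding norm_divide norm_of_real using AB S by simp
  also have "\<dots> \<le> (\<bar>B - A\<bar> * (2 * cmod f) + 1 * (cmod (a - b) * cmod f)) / (A * B)"
    using num AB S by (intro divide_right_mono) auto
  also have "\<dots> \<le> (\<bar>B - A\<bar> * (2 * cmod f) + 1 * (cmod (a - b) * cmod f)) / (S * S)"
    using AB S by (intro divide_left_mono mult_mono mult_pos_pos) auto
  also have "\<dots> = (\<bar>B - A\<bar> * S * (2 * cmod f) + S * (cmod (a - b) * cmod f)) / S ^ 3"
    using S by (simp add: field_simps power3_eq_cube)
  also have "\<dots> \<le> (cmod (a - b) * (2 * cmod f) + 1 * (cmod (a - b) * cmod f)) / S ^ 3"
    using S BA by (intro divide_right_mono add_mono mult_right_mono) auto
  also have "\<dots> = 3 / S ^ 3 * cmod (a - b) * cmod f"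
    by (simp add: field_simps)
  finally show ?thesis by (simp add: S_def)
qed

text \<open>A common step would leave the wronskian unchanged, so its increment sees only the
  difference of two steps applied to one vector. This is discrete variation of constants.\<close>

lemma wronskian_sol_increment_right:
  assumes "\<And>n. cmod (a n) \<le> r" "\<And>n. cmod (b n) \<le> r" "r < 1"
  shows "\<bar>wronskian (sol b \<theta> g (Suc n)) (sol a \<theta> f (Suc n)) - wronskian (sol b \<theta> g n) (sol a \<theta> f n)\<bar>
    \<le> 3 / sqrt (1 - r\<^sup>2) ^ 3 * cmod (a n - b n) * cmod (sol a \<theta> f n) * cmod (sol b \<theta> g (Suc n))"
proof -
  have b1: "cmod (b n) < 1" using assms(2)[of n] assms(3) by linarith
  have "wronskian (sol b \<theta> g (Suc n)) (sol a \<theta> f (Suc n)) - wronskian (sol b \<theta> g n) (sol a \<theta> f n)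
      = wronskian (sol b \<theta> g (Suc n)) (szego_step (a n) \<theta> (sol a \<theta> f n) - szego_step (b n) \<theta> (sol a \<theta> f n))"
    using wronskian_step[OF b1, of \<theta> "sol b \<theta> g n" "sol a \<theta> f n"] by (simp add: wronskian_diff_right)
  also have "\<bar>\<dots>\<bar> \<le> cmod (sol b \<theta> g (Suc n)) *
      cmod (szego_step (a n) \<theta> (sol a \<theta> f n) - szego_step (b n) \<theta> (sol a \<theta> f n))"
    by (rule abs_wronskian_le)
  also have "\<dots> \<le> cmod (sol b \<theta> g (Suc n)) *
      (3 / sqrt (1 - r\<^sup>2) ^ 3 * cmod (a n - b n) * cmod (sol a \<theta> f n))"
    using assms by (intro mult_left_mono cmod_szego_step_diff_le) auto
  finally show ?thesis by (simp add: mult_ac)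
qed

lemma gronwall_summable:
  fixes z d :: "nat \<Rightarrow> real"
  assumes "\<And>n. z (Suc n) \<le> z n * (1 + d n)" "\<And>n. d n \<ge> 0" "summable d" "z 0 \<ge> 0"
  shows "z n \<le> z 0 * exp (suminf d)"
proof -
  have "z n \<le> z 0 * exp (sum d {..<n})"
  proof (induction n)
    case (Suc n)
    have "z (Suc n) \<le> z n * (1 + d n)" by (rule assms(1))
    also have "\<dots> \<le> z 0 * exp (sum d {..<n}) * (1 + d n)"
      using Suc assms(2) by (intro mult_right_mono) (auto simp: add_nonneg_nonneg)
    also have "\<dots> \<le> z 0 * exp (sum d {..<n}) * exp (d n)"
      using assms(4) by (intro mult_left_mono exp_ge_add_one_self) auto
    finally show ?case by (simp add: exp_add mult_ac)
  qed simp
  also have "\<dots> \<le> z 0 * exp (suminf d)"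
    using assms by (intro mult_left_mono) (auto intro: sum_le_suminf)
  finally show ?thesis .
qed

text \<open>Wronskians with two unperturbed solutions are the coordinates of the perturbed one.
  Boundedness of the unperturbed solutions makes the increments at most a constant times
  \<open>|a n - b n|\<close> times the coordinates, and Gronwall applies.\<close>

lemma perturbed_bounded:
  assumes r: "\<And>n. cmod (a n) \<le> r" "\<And>n. cmod (b n) \<le> r" "r < 1"
    and d: "summable (\<lambda>n. cmod (a n - b n))"
    and bd: "\<And>f. \<exists>C. \<forall>n. cmod (sol b \<theta> f n) \<le> C"
  shows "\<exists>C. \<forall>n. cmod (sol a \<theta> f n) \<le> C"
proof -
  obtain C1 C2 where "\<And>n. cmod (sol b \<theta> 1 n) \<le> C1" "\<And>n. cmod (sol b \<theta> \<i> n) \<le> C2"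
    using bd by metis
  then obtain C where C: "\<And>n. cmod (sol b \<theta> 1 n) \<le> C" "\<And>n. cmod (sol b \<theta> \<i> n) \<le> C"
    by (metis max.coboundedI1 max.coboundedI2)
  have C0: "C \<ge> 0" using C(1)[of 0] by simp
  define K where "K = 3 / sqrt (1 - r\<^sup>2) ^ 3"
  have "0 \<le> r" using r(1) norm_ge_zero order_trans by blast
  hence K0: "K \<ge> 0" using r(3) by (simp add: K_def abs_square_le_1)
  define x y where "x = (\<lambda>n. wronskian (sol b \<theta> 1 n) (sol a \<theta> f n))"
    and "y = (\<lambda>n. wronskian (sol b \<theta> \<i> n) (sol a \<theta> f n))"
  define z where "z = (\<lambda>n. \<bar>x n\<bar> + \<bar>y n\<bar>)"
  have b1: "\<And>n. cmod (b n) < 1" using r le_less_trans by blast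
  have Y: "cmod (sol a \<theta> f n) \<le> C * z n" for n
  proof -
    have "wronskian (sol b \<theta> 1 n) (sol b \<theta> \<i> n) = 1"
      using wronskian_sol[of b \<theta> 1 n \<i>] b1 by (simp add: wronskian_def)
    from wronskian_expand[OF this, of "sol a \<theta> f n"]
    have "sol a \<theta> f n = of_real (- y n) * sol b \<theta> 1 n + of_real (x n) * sol b \<theta> \<i> n"
      by (simp add: x_def y_def wronskian_swap[of "sol a \<theta> f n"])
    also have "cmod \<dots> \<le> \<bar>y n\<bar> * cmod (sol b \<theta> 1 n) + \<bar>x n\<bar> * cmod (sol b \<theta> \<i> n)"
      by (rule order_trans[OF norm_triangle_ineq]) (simp add: norm_mult)
    also have "\<dots> \<le> \<bar>y n\<bar> * C + \<bar>x n\<bar> * C"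
      using C by (intro add_mono mult_left_mono) auto
    finally show ?thesis by (simp add: z_def algebra_simps)
  qed
  have inc: "K * cmod (a n - b n) * cmod (sol a \<theta> f n) * cmod (sol b \<theta> g (Suc n))
      \<le> K * cmod (a n - b n) * (C * z n) * C" if "g = 1 \<or> g = \<i>" for n g
    using Y K0 C that C0 by (intro mult_mono) (auto simp: z_def simp del: sol.simps)
  have "z (Suc n) \<le> z n * (1 + 2 * K * C * C * cmod (a n - b n))" for n
  proof -
    have "\<bar>x (Suc n) - x n\<bar> \<le> K * cmod (a n - b n) * (C * z n) * C"
      using wronskian_sol_increment_right[where a=a and b=b and r=r, OF r, of \<theta> 1 n f] inc[OF disjI1[OF refl], of n]
      unfolding x_def K_def by (rule order_trans)
    moreover have "\<bar>y (Suc n) - y n\<bar> \<le> K * cmod (a n - b n) * (C * z n) * C"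
      using wronskian_sol_increment_right[where a=a and b=b and r=r, OF r, of \<theta> \<i> n f] inc[OF disjI2[OF refl], of n]
      unfolding y_def K_def by (rule order_trans)
    ultimately have "z (Suc n) \<le> z n + 2 * (K * cmod (a n - b n) * (C * z n) * C)"
      unfolding z_def by linarith
    thus ?thesis by (simp add: algebra_simps)
  qed
  hence zb: "z n \<le> z 0 * exp (suminf (\<lambda>n. 2 * K * C * C * cmod (a n - b n)))" for n
    using K0 C0 d by (intro gronwall_summable) (auto simp: z_def intro!: summable_mult mult_nonneg_nonneg)
  have "cmod (sol a \<theta> f n) \<le> C * (z 0 * exp (suminf (\<lambda>n. 2 * K * C * C * cmod (a n - b n))))" for n
    using Y[of n] zb[of n] C0 by (meson mult_left_mono order_trans)
  thus ?thesis by blast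
qed

lemma cmod_sol_le:
  assumes "\<And>n. cmod (a n) \<le> r" "r < 1"
  shows "cmod (sol a \<theta> f n) \<le> (2 / sqrt (1 - r\<^sup>2)) ^ n * cmod f"
proof (induction n)
  case (Suc n)
  have "0 \<le> r" using assms norm_ge_zero order_trans by blast
  hence "2 / sqrt (1 - r\<^sup>2) \<ge> 0" using assms(2) by (simp add: abs_square_le_1)
  hence "2 / sqrt (1 - r\<^sup>2) * cmod (sol a \<theta> f n)
      \<le> 2 / sqrt (1 - r\<^sup>2) * ((2 / sqrt (1 - r\<^sup>2)) ^ n * cmod f)"
    using Suc by (rule mult_left_mono[rotated])
  thus ?case
    using cmod_szego_step_le[of "a n" r \<theta> "sol a \<theta> f n"] assms by simp
qed simp

lemma (in periodic_coefficients) b_uniform: "\<exists>r<1. \<forall>n. cmod (b n) \<le> r"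
proof -
  define r where "r = Max ((\<lambda>n. cmod (b n)) ` {..<p})"
  have "r < 1" unfolding r_def using p_pos b_less_1 by (subst Max_less_iff) auto
  moreover have "cmod (b n) \<le> r" for n
  proof -
    have "b n = b (n mod p)" using b_periodic_mult[of "n mod p" "n div p"] by simp
    thus ?thesis unfolding r_def using p_pos by (intro Max_ge) auto
  qed
  ultimately show ?thesis by blast
qed

text \<open>Within one period a solution grows by at most a fixed factor, so estimates at multiples
  of \<open>p\<close> control all times.\<close>

lemma (in periodic_coefficients) block_bound:
  assumes "\<And>k. cmod (sol b \<theta> f (k * p)) \<le> C k"
  shows "\<exists>K>0. \<forall>n. cmod (sol b \<theta> f n) \<le> K * C (n div p)"
proof -
  obtain r where r: "r < 1" "\<And>n. cmod (b n) \<le> r" using b_uniform by blast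
  define q where "q = 2 / sqrt (1 - r\<^sup>2)"
  have "0 \<le> r" using r(2) norm_ge_zero order_trans by blast
  hence "q \<ge> 2" using r(1)
    by (simp add: q_def field_simps abs_square_less_1 abs_square_le_1)
  have "cmod (sol b \<theta> f n) \<le> q ^ p * C (n div p)" for n
  proof -
    have "cmod (sol b \<theta> f n) = cmod (sol b \<theta> (sol b \<theta> f (n div p * p)) (n mod p))"
      using sol_shift[of \<theta> f "n mod p" "n div p"] by simp
    also have "\<dots> \<le> q ^ (n mod p) * cmod (sol b \<theta> f (n div p * p))"
      unfolding q_def by (rule cmod_sol_le) (use r in auto)
    also have "\<dots> \<le> q ^ p * C (n div p)"
      using \<open>q \<ge> 2\<close> p_pos assms by (intro mult_mono power_increasing) (auto intro: less_imp_le)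
    finally show ?thesis .
  qed
  thus ?thesis using \<open>q \<ge> 2\<close> by (intro exI[of _ "q ^ p"]) auto
qed

text \<open>In the interior of a band the monodromy map \<open>T\<close> is elliptic: it preserves the definite
  quadratic form \<open>wronskian f (T f)\<close>.\<close>

lemma (in periodic_coefficients) band_bounded:
  assumes "\<bar>half_trace \<theta>\<bar> < 1"
  shows "\<exists>C. \<forall>n. cmod (sol b \<theta> f n) \<le> C"
proof -
  define A B where "A = tm_diag b \<theta> p" and "B = tm_off b \<theta> p"
  define Q where "Q = (\<lambda>f. wronskian f (sol b \<theta> f p))"
  \<comment> \<open>The coercivity constant of \<open>Q\<close>: the form is
    \<open>Im A * |g|^2\<close> plus a term bounded by \<open>|B| * |g|^2\<close>. Since
    \<open>|Im A|^2 - |B|^2 = 1 - (Re A)^2\<close>, it is positive exactly inside a band.\<close>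
  define c where "c = \<bar>Im A\<bar> - cmod B"
  have "(cmod A)\<^sup>2 - (cmod B)\<^sup>2 = 1" using tm_det[of b \<theta> p] b_less_1 by (simp add: A_def B_def)
  moreover have "(Re A)\<^sup>2 < 1" using assms by (simp add: half_trace_def A_def abs_square_less_1)
  ultimately have "(cmod B)\<^sup>2 < \<bar>Im A\<bar>\<^sup>2" unfolding cmod_power2 by simp
  hence c: "c > 0" unfolding c_def using power2_less_imp_less by fastforce
  have Qlow: "c * (cmod g)\<^sup>2 \<le> \<bar>Q g\<bar>" for g
  proof -
    have "Q g = Im A * (cmod g)\<^sup>2 + Im (B * (cnj g * cnj g))"
      unfolding Q_def wronskian_def sol_eq_tm A_def[symmetric] B_def[symmetric] cmod_power2
      by (simp add: algebra_simps power2_eq_square)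
    moreover have "\<bar>Im (B * (cnj g * cnj g))\<bar> \<le> cmod B * (cmod g)\<^sup>2"
      using abs_Im_le_cmod[of "B * (cnj g * cnj g)"] by (simp add: norm_mult power2_eq_square)
    moreover have "\<bar>Im A * (cmod g)\<^sup>2\<bar> = \<bar>Im A\<bar> * (cmod g)\<^sup>2" by (simp add: abs_mult)
    ultimately show ?thesis unfolding c_def left_diff_distrib by linarith
  qed
  have inv: "Q (sol b \<theta> f (k * p)) = Q f" for k
  proof (induction k)
    case (Suc k)
    have "sol b \<theta> (sol b \<theta> f (Suc k * p)) p = sol b \<theta> (sol b \<theta> (sol b \<theta> f (k * p)) p) p"
      using sol_shift[of \<theta> f p k] by simp
    moreover have "sol b \<theta> f (Suc k * p) = sol b \<theta> (sol b \<theta> f (k * p)) p"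
      using sol_shift[of \<theta> f p k] by simp
    ultimately have "Q (sol b \<theta> f (Suc k * p))
        = wronskian (sol b \<theta> (sol b \<theta> f (k * p)) p) (sol b \<theta> (sol b \<theta> (sol b \<theta> f (k * p)) p) p)"
      by (simp add: Q_def)
    thus ?case unfolding wronskian_sol[where a=b, OF b_less_1] using Suc by (simp add: Q_def)
  qed (simp add: Q_def)
  have "cmod (sol b \<theta> f (k * p)) \<le> sqrt (\<bar>Q f\<bar> / c)" for k
    using Qlow[of "sol b \<theta> f (k * p)"] c unfolding inv
    by (intro real_le_rsqrt) (simp add: field_simps)
  from block_bound[OF this] show ?thesis by blast
qed

section \<open>Perturbation at a band edge\<close>

lemma szego_step_surj:
  assumes "cmod a < 1"
  shows "\<exists>f. szego_step a \<theta> f = g"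
proof -
  define R where "R = szego_rho a"
  have R: "R > 0" "R\<^sup>2 = 1 - (cmod a)\<^sup>2"
    using szego_rho_pos[OF assms] szego_rho_sq[OF assms] by (simp_all add: R_def)
  \<comment> \<open>Explicit inverse of \<open>h - cnj (a * h)\<close>, whose determinant is
    \<open>R^2\<close>, applied to \<open>R * g\<close>.\<close>
  define h where "h = (g + cnj a * cnj g) / of_real R"
  have "h - cnj (a * h) = (1 - a * cnj a) * g / of_real R"
    using R by (simp add: h_def field_simps)
  also have "1 - a * cnj a = of_real (R\<^sup>2)"
    unfolding R complex_norm_square[symmetric] by simp
  also have "\<dots> * g / of_real R = of_real R * g"
    using R(1) by (simp add: power2_eq_square)
  finally have h: "h - cnj (a * h) = of_real R * g" .
  have 1: "cis (\<theta>/2) * (cis (- \<theta>/2) * h) = h"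
    by (simp add: mult.assoc[symmetric] cis_mult)
  have "szego_step a \<theta> (cis (- \<theta>/2) * h) = g"
    unfolding szego_step_def R_def[symmetric] mult.assoc 1 h using R(1) by simp
  thus ?thesis by blast
qed

text \<open>Serves to prescribe a solution at the far end of a time window.\<close>

lemma sol_surj:
  assumes "\<And>n. cmod (a n) < 1"
  shows "\<exists>f. sol a \<theta> f n = g"
proof (induction n arbitrary: g)
  case (Suc n)
  obtain h where "szego_step (a n) \<theta> h = g" using szego_step_surj assms by blast
  moreover obtain f where "sol a \<theta> f n = h" using Suc by blast
  ultimately show ?case by auto
qed simp

lemma sol_zero [simp]: "sol a \<theta> 0 n = 0"
  by (induction n) (simp_all add: szego_step_def)

lemma telescope_abs_le:
  fixes f g :: "nat \<Rightarrow> real"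
  assumes "\<And>m. \<bar>f (Suc m) - f m\<bar> \<le> g m" "n \<le> L"
  shows "\<bar>f n - f L\<bar> \<le> sum g {n..<L}"
  using assms(2)
proof (induction L rule: dec_induct)
  case (step L)
  thus ?case using assms(1)[of L] by simp
qed simp

context periodic_coefficients
begin

lemma eigen_block:
  assumes "sol b \<theta> u p = of_real s * u"
  shows "sol b \<theta> u (k * p) = of_real (s ^ k) * u"
proof (induction k)
  case (Suc k)
  have "sol b \<theta> u (Suc k * p) = sol b \<theta> (sol b \<theta> u (k * p)) p"
    using sol_shift[of \<theta> u p k] by simp
  thus ?case unfolding Suc sol_scale assms by simp
qed simp

text \<open>An eigenvalue of modulus 1 makes the modulus of the solution \<open>p\<close>-periodic,
  and area preservation excludes zeros, so the minimum over one period works. The bound converts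
  closeness in the plane into closeness of directions.\<close>

lemma eigen_lower_bound:
  assumes "sol b \<theta> u p = of_real s * u" "u \<noteq> 0" "\<bar>s\<bar> = 1"
  shows "\<exists>c>0. \<forall>n. c \<le> cmod (sol b \<theta> u n)"
proof -
  define c where "c = Min ((\<lambda>n. cmod (sol b \<theta> u n)) ` {..<p})"
  have nz: "sol b \<theta> u n \<noteq> 0" for n
  proof
    assume "sol b \<theta> u n = 0"
    moreover have "wronskian (sol b \<theta> u n) (sol b \<theta> (\<i> * u) n) = wronskian u (\<i> * u)"
      by (rule wronskian_sol[where a=b, OF b_less_1])
    moreover have "wronskian u (\<i> * u) = (cmod u)\<^sup>2"
      unfolding wronskian_def cmod_power2 by (simp add: power2_eq_square)
    ultimately show False using assms(2) by (simp add: wronskian_def)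
  qed
  have "c > 0" unfolding c_def using p_pos nz by (subst Min_gr_iff) auto
  moreover have "c \<le> cmod (sol b \<theta> u n)" for n
  proof -
    have "sol b \<theta> u n = of_real (s ^ (n div p)) * sol b \<theta> u (n mod p)"
      using sol_shift[of \<theta> u "n mod p" "n div p"] unfolding eigen_block[OF assms(1)] sol_scale by simp
    hence "cmod (sol b \<theta> u n) = cmod (sol b \<theta> u (n mod p))"
      by (simp only: norm_mult norm_of_real power_abs assms(3)) simp
    thus ?thesis unfolding c_def using p_pos by simp
  qed
  ultimately show ?thesis by blast
qed

text \<open>In the frame \<open>u\<close>, \<open>w\<close> the monodromy is triangular. Area
  preservation makes the second diagonal entry \<open>1 / s = s\<close>, so powers grow at most
  linearly, through the off-diagonal entry \<open>\<kappa>\<close>.\<close>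

lemma edge_frame:
  assumes "sol b \<theta> u p = of_real s * u" "u \<noteq> 0" "\<bar>s\<bar> = 1"
  obtains w C where "wronskian u w = 1" "C > 0" "\<And>n. cmod (sol b \<theta> u n) \<le> C"
    "\<And>n. cmod (sol b \<theta> w n) \<le> C * (1 + real n)"
proof -
  define w where "w = \<i> * u / of_real ((cmod u)\<^sup>2)"
  have "cnj u * w = \<i> * (u * cnj u) / of_real ((cmod u)\<^sup>2)" by (simp add: w_def)
  also have "\<dots> = \<i>" using assms(2) unfolding complex_norm_square[symmetric] by simp
  finally have uw: "wronskian u w = 1" by (simp only: wronskian_def) simp
  define \<kappa> where "\<kappa> = wronskian (sol b \<theta> w p) w"
  have ss: "s * s = 1" using assms(3) by (metis abs_mult_self_eq mult_1)
  have "s * wronskian u (sol b \<theta> w p) = wronskian (sol b \<theta> u p) (sol b \<theta> w p)"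
    unfolding assms(1) by (simp add: wronskian_def algebra_simps)
  hence "s * wronskian u (sol b \<theta> w p) = 1"
    unfolding wronskian_sol[where a=b, OF b_less_1] uw .
  hence "wronskian u (sol b \<theta> w p) = s" using ss by (metis mult.left_commute mult_1_right)
  hence wp: "sol b \<theta> w p = of_real \<kappa> * u + of_real s * w"
    using wronskian_expand[OF uw, of "sol b \<theta> w p"] by (simp add: \<kappa>_def)
  have wk: "\<exists>c. \<bar>c\<bar> \<le> real k * \<bar>\<kappa>\<bar> \<and> sol b \<theta> w (k * p) = of_real (s ^ k) * w + of_real c * u" for k
  proof (induction k)
    case (Suc k)
    then obtain c where c: "\<bar>c\<bar> \<le> real k * \<bar>\<kappa>\<bar>"
      "sol b \<theta> w (k * p) = of_real (s ^ k) * w + of_real c * u" by blast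
    have "sol b \<theta> w (Suc k * p) = sol b \<theta> (sol b \<theta> w (k * p)) p"
      using sol_shift[of \<theta> w p k] by simp
    also have "\<dots> = of_real (s ^ Suc k) * w + of_real (s ^ k * \<kappa> + c * s) * u"
      unfolding c(2) sol_add sol_scale wp assms(1) by (simp add: algebra_simps)
    finally have "sol b \<theta> w (Suc k * p) = of_real (s ^ Suc k) * w + of_real (s ^ k * \<kappa> + c * s) * u" .
    moreover have "\<bar>s ^ k * \<kappa> + c * s\<bar> \<le> real (Suc k) * \<bar>\<kappa>\<bar>"
    proof -
      have "\<bar>s ^ k * \<kappa> + c * s\<bar> \<le> \<bar>s ^ k * \<kappa>\<bar> + \<bar>c * s\<bar>" by (rule abs_triangle_ineq)
      also have "\<dots> = \<bar>\<kappa>\<bar> + \<bar>c\<bar>" by (simp add: abs_mult power_abs assms(3))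
      finally show ?thesis using c(1) by (simp add: algebra_simps)
    qed
    ultimately show ?case by blast
  qed (auto intro: exI[of _ 0])
  have wkb: "cmod (sol b \<theta> w (k * p)) \<le> (cmod w + \<bar>\<kappa>\<bar> * cmod u) * (1 + real k)" for k
  proof -
    obtain c where c: "\<bar>c\<bar> \<le> real k * \<bar>\<kappa>\<bar>"
      "sol b \<theta> w (k * p) = of_real (s ^ k) * w + of_real c * u" using wk by blast
    have "cmod (sol b \<theta> w (k * p)) \<le> \<bar>s ^ k\<bar> * cmod w + \<bar>c\<bar> * cmod u"
      unfolding c(2) by (rule order_trans[OF norm_triangle_ineq]) (simp only: norm_mult norm_of_real order_refl)
    also have "\<dots> \<le> 1 * cmod w + (real k * \<bar>\<kappa>\<bar>) * cmod u"
      using c(1) by (intro add_mono mult_right_mono) (auto simp: power_abs assms(3))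
    also have "\<dots> \<le> (cmod w + \<bar>\<kappa>\<bar> * cmod u) * (1 + real k)"
      by (simp add: algebra_simps)
    finally show ?thesis .
  qed
  obtain K1 where K1: "K1 > 0" "\<And>n. cmod (sol b \<theta> w n) \<le> K1 * ((cmod w + \<bar>\<kappa>\<bar> * cmod u) * (1 + real (n div p)))"
    using block_bound[where C = "\<lambda>k. (cmod w + \<bar>\<kappa>\<bar> * cmod u) * (1 + real k)", OF wkb] by blast
  have "cmod (sol b \<theta> u (k * p)) \<le> cmod u" for k
    unfolding eigen_block[OF assms(1)] by (simp add: norm_mult norm_power assms(3))
  then obtain K2 where K2: "K2 > 0" "\<And>n. cmod (sol b \<theta> u n) \<le> K2 * cmod u"
    using block_bound[where C = "\<lambda>k. cmod u"] by blast
  define C where "C = K1 * (cmod w + \<bar>\<kappa>\<bar> * cmod u) + K2 * cmod u"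
  have nn: "K1 * (cmod w + \<bar>\<kappa>\<bar> * cmod u) \<ge> 0" using K1(1) by simp
  show ?thesis
  proof (rule that[OF uw, of C])
    show "C > 0" using nn K2(1) assms(2) by (simp add: C_def add_nonneg_pos)
    show "cmod (sol b \<theta> u n) \<le> C" for n using K2(2)[of n] nn by (simp add: C_def)
    show "cmod (sol b \<theta> w n) \<le> C * (1 + real n)" for n
    proof -
      have "cmod (sol b \<theta> w n) \<le> (K1 * (cmod w + \<bar>\<kappa>\<bar> * cmod u)) * (1 + real (n div p))"
        using K1(2)[of n] by (simp only: mult.assoc)
      also have "\<dots> \<le> C * (1 + real n)"
        using nn K2(1) by (intro mult_mono) (auto simp: C_def)
      finally show ?thesis .
    qed
  qed
qed

text \<open>A Jost-type solution, built by solving backward from an arbitrary time \<open>L\<close>: with the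
  weight \<open>1 + n\<close> on the coefficient of the linearly growing solution, the estimate needs exactly
  the first moment of the perturbation, uniformly in \<open>L\<close>.\<close>

lemma jost_close:
  assumes r: "\<And>n. cmod (a n) \<le> r" "\<And>n. cmod (b n) \<le> r" "r < 1"
    and d: "summable (\<lambda>n. real n * cmod (a n - b n))"
    and u: "sol b \<theta> u p = of_real s * u" "u \<noteq> 0" "\<bar>s\<bar> = 1"
    and "\<epsilon> > 0"
  shows "\<exists>N. \<forall>L\<ge>N. \<exists>f. \<forall>n\<in>{N..L}. cmod (sol a \<theta> f n - sol b \<theta> u n) \<le> \<epsilon>"
proof -
  obtain w C where uw: "wronskian u w = 1" and C: "C > 0" "\<And>n. cmod (sol b \<theta> u n) \<le> C"
    "\<And>n. cmod (sol b \<theta> w n) \<le> C * (1 + real n)"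
    using edge_frame[OF u] by blast
  define K where "K = 3 / sqrt (1 - r\<^sup>2) ^ 3"
  have "0 \<le> r" using r(1) norm_ge_zero order_trans by blast
  hence K0: "K \<ge> 0" using r(3) by (simp add: K_def abs_square_le_1)
  have a1: "\<And>n. cmod (a n) < 1" using r le_less_trans by blast
  \<comment> \<open>The factor 3 is 2 + 1: increments of the \<open>u\<close>-coordinate involve
    \<open>w\<close> at time \<open>n + 1\<close>, bounded by \<open>2 * C * (1 + n)\<close>, and
    those of the \<open>w\<close>-coordinate carry the weight \<open>1 + n\<close>.\<close>
  define g where "g = (\<lambda>n. 3 * K * C * C * (1 + real n) * cmod (a n - b n))"
  have g0: "g n \<ge> 0" for n using K0 C by (simp add: g_def)
  have "summable g"
  proof (rule summable_comparison_test_ev)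
    show "\<forall>\<^sub>F n in sequentially. norm (g n) \<le> 6 * K * C * C * (real n * cmod (a n - b n))"
      using eventually_ge_at_top[of 1]
    proof eventually_elim
      case (elim n)
      have "(3 * K * C * C * cmod (a n - b n)) * (1 + real n) \<le> (3 * K * C * C * cmod (a n - b n)) * (2 * real n)"
        using elim K0 C by (intro mult_left_mono) auto
      also have "(3 * K * C * C * cmod (a n - b n)) * (1 + real n) = norm (g n)"
        using g0[of n] by (simp add: g_def)
      finally show ?case by (simp add: mult_ac)
    qed
    show "summable (\<lambda>n. 6 * K * C * C * (real n * cmod (a n - b n)))"
      using d by (rule summable_mult)
  qed
  define \<eta> where "\<eta> = min (1/2) (\<epsilon> / (2 * C))"
  have \<eta>: "\<eta> > 0" "\<eta> \<le> 1/2" "2 * C * \<eta> \<le> \<epsilon>"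
    using C(1) \<open>\<epsilon> > 0\<close> by (auto simp: \<eta>_def min_def field_simps)
  obtain N where N: "\<And>m n. m \<ge> N \<Longrightarrow> norm (sum g {m..<n}) < \<eta>"
    using \<open>summable g\<close> \<eta>(1) unfolding summable_Cauchy by blast
  show ?thesis
  proof (intro exI[of _ N] allI impI)
    fix L assume "N \<le> L"
    obtain f where f: "sol a \<theta> f L = sol b \<theta> u L" using sol_surj[of a] a1 by blast
    \<comment> \<open>The perturbed solution is \<open>- x\<close> times the solution from
      \<open>u\<close> plus \<open>y\<close> times the one from \<open>w\<close>, so agreement at
      time \<open>L\<close> means \<open>x = -1\<close> and \<open>y = 0\<close>.\<close>
    define x y where "x = (\<lambda>n. wronskian (sol b \<theta> w n) (sol a \<theta> f n))"
      and "y = (\<lambda>n. wronskian (sol b \<theta> u n) (sol a \<theta> f n))"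
    have uwn: "wronskian (sol b \<theta> u n) (sol b \<theta> w n) = 1" for n
      unfolding wronskian_sol[where a=b, OF b_less_1] by (rule uw)
    define e where "e = (\<lambda>n. \<bar>x n + 1\<bar> + (1 + real n) * \<bar>y n\<bar>)"
    have e0: "e n \<ge> 0" for n by (simp add: e_def)
    have diff: "cmod (sol a \<theta> f n - sol b \<theta> u n) \<le> C * e n" for n
    proof -
      have "sol a \<theta> f n - sol b \<theta> u n = of_real (- (x n + 1)) * sol b \<theta> u n + of_real (y n) * sol b \<theta> w n"
        using wronskian_expand[OF uwn[of n], of "sol a \<theta> f n"]
        by (simp add: x_def y_def wronskian_swap[of "sol a \<theta> f n"] algebra_simps)
      also have "cmod \<dots> \<le> \<bar>x n + 1\<bar> * cmod (sol b \<theta> u n) + \<bar>y n\<bar> * cmod (sol b \<theta> w n)"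
        by (rule order_trans[OF norm_triangle_ineq]) (simp only: norm_mult norm_of_real abs_minus_cancel order_refl)
      also have "\<dots> \<le> \<bar>x n + 1\<bar> * C + \<bar>y n\<bar> * (C * (1 + real n))"
        using C by (intro add_mono mult_left_mono) auto
      finally show ?thesis by (simp add: e_def algebra_simps)
    qed
    have Y: "cmod (sol a \<theta> f n) \<le> C * (1 + e n)" for n
      using diff[of n] C(2)[of n] norm_triangle_sub[of "sol a \<theta> f n" "sol b \<theta> u n"]
      by (simp add: algebra_simps)
    have incx: "\<bar>x (Suc m) - x m\<bar> \<le> 2 / 3 * g m * (1 + e m)" for m
    proof -
      have "\<bar>x (Suc m) - x m\<bar> \<le> K * cmod (a m - b m) * cmod (sol a \<theta> f m) * cmod (sol b \<theta> w (Suc m))"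
        unfolding x_def K_def by (rule wronskian_sol_increment_right[OF r])
      also have "\<dots> \<le> K * cmod (a m - b m) * (C * (1 + e m)) * (C * (2 * (1 + real m)))"
        using Y K0 C(1) e0
      proof (intro mult_mono)
        show "cmod (sol b \<theta> w (Suc m)) \<le> C * (2 * (1 + real m))"
        proof (rule order_trans[OF C(3)])
          show "C * (1 + real (Suc m)) \<le> C * (2 * (1 + real m))"
            using C(1) by (intro mult_left_mono) auto
        qed
      qed auto
      also have "\<dots> = 2 / 3 * g m * (1 + e m)" by (simp add: g_def)
      finally show ?thesis .
    qed
    have incy: "\<bar>y (Suc m) - y m\<bar> \<le> K * cmod (a m - b m) * (C * (1 + e m)) * C" for m
    proof -
      have "\<bar>y (Suc m) - y m\<bar> \<le> K * cmod (a m - b m) * cmod (sol a \<theta> f m) * cmod (sol b \<theta> u (Suc m))"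
        unfolding y_def K_def by (rule wronskian_sol_increment_right[OF r])
      also have "\<dots> \<le> K * cmod (a m - b m) * (C * (1 + e m)) * C"
        using Y K0 C e0 by (intro mult_mono) (auto simp del: sol.simps)
      finally show ?thesis .
    qed
    have "x L = - 1" "y L = 0"
      using uwn[of L] by (simp_all add: x_def y_def f wronskian_swap[of "sol b \<theta> w L"]) (simp add: wronskian_def)
    have esum: "e n \<le> (\<Sum>m\<in>{n..<L}. g m * (1 + e m))" if "n \<le> L" for n
    proof -
      have xb: "\<bar>x n + 1\<bar> \<le> (\<Sum>m\<in>{n..<L}. 2 / 3 * g m * (1 + e m))"
        using telescope_abs_le[of x, OF incx that] \<open>x L = - 1\<close> by simp
      have "\<bar>y n\<bar> \<le> (\<Sum>m\<in>{n..<L}. K * cmod (a m - b m) * (C * (1 + e m)) * C)"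
        using telescope_abs_le[of y, OF incy that] \<open>y L = 0\<close> by simp
      hence "(1 + real n) * \<bar>y n\<bar> \<le> (1 + real n) * (\<Sum>m\<in>{n..<L}. K * cmod (a m - b m) * (C * (1 + e m)) * C)"
        by (intro mult_left_mono) auto
      also have "\<dots> = (\<Sum>m\<in>{n..<L}. (1 + real n) * (K * cmod (a m - b m) * (C * (1 + e m)) * C))"
        by (rule sum_distrib_left)
      \<comment> \<open>Going backward produces sums over \<open>m \<ge> n\<close>, so the weight at
        \<open>n\<close> is dominated by the weight at \<open>m\<close>.\<close>
      also have "\<dots> \<le> (\<Sum>m\<in>{n..<L}. (1 + real m) * (K * cmod (a m - b m) * (C * (1 + e m)) * C))"
        using K0 C(1) e0 by (intro sum_mono mult_right_mono mult_nonneg_nonneg) (auto simp: add_nonneg_nonneg)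
      also have "\<dots> = (\<Sum>m\<in>{n..<L}. 1 / 3 * g m * (1 + e m))"
        by (intro sum.cong refl) (simp add: g_def)
      finally have "e n \<le> (\<Sum>m\<in>{n..<L}. 2 / 3 * g m * (1 + e m)) + (\<Sum>m\<in>{n..<L}. 1 / 3 * g m * (1 + e m))"
        using xb unfolding e_def by linarith
      also have "\<dots> = (\<Sum>m\<in>{n..<L}. g m * (1 + e m))"
        unfolding sum.distrib[symmetric] by (intro sum.cong refl) (simp add: field_simps)
      finally show ?thesis .
    qed
    \<comment> \<open>The maximum over the finite window closes the estimate:
      \<open>E \<le> \<eta> * (1 + E)\<close> with \<open>\<eta> \<le> 1/2\<close> gives
      \<open>E \<le> 2 * \<eta>\<close>.\<close>
    define E where "E = Max (e ` {N..L})"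
    have E: "e n \<le> E" if "n \<in> {N..L}" for n
      unfolding E_def using that by (intro Max_ge) auto
    have "E \<in> e ` {N..L}" unfolding E_def using \<open>N \<le> L\<close> by (intro Max_in) auto
    then obtain n where n: "n \<in> {N..L}" "E = e n" by blast
    have "E \<le> (\<Sum>m\<in>{n..<L}. g m * (1 + e m))" using esum n by auto
    also have "\<dots> \<le> (\<Sum>m\<in>{n..<L}. g m * (1 + E))"
      using E n(1) g0 by (intro sum_mono mult_left_mono) auto
    also have "\<dots> = sum g {n..<L} * (1 + E)" by (simp add: sum_distrib_right)
    also have "\<dots> \<le> \<eta> * (1 + E)"
      using N[of n L] n e0[of n] by (intro mult_right_mono) auto
    finally have "E \<le> \<eta> + \<eta> * E" by (simp add: algebra_simps)
    moreover have "\<eta> * E \<le> 1/2 * E" using \<eta>(2) n e0[of n] by (intro mult_right_mono) auto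
    ultimately have "E \<le> 2 * \<eta>" by linarith
    hence "C * e n \<le> \<epsilon>" if "n \<in> {N..L}" for n
    proof -
      have "C * e n \<le> C * (2 * \<eta>)" using E[OF that] \<open>E \<le> 2 * \<eta>\<close> C(1) by (intro mult_left_mono) auto
      thus ?thesis using \<eta>(3) by (simp add: mult_ac)
    qed
    thus "\<exists>f. \<forall>n\<in>{N..L}. cmod (sol a \<theta> f n - sol b \<theta> u n) \<le> \<epsilon>"
      using diff order_trans by blast
  qed
qed

end

section \<open>From closeness in the plane to closeness of lifted angles\<close>

lemma cmod_cis_diff_le: "cmod (cis s - cis t) \<le> \<bar>s - t\<bar>"
proof -
  have "cis s - cis t = cis t * (cis (s - t) - 1)"
    by (simp add: right_diff_distrib cis_mult)
  hence "cmod (cis s - cis t) = 2 * \<bar>sin ((s - t) / 2)\<bar>"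
    using dist_exp_i_1[of "s - t"] by (simp add: norm_mult cis_conv_exp del: of_real_diff)
  thus ?thesis using abs_sin_x_le_abs_x[of "(s - t) / 2"] by simp
qed

text \<open>A crude bound below pi on one step is what excludes a jump to another branch when angles
  are otherwise known only modulo pi. It comes from uniform continuity of \<open>Arg (1 - q)\<close>
  on a disc of radius below 1.\<close>

lemma turn_close:
  assumes "r < 1"
  shows "\<exists>\<delta>>0. \<delta> \<le> 1 \<and> (\<forall>a b x y t. cmod a \<le> r \<longrightarrow> cmod b \<le> r \<longrightarrow> cmod (a - b) < \<delta> \<longrightarrow> \<bar>y - x\<bar> < \<delta>
    \<longrightarrow> \<bar>turn a (t + y) - turn b (t + x)\<bar> < 2)"
proof -
  have "continuous_on (cball 0 r) (\<lambda>q. Arg (1 - q))"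
  proof (intro continuous_on_Arg' continuous_intros)
    fix q :: complex assume "q \<in> cball 0 r"
    hence "Re q < 1" using assms complex_Re_le_cmod[of q] by auto
    thus "1 - q \<notin> \<real>\<^sub>\<le>\<^sub>0" by (simp add: complex_nonpos_Reals_iff)
  qed
  hence "uniformly_continuous_on (cball 0 r) (\<lambda>q. Arg (1 - q))"
    by (rule compact_uniformly_continuous) simp
  then obtain e where e: "e > 0" "\<And>q q'. cmod q \<le> r \<Longrightarrow> cmod q' \<le> r \<Longrightarrow> cmod (q - q') < e
      \<Longrightarrow> \<bar>Arg (1 - q) - Arg (1 - q')\<bar> < 1"
    unfolding uniformly_continuous_on_def dist_norm real_norm_def
    by (metis mem_cball_0 zero_less_one)
  \<comment> \<open>A third of \<open>e\<close>, because the coefficients contribute one \<delta>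
    and the doubled angle in \<open>cis\<close> two more.\<close>
  define \<delta> where "\<delta> = min 1 (e / 3)"
  have \<delta>: "\<delta> > 0" "\<delta> \<le> 1" "3 * \<delta> \<le> e" using e(1) by (auto simp: \<delta>_def)
  have "\<bar>turn a (t + y) - turn b (t + x)\<bar> < 2"
    if ab: "cmod a \<le> r" "cmod b \<le> r" and d: "cmod (a - b) < \<delta>" "\<bar>y - x\<bar> < \<delta>" for a b x y t
  proof -
    define q q' where "q = cnj a * cis (- 2 * (t + y))" and "q' = cnj b * cis (- 2 * (t + x))"
    have "q - q' = cnj (a - b) * cis (- 2 * (t + y)) + cnj b * (cis (- 2 * (t + y)) - cis (- 2 * (t + x)))"
      by (simp add: q_def q'_def algebra_simps)
    also have "cmod \<dots> \<le> cmod (a - b) + cmod b * cmod (cis (- 2 * (t + y)) - cis (- 2 * (t + x)))"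
      by (rule order_trans[OF norm_triangle_ineq])
        (simp only: norm_mult complex_mod_cnj norm_cis mult_1_right order_refl)
    also have "\<dots> \<le> cmod (a - b) + 1 * \<bar>- 2 * (t + y) - - 2 * (t + x)\<bar>"
      using ab assms by (intro add_mono mult_mono cmod_cis_diff_le) auto
    also have "\<dots> < \<delta> + 2 * \<delta>" using d by (simp add: abs_if split: if_splits)
    finally have "cmod (q - q') < e" using \<delta>(3) by simp
    moreover have "cmod q \<le> r" "cmod q' \<le> r" using ab by (simp_all add: q_def q'_def norm_mult)
    ultimately have "\<bar>Arg (1 - q) - Arg (1 - q')\<bar> < 1" using e(2) by blast
    moreover have "turn a (t + y) - turn b (t + x) = (y - x) + (Arg (1 - q) - Arg (1 - q'))"
      by (simp add: turn_def q_def q'_def)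
    ultimately show ?thesis using d(2) \<delta>(2) by linarith
  qed
  thus ?thesis using \<delta> by blast
qed

lemma abs_sin_add_pi_int: "\<bar>sin (t + pi * of_int j)\<bar> = \<bar>sin t\<bar>"
proof -
  have s: "sin (pi * of_int j) = 0" using sin_zero_iff_int2 by (metis mult.commute)
  hence "(cos (pi * of_int j))\<^sup>2 = 1" using sin_cos_squared_add[of "pi * of_int j"] by simp
  hence "\<bar>cos (pi * of_int j)\<bar> = 1" by (metis abs_square_eq_1)
  thus ?thesis using s by (simp add: sin_add abs_mult)
qed

text \<open>A small sine allows only angles near 0 or near plus or minus pi; the latter are out of
  reach because \<open>2 + \<delta> \<le> 3 < pi\<close>.\<close>

lemma abs_less_if_abs_sin_less:
  fixes t \<delta> :: real
  assumes "\<bar>t\<bar> \<le> 2" "0 < \<delta>" "\<delta> \<le> 1" "\<bar>sin t\<bar> < sin \<delta>"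
  shows "\<bar>t\<bar> < \<delta>"
proof (rule ccontr)
  assume "\<not> \<bar>t\<bar> < \<delta>"
  hence ge: "\<delta> \<le> \<bar>t\<bar>" by simp
  have pi: "pi > 3" by (rule pi_gt3)
  have "sin \<delta> \<le> sin \<bar>t\<bar>"
  proof (cases "\<bar>t\<bar> \<le> pi/2")
    case True
    thus ?thesis using ge assms pi by (intro sin_monotone_2pi_le) auto
  next
    case False
    have "sin \<delta> \<le> sin (pi - \<bar>t\<bar>)"
      using False assms pi by (intro sin_monotone_2pi_le) auto
    thus ?thesis by simp
  qed
  moreover have "\<bar>sin t\<bar> = sin \<bar>t\<bar>"
  proof -
    have "sin \<bar>t\<bar> \<ge> 0" using assms(1) pi by (intro sin_ge_zero) auto
    thus ?thesis by (cases "t \<ge> 0") (auto simp: abs_if)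
  qed
  ultimately show False using assms(4) by simp
qed

text \<open>A Jost-type solution stays near the nonvanishing eigenvector solution, so the sine of
  the angle between them is small. A bootstrap follows one branch: each step keeps the lifted
  difference below 2, and the sine bound improves this to \<delta>. Returning to initial angle 0
  costs 2 pi for each sequence.\<close>

lemma (in periodic_coefficients) edge_phase:
  assumes r: "\<And>n. cmod (a n) \<le> r" "\<And>n. cmod (b n) \<le> r" "r < 1"
    and d: "summable (\<lambda>n. real n * cmod (a n - b n))"
    and edge: "\<bar>half_trace \<theta>\<bar> = 1"
  shows "\<exists>C N. \<forall>n\<ge>N. \<bar>ang a \<theta> 0 n - ang b \<theta> 0 n\<bar> \<le> C"
proof -
  have a1: "\<And>n. cmod (a n) < 1" using r le_less_trans by blast
  obtain u s where u0: "u \<noteq> 0" and us: "sol b \<theta> u p = of_real s * u" and s: "\<bar>s\<bar> = 1"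
    using tm_eigenvector[of b \<theta> p] b_less_1 edge unfolding half_trace_def by (metis order_refl)
  obtain c where c: "c > 0" "\<And>n. c \<le> cmod (sol b \<theta> u n)"
    using eigen_lower_bound[OF us u0 s] by blast
  define x0 where "x0 = Arg u"
  have up: "of_real (cmod u) * cis x0 = u"
    unfolding x0_def by (metis rcis_cmod_Arg rcis_def)
  define x where "x = ang b \<theta> x0"
  have upol: "\<exists>t>0. sol b \<theta> u n = of_real t * cis (x n)" for n
    using sol_polar[where a=b and r="cmod u" and x=x0, OF b_less_1] u0 unfolding up x_def by simp
  obtain \<delta> where \<delta>: "\<delta> > 0" "\<delta> \<le> 1" "\<And>\<alpha> \<beta> x y t. cmod \<alpha> \<le> r \<Longrightarrow> cmod \<beta> \<le> r
      \<Longrightarrow> cmod (\<alpha> - \<beta>) < \<delta> \<Longrightarrow> \<bar>y - x\<bar> < \<delta> \<Longrightarrow> \<bar>turn \<alpha> (t + y) - turn \<beta> (t + x)\<bar> < 2"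
    using turn_close[OF r(3)] by blast
  have sd: "sin \<delta> > 0" using \<delta>(1,2) pi_gt3 by (intro sin_gt_zero) auto
  \<comment> \<open>The perturbed solution will stay above \<open>c / 2\<close> in modulus, so the
    sine is at most \<open>\<epsilon> / (c / 2) = sin \<delta> / 2\<close>.\<close>
  define \<epsilon> where "\<epsilon> = c * sin \<delta> / 4"
  have \<epsilon>: "\<epsilon> > 0" "\<epsilon> \<le> c / 4"
    using c(1) sd sin_le_one[of \<delta>] by (auto simp: \<epsilon>_def)
  obtain N1 where N1: "\<And>L. L \<ge> N1 \<Longrightarrow> \<exists>f. \<forall>n\<in>{N1..L}. cmod (sol a \<theta> f n - sol b \<theta> u n) \<le> \<epsilon>"
    using jost_close[OF r d us u0 s \<epsilon>(1)] by blast
  have "(\<lambda>n. real n * cmod (a n - b n)) \<longlonglongrightarrow> 0" using d by (rule summable_LIMSEQ_zero)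
  hence "\<forall>\<^sub>F n in sequentially. real n * cmod (a n - b n) < \<delta>"
    using \<delta>(1) by (rule order_tendstoD)
  then obtain N2 where N2: "\<And>n. n \<ge> N2 \<Longrightarrow> real n * cmod (a n - b n) < \<delta>"
    unfolding eventually_sequentially by blast
  define N where "N = Suc (max N1 N2)"
  have small: "cmod (a n - b n) < \<delta>" if "n \<ge> N" for n
  proof -
    have "1 * cmod (a n - b n) \<le> real n * cmod (a n - b n)"
      using that by (intro mult_right_mono) (auto simp: N_def)
    moreover have "N2 \<le> n" using that unfolding N_def by linarith
    ultimately show ?thesis using N2[of n] by simp
  qed
  have "\<bar>ang a \<theta> 0 L - ang b \<theta> 0 L\<bar> \<le> \<bar>ang a \<theta> 0 N - ang b \<theta> 0 N\<bar> + 2 * \<delta> + 4 * pi" if L: "L \<ge> N" for L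
  proof -
    obtain f where f: "\<And>n. n \<in> {N..L} \<Longrightarrow> cmod (sol a \<theta> f n - sol b \<theta> u n) \<le> \<epsilon>"
      using N1[of L] L by (force simp: N_def)
    have flow: "c / 2 \<le> cmod (sol a \<theta> f n)" if "n \<in> {N..L}" for n
      using f[OF that] c(2)[of n] \<epsilon>(2) c(1) norm_triangle_sub[of "sol b \<theta> u n" "sol a \<theta> f n"]
      by (simp add: norm_minus_commute)
    have "f \<noteq> 0" using flow[of L] L c(1) by auto
    define y' where "y' = Arg f"
    have fp: "of_real (cmod f) * cis y' = f"
      unfolding y'_def by (metis rcis_cmod_Arg rcis_def)
    \<comment> \<open>Rounding selects the branch nearest to \<open>x N\<close>, leaving a
      difference of at most \<open>pi / 2 < 2\<close>.\<close>
    define j where "j = - round ((ang a \<theta> y' N - x N) / pi)"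
    define y where "y = ang a \<theta> (y' + pi * of_int j)"
    have y: "y n = ang a \<theta> y' n + pi * of_int j" for n by (simp add: y_def ang_pi_int)
    have yN: "\<bar>y N - x N\<bar> \<le> 2"
    proof -
      have "\<bar>of_int (round ((ang a \<theta> y' N - x N) / pi)) - (ang a \<theta> y' N - x N) / pi\<bar> \<le> 1/2"
        by (rule of_int_round_abs_le)
      hence "pi * \<bar>of_int (round ((ang a \<theta> y' N - x N) / pi)) - (ang a \<theta> y' N - x N) / pi\<bar> \<le> pi * (1/2)"
        by (intro mult_left_mono) auto
      also have "pi * \<bar>of_int (round ((ang a \<theta> y' N - x N) / pi)) - (ang a \<theta> y' N - x N) / pi\<bar>
          = \<bar>pi * (of_int (round ((ang a \<theta> y' N - x N) / pi)) - (ang a \<theta> y' N - x N) / pi)\<bar>"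
        by (simp only: abs_mult) simp
      also have "pi * (of_int (round ((ang a \<theta> y' N - x N) / pi)) - (ang a \<theta> y' N - x N) / pi) = - (y N - x N)"
        by (simp add: y j_def field_simps)
      finally show ?thesis using pi_less_4 by linarith
    qed
    have sin_small: "\<bar>sin (y n - x n)\<bar> < sin \<delta>" if n: "n \<in> {N..L}" for n
    proof -
      obtain t where t: "t > 0" "sol b \<theta> u n = of_real t * cis (x n)" using upol by blast
      obtain q where q: "q > 0" "sol a \<theta> f n = of_real q * cis (ang a \<theta> y' n)"
        using sol_polar[where a=a and r="cmod f" and x=y' and \<theta>=\<theta> and n=n, OF a1] \<open>f \<noteq> 0\<close> unfolding fp by auto
      have q2: "c / 2 \<le> q" using flow[OF n] q by (simp add: norm_mult)
      \<comment> \<open>The wronskian of a vector with itself vanishes, so only the small difference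
        of the two solutions contributes.\<close>
      have "t * q * sin (ang a \<theta> y' n - x n) = wronskian (sol b \<theta> u n) (sol a \<theta> f n - sol b \<theta> u n)"
        unfolding wronskian_diff_right unfolding t(2) q(2) wronskian_polar by simp
      also have "\<bar>\<dots>\<bar> \<le> t * \<epsilon>"
        by (rule order_trans[OF abs_wronskian_le], rule mult_mono[OF _ f[OF n]]) (use t in \<open>auto simp: norm_mult\<close>)
      finally have "t * (q * \<bar>sin (ang a \<theta> y' n - x n)\<bar>) \<le> t * \<epsilon>"
        using t(1) q(1) by (simp add: abs_mult mult_ac)
      hence "q * \<bar>sin (ang a \<theta> y' n - x n)\<bar> \<le> \<epsilon>" using t(1) by simp
      moreover have "c / 2 * \<bar>sin (ang a \<theta> y' n - x n)\<bar> \<le> q * \<bar>sin (ang a \<theta> y' n - x n)\<bar>"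
        using q2 by (intro mult_right_mono) auto
      ultimately have "c / 2 * \<bar>sin (ang a \<theta> y' n - x n)\<bar> \<le> c / 2 * (sin \<delta> / 2)"
        by (simp add: \<epsilon>_def)
      hence "\<bar>sin (ang a \<theta> y' n - x n)\<bar> \<le> sin \<delta> / 2"
        using c(1) by (simp only: mult_le_cancel_left_pos half_gt_zero)
      moreover have "y n - x n = (ang a \<theta> y' n - x n) + pi * of_int j" by (simp add: y)
      hence "\<bar>sin (y n - x n)\<bar> = \<bar>sin (ang a \<theta> y' n - x n)\<bar>"
        by (simp only: abs_sin_add_pi_int)
      ultimately show ?thesis using sd by linarith
    qed
    have close: "\<bar>y n - x n\<bar> < \<delta>" if "N \<le> n" "n \<le> L" for n
      using that
    proof (induction n rule: dec_induct)
      case base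
      show ?case by (rule abs_less_if_abs_sin_less) (use yN \<delta>(1,2) sin_small[of N] L in auto)
    next
      case (step n)
      have "\<bar>turn (a n) (\<theta>/2 + y n) - turn (b n) (\<theta>/2 + x n)\<bar> < 2"
        using step small[of n] r by (intro \<delta>(3)) auto
      hence "\<bar>y (Suc n) - x (Suc n)\<bar> \<le> 2" by (simp add: y_def x_def)
      thus ?case by (rule abs_less_if_abs_sin_less) (use \<delta>(1,2) sin_small[of "Suc n"] step in auto)
    qed
    have "\<bar>(ang a \<theta> 0 L - ang a \<theta> 0 N) - (y L - y N)\<bar> \<le> 2 * pi"
      unfolding y_def by (rule ang_increment_diff[where a=a, OF a1])
    moreover have "\<bar>(ang b \<theta> 0 L - ang b \<theta> 0 N) - (x L - x N)\<bar> \<le> 2 * pi"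
      unfolding x_def by (rule ang_increment_diff[where a=b, OF b_less_1])
    moreover have "\<bar>y L - x L\<bar> < \<delta>" "\<bar>y N - x N\<bar> < \<delta>" using close L by auto
    ultimately show ?thesis by linarith
  qed
  thus ?thesis by blast
qed

section \<open>Orthogonal polynomials on the unit circle\<close>

lemma unit_mult_cnj: "cmod z = 1 \<Longrightarrow> z * cnj z = 1"
  by (simp flip: complex_norm_square)

lemma unit_power_cnj:
  assumes "cmod z = 1" "k \<le> n"
  shows "z ^ n * cnj z ^ k = z ^ (n - k)"
proof -
  have "z ^ n * cnj z ^ k = z ^ (n - k) * (z * cnj z) ^ k"
    using assms(2) by (simp add: power_mult_distrib flip: power_add mult.assoc)
  thus ?thesis by (simp add: unit_mult_cnj[OF assms(1)])
qed

definition star :: "complex poly \<Rightarrow> complex poly" where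
  "star P = reflect_poly (map_poly cnj P)"

lemma poly_star:
  assumes "cmod z = 1"
  shows "poly (star P) z = z ^ degree P * cnj (poly P z)"
proof -
  have z: "z \<noteq> 0" using assms by auto
  have "inverse z = cnj z" using unit_mult_cnj[OF assms] by (rule inverse_unique)
  thus ?thesis
    unfolding star_def using poly_reflect_poly_nz[OF z, of "map_poly cnj P"]
    by (simp add: degree_map_poly)
qed

lemma degree_star_le: "degree (star P) \<le> degree P"
  unfolding star_def using degree_reflect_poly_le[of "map_poly cnj P"] by (simp add: degree_map_poly)

lemma poly_star_0: "poly (star P) 0 = cnj (lead_coeff P)"
  by (simp add: star_def coeff_map_poly degree_map_poly)

lemma coeff_star_degree: "coeff (star P) (degree P) = cnj (poly P 0)"
  by (simp add: star_def coeff_reflect_poly coeff_map_poly degree_map_poly poly_0_coeff_0)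

text \<open>Keeps conjugation on the circle within polynomials of degree at most \<open>m\<close>:
  \<open>star\<close> reverses at the actual degree, and a monomial supplies the missing power of
  \<open>z\<close>.\<close>

lemma conj_reflection:
  assumes "degree P \<le> m"
  obtains S where "degree S \<le> m" "\<And>z. cmod z = 1 \<Longrightarrow> poly S z = z ^ m * cnj (poly P z)"
proof (rule that[of "monom 1 (m - degree P) * star P"])
  have "degree (monom 1 (m - degree P) * star P) \<le> (m - degree P) + degree P"
    using degree_mult_le[of "monom 1 (m - degree P)" "star P"] degree_star_le[of P]
    by (simp add: degree_monom_eq)
  thus "degree (monom 1 (m - degree P) * star P) \<le> m" using assms by simp
next
  fix z :: complex assume "cmod z = 1"
  thus "poly (monom 1 (m - degree P) * star P) z = z ^ m * cnj (poly P z)"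
    using assms by (simp add: poly_monom poly_star flip: power_add mult.assoc)
qed

lemma interpolation_exists:
  fixes d :: "'a::field \<Rightarrow> 'a"
  assumes "finite Z"
  shows "\<exists>R. degree R \<le> card Z - 1 \<and> (\<forall>z\<in>Z. poly R z = d z)"
  using assms
proof (induction Z)
  case (insert x Z)
  then obtain R where R: "degree R \<le> card Z - 1" "\<And>z. z \<in> Z \<Longrightarrow> poly R z = d z" by blast
  define W where "W = (\<Prod>z\<in>Z. [:- z, 1:])"
  have W: "poly W x \<noteq> 0" "\<And>z. z \<in> Z \<Longrightarrow> poly W z = 0"
    using insert.hyps by (auto simp: W_def poly_prod)
  have dW: "degree W \<le> card Z"
    using degree_prod_sum_le[OF insert.hyps(1), of "\<lambda>z. [:- z, 1:]"] by (simp add: W_def)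
  define R' where "R' = R + smult ((d x - poly R x) / poly W x) W"
  have "degree R' \<le> card Z"
    unfolding R'_def using R(1) dW by (intro degree_add_le) (auto intro: order_trans[OF degree_smult_le])
  moreover have "\<forall>z\<in>insert x Z. poly R' z = d z" using R W by (simp add: R'_def)
  ultimately show ?case using insert.hyps by (intro exI[of _ R']) simp
qed (auto intro: exI[of _ 0])

section \<open>The inner product of the measure and its orthogonal polynomials\<close>

locale circle_measure =
  fixes M :: "complex measure"
  assumes circle: "circle_prob M" and nontrivial: "nontrivial_measure M"
begin

lemma prob: "prob_space M" and sets_M: "sets M = sets circle_borel"
  using circle by (auto simp: circle_prob_def)

sublocale prob_space M by (rule prob)

lemma space_M: "space M = unit_circle"
  using sets_eq_imp_space_eq[OF sets_M] by (simp add: space_restrict_space)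

lemma measurable_continuous:
  fixes f :: "complex \<Rightarrow> 'b::topological_space"
  shows "continuous_on unit_circle f \<Longrightarrow> f \<in> borel_measurable M"
  using borel_measurable_continuous_on_restrict measurable_cong_sets[OF sets_M refl] by blast

lemma integrable_continuous:
  fixes f :: "complex \<Rightarrow> 'b::{banach,second_countable_topology}"
  assumes "continuous_on unit_circle f"
  shows "integrable M f"
proof -
  have "bounded (f ` unit_circle)"
    using compact_continuous_image[OF assms] by (simp add: compact_imp_bounded)
  then obtain B where "\<And>z. z \<in> unit_circle \<Longrightarrow> norm (f z) \<le> B"
    unfolding bounded_iff by (meson imageI)
  thus ?thesis using measurable_continuous[OF assms]
    by (intro integrable_const_bound[of _ B]) (auto simp: space_M)
qed

definition pairing :: "complex poly \<Rightarrow> complex poly \<Rightarrow> complex" where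
  "pairing Q P = (LINT z|M. cnj (poly Q z) * poly P z)"

definition sqn :: "complex poly \<Rightarrow> real" where
  "sqn P = (LINT z|M. (cmod (poly P z))\<^sup>2)"

lemma pairing_integrable: "integrable M (\<lambda>z. cnj (poly Q z) * poly P z)"
  by (intro integrable_continuous continuous_intros)

lemma pairing_cong:
  assumes "\<And>z. cmod z = 1 \<Longrightarrow> cnj (poly Q z) * poly P z = cnj (poly Q' z) * poly P' z"
  shows "pairing Q P = pairing Q' P'"
  unfolding pairing_def by (rule Bochner_Integration.integral_cong) (auto simp: space_M assms)

lemma pairing_add: "pairing Q (P + P') = pairing Q P + pairing Q P'"
  unfolding pairing_def using pairing_integrable by (simp add: distrib_left)

lemma pairing_smult: "pairing Q (smult c P) = c * pairing Q P"
  unfolding pairing_def using pairing_integrable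
  by (subst integral_mult_right_zero[symmetric]) (simp add: mult_ac)

lemma pairing_diff: "pairing Q (P - P') = pairing Q P - pairing Q P'"
  using pairing_add[of Q P "smult (-1) P'"] pairing_smult[of Q "-1" P'] by simp

lemma pairing_cnj: "cnj (pairing Q P) = pairing P Q"
  unfolding pairing_def by (subst Bochner_Integration.integral_cnj[symmetric]) (simp add: mult.commute)

lemma pairing_add_left: "pairing (Q + Q') P = pairing Q P + pairing Q' P"
  using pairing_add[of P Q Q'] pairing_cnj by (metis complex_cnj_add)

lemma pairing_smult_left: "pairing (smult c Q) P = cnj c * pairing Q P"
  using pairing_smult[of P c Q] pairing_cnj by (metis complex_cnj_mult)

lemma pairing_self: "pairing P P = of_real (sqn P)"
proof -
  have "pairing P P = (LINT z|M. of_real ((cmod (poly P z))\<^sup>2))"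
    unfolding pairing_def by (rule Bochner_Integration.integral_cong) (simp_all only: complex_norm_square mult.commute)
  thus ?thesis unfolding sqn_def by (simp only: integral_complex_of_real)
qed

lemma sqn_nonneg: "sqn P \<ge> 0"
  by (simp add: sqn_def)

text \<open>A vanishing norm would concentrate the measure on the finitely many zeros of
  \<open>P\<close>, making it a finite combination of point masses. This is where nontriviality
  enters.\<close>

lemma sqn_pos:
  assumes "P \<noteq> 0"
  shows "sqn P > 0"
proof (rule ccontr)
  assume "\<not> sqn P > 0"
  hence "sqn P = 0" using sqn_nonneg[of P] by simp
  moreover have "integrable M (\<lambda>z. (cmod (poly P z))\<^sup>2)"
    by (intro integrable_continuous continuous_intros)
  ultimately have ae: "AE z in M. poly P z = 0"
    unfolding sqn_def by (subst (asm) integral_nonneg_eq_0_iff_AE) auto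
  define S where "S = {z. poly P z = 0} \<inter> unit_circle"
  have S: "finite S" "S \<subseteq> space M" using poly_roots_finite[OF assms] by (auto simp: S_def space_M)
  have single: "{s} \<in> sets M" if "s \<in> S" for s
    using that by (auto simp: sets_M sets_restrict_space S_def image_iff intro!: bexI[of _ "{s}"])
  have "emeasure M A = (\<Sum>s\<in>S. emeasure M {s} * emeasure (return M s) A)" if A: "A \<in> sets M" for A
  proof -
    have SA: "S \<inter> A \<in> sets M" "finite (S \<inter> A)"
    proof -
      have "(\<Union>s\<in>S \<inter> A. {s}) \<in> sets M" using single S by (intro sets.finite_UN) auto
      thus "S \<inter> A \<in> sets M" by simp
    qed (use S in auto)
    have "emeasure M A = emeasure M (S \<inter> A)"
      using ae A SA sets.sets_into_space[OF A] by (intro emeasure_eq_AE) (auto simp: S_def space_M elim!: eventually_mono intro: AE_I2)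
    also have "\<dots> = (\<Sum>s\<in>S \<inter> A. emeasure M {s})"
      using SA single by (intro emeasure_eq_sum_singleton) auto
    also have "\<dots> = (\<Sum>s\<in>S. emeasure M {s} * indicator A s)"
      using S(1) by (simp add: sum.inter_restrict indicator_def if_distrib cong: if_cong)
    also have "\<dots> = (\<Sum>s\<in>S. emeasure M {s} * emeasure (return M s) A)"
      using A by simp
    finally show ?thesis .
  qed
  thus False using nontrivial S unfolding nontrivial_measure_def
    by (auto dest!: spec[of _ S] spec[of _ "\<lambda>s. emeasure M {s}"])
qed

text \<open>Szego recursion used as the construction: the coefficient is chosen to give
  orthogonality to 1, and orthogonality to higher powers is inherited.\<close>

primrec OP :: "nat \<Rightarrow> complex poly" where
  "OP 0 = 1"
| "OP (Suc n) = pCons 0 (OP n) - smult (pairing 1 (pCons 0 (OP n)) / pairing 1 (star (OP n))) (star (OP n))"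

definition OP_coeff :: "nat \<Rightarrow> complex" where
  "OP_coeff n = cnj (pairing 1 (pCons 0 (OP n)) / pairing 1 (star (OP n)))"

lemma OP_Suc: "OP (Suc n) = pCons 0 (OP n) - smult (cnj (OP_coeff n)) (star (OP n))"
  by (simp add: OP_coeff_def)

lemma OP_degree_lead: "degree (OP n) = n \<and> lead_coeff (OP n) = 1"
proof (induction n)
  case (Suc n)
  have d: "degree (smult c (star (OP n))) < Suc n" for c
    using degree_star_le[of "OP n"] degree_smult_le[of c "star (OP n)"] Suc by linarith
  have nz: "OP n \<noteq> 0" using Suc by auto
  have l: "coeff (OP n) n = 1" using Suc by metis
  have d1: "degree (pCons 0 (OP n)) = Suc n" using Suc nz by simp
  have "degree (OP (Suc n)) = Suc n"
    unfolding OP_Suc diff_conv_add_uminus using d[of "- cnj (OP_coeff n)"] d1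
    by (subst degree_add_eq_left) auto
  moreover have "coeff (OP (Suc n)) (Suc n) = 1"
    unfolding OP_Suc using d[of "cnj (OP_coeff n)"] l by (simp add: coeff_eq_0 del: coeff_smult)
  ultimately show ?case by simp
qed simp

lemma degree_OP [simp]: "degree (OP n) = n" and lead_coeff_OP: "coeff (OP n) n = 1"
  using OP_degree_lead[of n] by auto

lemma poly_star_OP: "cmod z = 1 \<Longrightarrow> poly (star (OP n)) z = z ^ n * cnj (poly (OP n) z)"
  by (simp add: poly_star)

text \<open>Conjugation on the circle reverses the order of the powers, so orthogonality to degrees
  below \<open>n\<close> becomes orthogonality of the reversal to \<open>z\<close>, ...,
  \<open>z^n\<close>. Orthogonality is a hypothesis so that the lemma can serve inside the induction
  proving it.\<close>

lemma star_orthogonal_aux: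
  assumes orth: "\<And>Q. degree Q < n \<Longrightarrow> pairing Q (OP n) = 0"
    and "degree S < n"
  shows "pairing (pCons 0 S) (star (OP n)) = 0"
proof -
  have "degree S \<le> n - 1" using assms(2) by simp
  then obtain T where T: "degree T \<le> n - 1" "\<And>z. cmod z = 1 \<Longrightarrow> poly T z = z ^ (n - 1) * cnj (poly S z)"
    using conj_reflection by blast
  have n: "Suc (n - 1) = n" using assms(2) by simp
  have "pairing (pCons 0 S) (star (OP n)) = pairing (OP n) T"
  proof (rule pairing_cong)
    fix z :: complex assume z: "cmod z = 1"
    have "cnj z * z ^ n = z ^ (n - 1)"
      using unit_power_cnj[OF z, of 1 n] n by (simp add: mult.commute)
    hence "cnj z * cnj (poly S z) * (z ^ n * cnj (poly (OP n) z))
        = z ^ (n - 1) * cnj (poly S z) * cnj (poly (OP n) z)"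
      by (metis (no_types, lifting) mult.assoc mult.commute)
    thus "cnj (poly (pCons 0 S) z) * poly (star (OP n)) z = cnj (poly (OP n) z) * poly T z"
      by (simp add: poly_star_OP[OF z] T(2)[OF z] mult_ac)
  qed
  also have "\<dots> = cnj (pairing T (OP n))" by (simp add: pairing_cnj)
  also have "pairing T (OP n) = 0" using orth[of T] T(1) n by simp
  finally show ?thesis by simp
qed

text \<open>After reflection the pairing is with \<open>z^n\<close>, which differs from the monic
  \<open>OP n\<close> by lower degrees only. The denominator of the recursion is therefore
  positive.\<close>

lemma pairing_1_star:
  assumes "\<And>Q. degree Q < n \<Longrightarrow> pairing Q (OP n) = 0"
  shows "pairing 1 (star (OP n)) = of_real (sqn (OP n))"
proof -
  have "pairing 1 (star (OP n)) = pairing (OP n) (monom 1 n)"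
    by (rule pairing_cong) (simp add: poly_star_OP poly_monom)
  also have "\<dots> = cnj (pairing (OP n + (monom 1 n - OP n)) (OP n))" by (simp add: pairing_cnj)
  also have "pairing (OP n + (monom 1 n - OP n)) (OP n) = of_real (sqn (OP n))"
  proof (cases n)
    case 0
    thus ?thesis by (simp add: pairing_self)
  next
    case (Suc m)
    have "coeff (monom 1 n - OP n) k = 0" if "k \<ge> n" for k
      using that by (cases "k = n") (auto simp: lead_coeff_OP coeff_eq_0)
    hence "degree (monom 1 n - OP n) < n" using Suc by (intro degree_lessI) auto
    thus ?thesis unfolding pairing_add_left using assms by (simp add: pairing_self)
  qed
  finally show ?thesis by simp
qed

lemma OP_orthogonal: "degree Q < n \<Longrightarrow> pairing Q (OP n) = 0"
proof (induction n arbitrary: Q)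
  case (Suc n)
  \<comment> \<open>The constant is handled by the choice of coefficient. The multiple of
    \<open>z\<close> is handled by the isometry of multiplication by \<open>z\<close> and the
    orthogonality of the reversal.\<close>
  obtain q Q1 where Q: "Q = pCons q Q1" by (cases Q)
  have sp: "sqn (OP n) > 0" using lead_coeff_OP[of n] by (intro sqn_pos) auto
  have "pairing 1 (OP (Suc n)) = 0"
    unfolding OP.simps pairing_diff pairing_smult using pairing_1_star[of n, OF Suc.IH] sp by simp
  hence "pairing [:q:] (OP (Suc n)) = 0"
    using pairing_smult_left[of q 1 "OP (Suc n)"] by (simp del: OP.simps)
  moreover have "pairing (pCons 0 Q1) (OP (Suc n)) = 0"
  proof (cases "Q1 = 0")
    case True
    thus ?thesis by (simp add: pairing_def)
  next
    case False
    hence dQ1: "degree Q1 < n" using Suc.prems Q by simp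
    have "pairing (pCons 0 Q1) (pCons 0 (OP n)) = pairing Q1 (OP n)"
    proof (rule pairing_cong)
      fix z :: complex assume z: "cmod z = 1"
      have "cnj (z * poly Q1 z) * (z * poly (OP n) z) = (z * cnj z) * (cnj (poly Q1 z) * poly (OP n) z)"
        by (simp add: mult_ac)
      thus "cnj (poly (pCons 0 Q1) z) * poly (pCons 0 (OP n)) z = cnj (poly Q1 z) * poly (OP n) z"
        by (simp add: unit_mult_cnj[OF z])
    qed
    thus ?thesis
      unfolding OP_Suc pairing_diff pairing_smult
      using Suc.IH[OF dQ1] star_orthogonal_aux[of n Q1, OF Suc.IH dQ1] by simp
  qed
  moreover have "Q = [:q:] + pCons 0 Q1" by (simp add: Q)
  ultimately show ?case unfolding pairing_add_left by (metis add_0 pairing_add_left)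
qed simp

lemmas star_orthogonal = star_orthogonal_aux[OF OP_orthogonal]

lemma sqn_OP_pos: "sqn (OP n) > 0"
  using lead_coeff_OP[of n] by (intro sqn_pos) auto

lemma monic_OP_eq: "monic_OP M n = OP n"
  unfolding monic_OP_def
proof (rule the_equality)
  show "degree (OP n) = n \<and> lead_coeff (OP n) = 1 \<and>
      (\<forall>Q. degree Q < n \<longrightarrow> (LINT z|M. cnj (poly Q z) * poly (OP n) z) = 0)"
    using OP_orthogonal lead_coeff_OP by (simp add: pairing_def)
next
  fix P assume P: "degree P = n \<and> lead_coeff P = 1 \<and>
      (\<forall>Q. degree Q < n \<longrightarrow> (LINT z|M. cnj (poly Q z) * poly P z) = 0)"
  show "P = OP n"
  proof (rule ccontr)
    assume ne: "P \<noteq> OP n"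
    have "coeff (P - OP n) k = 0" if "k \<ge> n" for k
      using that P by (cases "k = n") (auto simp: lead_coeff_OP coeff_eq_0)
    hence "degree (P - OP n) < n" using ne by (intro degree_lessI) auto
    hence "pairing (P - OP n) P = 0" "pairing (P - OP n) (OP n) = 0"
      using P OP_orthogonal unfolding pairing_def by blast+
    hence "pairing (P - OP n) (P - OP n) = 0" unfolding pairing_diff[of "P - OP n"] by simp
    thus False using sqn_pos[of "P - OP n"] ne by (simp add: pairing_self)
  qed
qed

lemma OP_coeff_eq: "OP_coeff n = verblunsky M n"
proof -
  have "poly (OP (Suc n)) 0 = - cnj (OP_coeff n)"
    unfolding OP_Suc by (simp add: poly_star_0 lead_coeff_OP)
  thus ?thesis by (simp only: verblunsky_def monic_OP_eq) simp
qed

lemma sqn_star: "sqn (star (OP n)) = sqn (OP n)"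
  unfolding sqn_def
  by (rule Bochner_Integration.integral_cong) (auto simp: space_M poly_star_OP norm_mult norm_power)

lemma sqn_add:
  assumes "pairing P Q = 0"
  shows "sqn (P + Q) = sqn P + sqn Q"
proof -
  have "pairing Q P = 0" using assms pairing_cnj by (metis complex_cnj_zero)
  hence "pairing (P + Q) (P + Q) = pairing P P + pairing Q Q"
    unfolding pairing_add pairing_add_left using assms by simp
  thus ?thesis unfolding pairing_self by (metis of_real_add of_real_eq_iff)
qed

lemma sqn_smult: "sqn (smult c P) = (cmod c)\<^sup>2 * sqn P"
  by (simp add: sqn_def norm_mult power_mult_distrib)

text \<open>Pythagoras for the recursion, read as an orthogonal decomposition of
  \<open>z * OP n\<close>; multiplication by \<open>z\<close> and reversal preserve the
  norm.\<close>

lemma sqn_OP_Suc: "sqn (OP (Suc n)) = (1 - (cmod (verblunsky M n))\<^sup>2) * sqn (OP n)"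
proof -
  define c where "c = cnj (verblunsky M n)"
  have e: "OP (Suc n) + smult c (star (OP n)) = pCons 0 (OP n)"
    unfolding OP_Suc OP_coeff_eq c_def by simp
  have "pairing (smult c (star (OP n))) (OP (Suc n)) = 0"
    using degree_star_le[of "OP n"] degree_smult_le[of c "star (OP n)"]
    by (intro OP_orthogonal) simp
  hence "pairing (OP (Suc n)) (smult c (star (OP n))) = 0"
    using pairing_cnj by (metis complex_cnj_zero)
  from sqn_add[OF this] have "sqn (pCons 0 (OP n)) = sqn (OP (Suc n)) + (cmod c)\<^sup>2 * sqn (OP n)"
    unfolding e sqn_smult sqn_star .
  moreover have "sqn (pCons 0 (OP n)) = sqn (OP n)"
    unfolding sqn_def by (rule Bochner_Integration.integral_cong) (auto simp: space_M norm_mult)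
  ultimately show ?thesis by (simp add: c_def algebra_simps)
qed

lemma verblunsky_less_1: "cmod (verblunsky M n) < 1"
proof -
  have "1 - (cmod (verblunsky M n))\<^sup>2 > 0"
    using sqn_OP_Suc[of n] sqn_OP_pos[of n] sqn_OP_pos[of "Suc n"] by (metis zero_less_mult_pos2)
  thus ?thesis by (simp add: abs_square_less_1)
qed

text \<open>The power \<open>cis \<theta> ^ n\<close> in the reversal turns the conjugated
  half-angle factor back into itself, leaving one \<open>szego_step\<close>; the ratio of norms
  supplies \<open>szego_rho\<close>.\<close>

lemma poly_OP_cis:
  "poly (OP n) (cis \<theta>) = of_real (sqrt (sqn (OP n))) * (cis (real n * \<theta> / 2) * sol (verblunsky M) \<theta> 1 n)"
proof (induction n)
  case 0
  show ?case by (simp add: sqn_def prob_space)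
next
  case (Suc n)
  define f where "f = sol (verblunsky M) \<theta> 1 n"
  define v where "v = verblunsky M n"
  define N where "N = sqrt (sqn (OP n))"
  define e where "e = cis (real n * \<theta> / 2)"
  define h where "h = cis (\<theta> / 2)"
  have pw: "cis \<theta> ^ n * cnj e = e"
  proof -
    have "cis \<theta> ^ n = e * e" by (simp add: e_def Complex.DeMoivre cis_mult mult.commute[of \<theta>])
    moreover have "e * cnj e = 1" by (simp add: e_def unit_mult_cnj)
    ultimately show ?thesis by (simp add: mult.assoc)
  qed
  have hh: "h * h = cis \<theta>" "h * cnj h = 1" by (simp_all add: h_def cis_mult unit_mult_cnj)
  have eh: "cis (real (Suc n) * \<theta> / 2) = e * h"
    by (simp add: e_def h_def cis_mult algebra_simps add_divide_distrib)
  have R: "szego_rho v > 0" using verblunsky_less_1 by (simp add: szego_rho_pos v_def)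
  have N': "sqrt (sqn (OP (Suc n))) = szego_rho v * N"
    unfolding sqn_OP_Suc by (simp add: real_sqrt_mult szego_rho_def v_def N_def)
  have "poly (OP (Suc n)) (cis \<theta>) = cis \<theta> * poly (OP n) (cis \<theta>)
      - cnj v * (cis \<theta> ^ n * cnj (poly (OP n) (cis \<theta>)))"
    unfolding OP_Suc OP_coeff_eq by (simp add: poly_star_OP v_def)
  also have "\<dots> = of_real N * (cis \<theta> * e * f - cnj v * (cis \<theta> ^ n * cnj e) * cnj f)"
    unfolding Suc by (simp add: N_def e_def f_def algebra_simps)
  also have "\<dots> = of_real N * (cis \<theta> * e * f - cnj v * e * cnj f)"
    unfolding pw ..
  also have "cis \<theta> * e * f - cnj v * e * cnj f = (e * h) * (h * f - cnj (v * h * f))"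
  proof -
    have "(e * h) * (h * f - cnj (v * h * f)) = (h * h) * e * f - cnj v * e * cnj f * (h * cnj h)"
      by (simp add: algebra_simps)
    thus ?thesis unfolding hh by simp
  qed
  also have "of_real N * ((e * h) * (h * f - cnj (v * h * f)))
      = of_real (szego_rho v * N) * ((e * h) * szego_step v \<theta> f)"
    using R by (simp add: szego_step_def h_def)
  finally show ?case unfolding N' eh by (simp add: v_def f_def)
qed

lemma two_term_cauchy_schwarz:
  fixes a b A B k l :: real
  assumes "0 \<le> a" "0 \<le> b" "a\<^sup>2 \<le> A * k" "b\<^sup>2 = B * l" "0 \<le> A" "0 \<le> B" "0 \<le> k" "0 \<le> l"
  shows "(a + b)\<^sup>2 \<le> (A + B) * (k + l)"
proof -
  have "(a * b)\<^sup>2 \<le> (A * k) * (B * l)"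
    using assms by (simp add: power_mult_distrib mult_right_mono)
  also have "\<dots> = (A * l) * (B * k)" by simp
  also have "\<dots> \<le> ((A * l + B * k) / 2)\<^sup>2"
    using zero_le_power2[of "A * l - B * k"] by (simp add: power2_eq_square field_simps)
  finally have "a * b \<le> (A * l + B * k) / 2"
    using assms by (intro power2_le_imp_le[of "a * b"]) auto
  thus ?thesis using assms by (simp add: power2_sum algebra_simps)
qed

text \<open>Cauchy-Schwarz for the Christoffel-Darboux kernel, whose diagonal is the sum, obtained
  by splitting off the top orthogonal component one degree at a time.\<close>

lemma christoffel_bound:
  assumes "degree P \<le> n"
  shows "(cmod (poly P (cis \<theta>)))\<^sup>2 \<le> sqn P * (\<Sum>j\<le>n. (cmod (sol (verblunsky M) \<theta> 1 j))\<^sup>2)"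
  using assms
proof (induction n arbitrary: P)
  case 0
  then obtain c where "P = [:c:]" by (metis degree_0_id le_zero_eq)
  thus ?case using prob_space by (simp add: sqn_def)
next
  case (Suc n)
  define c where "c = coeff P (Suc n)"
  define P' where "P' = P - smult c (OP (Suc n))"
  have dP': "degree P' \<le> n"
  proof (rule degree_le, intro allI impI)
    fix i assume "n < i"
    thus "coeff P' i = 0" using Suc.prems lead_coeff_OP[of "Suc n"]
      unfolding P'_def by (cases "i = Suc n") (auto simp: c_def coeff_eq_0 simp del: OP.simps)
  qed
  have P: "P = P' + smult c (OP (Suc n))" by (simp add: P'_def del: OP.simps)
  have "pairing P' (smult c (OP (Suc n))) = 0"
    unfolding pairing_smult using OP_orthogonal[of P' "Suc n"] dP' by simp
  from sqn_add[OF this] have sq: "sqn P = sqn P' + sqn (smult c (OP (Suc n)))"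
    using P by simp
  let ?s = "\<lambda>j. (cmod (sol (verblunsky M) \<theta> 1 j))\<^sup>2"
  have "(cmod (poly P (cis \<theta>)))\<^sup>2 \<le> (cmod (poly P' (cis \<theta>)) + cmod (poly (smult c (OP (Suc n))) (cis \<theta>)))\<^sup>2"
    by (subst P) (simp add: power_mono norm_triangle_ineq del: OP.simps)
  also have "\<dots> \<le> (sqn P' + sqn (smult c (OP (Suc n)))) * ((\<Sum>j\<le>n. ?s j) + ?s (Suc n))"
  proof (rule two_term_cauchy_schwarz)
    show "(cmod (poly P' (cis \<theta>)))\<^sup>2 \<le> sqn P' * (\<Sum>j\<le>n. ?s j)" by (rule Suc.IH[OF dP'])
    show "(cmod (poly (smult c (OP (Suc n))) (cis \<theta>)))\<^sup>2 = sqn (smult c (OP (Suc n))) * ?s (Suc n)"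
      unfolding sqn_smult poly_smult poly_OP_cis
      by (simp add: norm_mult power_mult_distrib sqn_nonneg del: OP.simps sol.simps)
  qed (auto intro: sqn_nonneg sum_nonneg)
  finally show ?case unfolding sq by simp
qed

end

section \<open>Zeros of paraorthogonal polynomials and the support\<close>

context circle_measure
begin

definition para_OP :: "nat \<Rightarrow> complex \<Rightarrow> complex poly" where
  "para_OP n \<tau> = OP n - smult \<tau> (star (OP n))"

lemma degree_para_OP_le: "degree (para_OP n \<tau>) \<le> n"
  unfolding para_OP_def using degree_star_le[of "OP n"]
  by (intro degree_diff_le) (auto intro: order_trans[OF degree_smult_le])

text \<open>The coefficient of \<open>z^n\<close> is 1 minus \<tau> times a number of the modulus of
  a Verblunsky coefficient, hence nonzero.\<close>

lemma para_OP_nonzero: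
  assumes "cmod \<tau> = 1" "n > 0"
  shows "para_OP n \<tau> \<noteq> 0"
proof
  obtain m where m: "n = Suc m" using assms(2) by (cases n) auto
  assume "para_OP n \<tau> = 0"
  hence "coeff (OP n) n - \<tau> * coeff (star (OP n)) n = 0"
    unfolding para_OP_def by (metis coeff_0 coeff_diff coeff_smult)
  hence "1 = \<tau> * cnj (poly (OP n) 0)"
    using coeff_star_degree[of "OP n"] lead_coeff_OP[of n] by simp
  moreover have "poly (OP n) 0 = - cnj (verblunsky M m)"
    unfolding m verblunsky_def monic_OP_eq by simp
  ultimately have "1 = cmod \<tau> * cmod (verblunsky M m)"
    by (metis complex_mod_cnj norm_minus_cancel norm_mult norm_one)
  thus False using assms(1) verblunsky_less_1[of m] by simp
qed

text \<open>The nodes are the zeros of a paraorthogonal polynomial. Subtracting from \<^term>\<open>f\<close> the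
  squared modulus of a polynomial interpolating its square root leaves a multiple of that
  polynomial, which integrates to zero; so no quadrature weights are needed.\<close>

lemma quadrature_nonneg:
  fixes f :: "complex \<Rightarrow> real"
  assumes tau: "cmod \<tau> = 1"
    and Z: "finite Z" "card Z = Suc m" "Z \<subseteq> unit_circle" "\<And>z. z \<in> Z \<Longrightarrow> poly (para_OP (Suc m) \<tau>) z = 0"
    and Q: "degree Q \<le> 2 * m" "\<And>z. cmod z = 1 \<Longrightarrow> poly Q z = z ^ m * of_real (f z)"
    and nonneg: "\<And>z. z \<in> Z \<Longrightarrow> f z \<ge> 0"
  shows "(LINT z|M. f z) \<ge> 0"
proof -
  define h where "h = para_OP (Suc m) \<tau>"
  have h0: "h \<noteq> 0" using para_OP_nonzero[OF tau] by (simp add: h_def)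
  have "Z \<subseteq> {z. poly h z = 0}" using Z(4) by (auto simp: h_def)
  hence "Suc m \<le> card {z. poly h z = 0}"
    unfolding Z(2)[symmetric] by (rule card_mono[OF poly_roots_finite[OF h0]])
  hence dh: "degree h = Suc m"
    using card_poly_roots_bound[OF h0] degree_para_OP_le[of "Suc m" \<tau>] by (simp add: h_def)
  obtain R where R: "degree R \<le> m" "\<And>z. z \<in> Z \<Longrightarrow> poly R z = of_real (sqrt (f z))"
    using interpolation_exists[OF Z(1), of "\<lambda>z. of_real (sqrt (f z))"] Z(2) by auto
  obtain S where S: "degree S \<le> m" "\<And>z. cmod z = 1 \<Longrightarrow> poly S z = z ^ m * cnj (poly R z)"
    using conj_reflection[OF R(1)] by blast
  define V where "V = Q - R * S"
  have "degree (R * S) \<le> 2 * m" using degree_mult_le[of R S] R(1) S(1) by linarith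
  hence dV: "degree V \<le> 2 * m" unfolding V_def using Q(1) by (intro degree_diff_le)
  have V0: "poly V z = 0" if "z \<in> Z" for z
  proof -
    have z: "cmod z = 1" using that Z(3) by auto
    have "of_real (sqrt (f z)) * of_real (sqrt (f z)) = (of_real (f z) :: complex)"
      using nonneg[OF that] by (simp flip: of_real_mult)
    thus ?thesis using that by (simp add: V_def Q(2)[OF z] S(2)[OF z] R(2) algebra_simps)
  qed
  \<comment> \<open>\<open>V\<close> vanishes at the \<open>m + 1\<close> zeros of \<open>h\<close>,
    which are too many for a nonzero remainder of degree at most \<open>m\<close>.\<close>
  have "V mod h = 0"
  proof (rule ccontr)
    assume ne: "V mod h \<noteq> 0"
    have "poly (V mod h) z = 0" if "z \<in> Z" for z
    proof -
      have "poly V z = poly (V div h * h + V mod h) z" by simp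
      hence "poly V z = poly (V div h) z * poly h z + poly (V mod h) z" by (simp only: poly_add poly_mult)
      thus ?thesis using V0[OF that] Z(4)[OF that] by (simp add: h_def)
    qed
    hence "card Z \<le> card {z. poly (V mod h) z = 0}"
      using poly_roots_finite[OF ne] by (intro card_mono) auto
    also have "\<dots> \<le> degree (V mod h)" by (rule card_poly_roots_bound[OF ne])
    also have "\<dots> < degree h" using ne h0 degree_mod_less' by blast
    finally show False using Z(2) dh by simp
  qed
  hence V: "V = V div h * h" by (metis add.right_neutral div_mult_mod_eq)
  define q where "q = V div h"
  have qzero: "(LINT z|M. cnj (z ^ m) * poly V z) = 0"
  proof (cases "q = 0")
    case True
    thus ?thesis using V by (simp add: q_def)
  next
    case False
    have "degree V = degree q + Suc m"
      using V False h0 dh by (metis degree_mult_eq q_def)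
    hence m: "m > 0" "degree q \<le> m - 1" using dV by auto
    \<comment> \<open>The integral pairs \<open>h\<close> with \<open>z * T\<close>, of degree at
      most \<open>m\<close> and without constant term. Both \<open>OP (Suc m)\<close> and its
      reversal are orthogonal to such polynomials.\<close>
    obtain T where T: "degree T \<le> m - 1" "\<And>z. cmod z = 1 \<Longrightarrow> poly T z = z ^ (m - 1) * cnj (poly q z)"
      using conj_reflection[OF m(2)] by blast
    have "degree (pCons 0 T) \<le> Suc (degree T)" by (rule degree_pCons_le)
    hence d: "degree (pCons 0 T) < Suc m" using T(1) m(1) by simp
    have "(LINT z|M. cnj (z ^ m) * poly V z) = pairing (pCons 0 T) h"
      unfolding pairing_def
    proof (rule Bochner_Integration.integral_cong[OF refl])
      fix z assume "z \<in> space M"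
      hence z: "cmod z = 1" by (simp add: space_M)
      have "z * z ^ (m - 1) = z ^ m" using m(1) by (cases m) auto
      hence "cnj z * cnj z ^ (m - 1) = cnj z ^ m" by (metis complex_cnj_mult complex_cnj_power)
      moreover have "poly V z = poly q z * poly h z" using V by (metis poly_mult q_def)
      ultimately show "cnj (z ^ m) * poly V z = cnj (poly (pCons 0 T) z) * poly h z"
        by (simp add: T(2)[OF z] mult_ac)
    qed
    also have "\<dots> = 0"
      unfolding h_def para_OP_def pairing_diff pairing_smult
      using OP_orthogonal[OF d] star_orthogonal[where S = T and n = "Suc m"] T(1) m(1) by (simp del: OP.simps)
    finally show ?thesis .
  qed
  have "of_real (LINT z|M. f z) = (LINT z|M. of_real (f z) :: complex)"
    by (simp only: integral_complex_of_real)
  also have "\<dots> = (LINT z|M. cnj (poly R z) * poly R z + cnj (z ^ m) * poly V z)"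
  proof (rule Bochner_Integration.integral_cong[OF refl])
    fix z assume "z \<in> space M"
    hence z: "cmod z = 1" by (simp add: space_M)
    have u: "cnj (z ^ m) * z ^ m = 1"
      using unit_power_cnj[OF z, of m m] by (simp add: mult.commute)
    have "cnj (z ^ m) * poly V z = (cnj (z ^ m) * z ^ m) * of_real (f z)
        - (cnj (z ^ m) * z ^ m) * (cnj (poly R z) * poly R z)"
      by (simp add: V_def Q(2)[OF z] S(2)[OF z] algebra_simps)
    thus "complex_of_real (f z) = cnj (poly R z) * poly R z + cnj (z ^ m) * poly V z"
      unfolding u by simp
  qed
  also have "\<dots> = pairing R R + (LINT z|M. cnj (z ^ m) * poly V z)"
    unfolding pairing_def
    by (intro Bochner_Integration.integral_add integrable_continuous continuous_intros)
  also have "\<dots> = of_real (sqn R)" unfolding qzero pairing_self by simp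
  finally have "(LINT z|M. f z) = sqn R" by (simp only: of_real_eq_iff)
  thus ?thesis using sqn_nonneg by simp
qed

text \<open>\<open>Re (cnj s * z)\<close> is the cosine of the angle from \<open>s\<close>. The
  factor \<open>c - cos\<close> is negative only on an arc around \<open>s\<close>, the power of
  \<open>1 + cos\<close> concentrates weight there, and \<open>z^m\<close> clears the negative
  powers of \<open>z\<close>.\<close>

lemma bump_polynomial:
  fixes s :: complex and c :: real
  assumes "Suc k \<le> m" "cmod s = 1"
  shows "\<exists>Q. degree Q \<le> 2 * m \<and>
    (\<forall>z. cmod z = 1 \<longrightarrow> poly Q z = z ^ m * of_real ((c - Re (cnj s * z)) * (1 + Re (cnj s * z)) ^ k))"
proof -
  define A where "A = [:- s / 2, of_real c, - cnj s / 2:]"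
  define B where "B = [:s / 2, 1, cnj s / 2:]"
  define Q where "Q = monom 1 (m - Suc k) * (A * B ^ k)"
  have "degree (B ^ k) \<le> 2 * k"
    using degree_power_le[of B k] by (rule order_trans) (simp add: B_def)
  hence "degree (A * B ^ k) \<le> 2 + 2 * k"
    using degree_mult_le[of A "B ^ k"] by (simp add: A_def split: if_splits)
  hence "degree Q \<le> (m - Suc k) + (2 + 2 * k)"
    unfolding Q_def using degree_mult_le[of "monom 1 (m - Suc k) :: complex poly" "A * B ^ k"]
    by (simp add: degree_monom_eq)
  hence "degree Q \<le> 2 * m" using assms(1) by linarith
  moreover have "poly Q z = z ^ m * of_real ((c - Re (cnj s * z)) * (1 + Re (cnj s * z)) ^ k)"
    if z: "cmod z = 1" for z
  proof -
    have re: "complex_of_real (Re (cnj s * z)) = (cnj s * z + s * cnj z) / 2"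
      using complex_add_cnj[of "cnj s * z"] by simp
    have "z * of_real (Re (cnj s * z)) = (cnj s * z\<^sup>2 + s * (z * cnj z)) / 2"
      unfolding re by (simp add: power2_eq_square algebra_simps)
    hence y: "z * of_real (Re (cnj s * z)) = (cnj s * z\<^sup>2 + s) / 2"
      unfolding unit_mult_cnj[OF z] by simp
    have A: "poly A z = z * of_real (c - Re (cnj s * z))"
      unfolding of_real_diff right_diff_distrib y by (simp add: A_def power2_eq_square field_simps)
    have B: "poly B z = z * of_real (1 + Re (cnj s * z))"
      unfolding of_real_add distrib_left y by (simp add: B_def power2_eq_square field_simps)
    have "poly Q z = z ^ (m - Suc k) * z ^ Suc k * of_real ((c - Re (cnj s * z)) * (1 + Re (cnj s * z)) ^ k)"
      unfolding Q_def poly_mult poly_power A B by (simp add: poly_monom power_mult_distrib)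
    moreover have "z ^ (m - Suc k) * z ^ Suc k = z ^ m"
      using assms(1) by (metis le_add_diff_inverse2 power_add)
    ultimately show ?thesis by (simp only:)
  qed
  ultimately show ?thesis by blast
qed

lemma Re_mult_cnj_dist:
  assumes "cmod s = 1" "cmod z = 1"
  shows "(cmod (z - s))\<^sup>2 = 2 - 2 * Re (cnj s * z)"
proof -
  have "(cmod (z - s))\<^sup>2 = (cmod z)\<^sup>2 + (cmod s)\<^sup>2 - 2 * Re (cnj s * z)"
    unfolding cmod_power2 by (simp add: power2_eq_square algebra_simps)
  thus ?thesis using assms by simp
qed

lemma abs_Re_mult_cnj_le: "cmod s = 1 \<Longrightarrow> cmod z = 1 \<Longrightarrow> \<bar>Re (cnj s * z)\<bar> \<le> 1"
  using abs_Re_le_cmod[of "cnj s * z"] by (simp add: norm_mult del: times_complex.simps)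

text \<open>A smaller arc around \<open>s\<close>, where the cosine exceeds \<open>c' > c\<close>,
  has positive mass. The negative contribution there grows like \<open>(1 + c') ^ k\<close>, against
  at most \<open>2 * (1 + c) ^ k\<close> from the positive part.\<close>

lemma bump_integral_negative:
  assumes s: "s \<in> measure_support M" and c: "- 1 < c" "c < 1"
  shows "\<exists>k. (LINT z|M. (c - Re (cnj s * z)) * (1 + Re (cnj s * z)) ^ k) < 0"
proof -
  have s1: "cmod s = 1" using s by (auto simp: measure_support_def space_M)
  define c' where "c' = (1 + c) / 2"
  have c': "c < c'" "c' < 1" using c by (auto simp: c'_def)
  define y where "y = (\<lambda>z. Re (cnj s * z))"
  have yc: "continuous_on S y" for S unfolding y_def by (intro continuous_intros)
  define E where "E = {z \<in> space M. c' < y z}"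
  have E: "E \<in> sets M"
    unfolding E_def by (intro borel_measurable_less measurable_continuous yc) simp
  define e where "e = sqrt (2 - 2 * c')"
  have e: "e > 0" "e\<^sup>2 = 2 - 2 * c'" using c' by (auto simp: e_def)
  have "ball s e \<inter> space M \<subseteq> E"
  proof
    fix z assume z: "z \<in> ball s e \<inter> space M"
    hence "(cmod (z - s))\<^sup>2 < e\<^sup>2"
      by (intro power_strict_mono) (auto simp: dist_norm norm_minus_commute)
    thus "z \<in> E" using z Re_mult_cnj_dist[OF s1, of z] e(2) by (auto simp: E_def y_def space_M)
  qed
  hence "emeasure M (ball s e \<inter> space M) \<le> emeasure M E" by (rule emeasure_mono[OF _ E])
  moreover have "emeasure M (ball s e \<inter> space M) > 0" using s e(1) by (simp add: measure_support_def)
  ultimately have "emeasure M E > 0" by (rule less_le_trans[rotated])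
  hence mE: "prob E > 0" by (simp add: emeasure_eq_measure)
  define t where "t = (c' - c) * prob E"
  have t: "t > 0" using c' mE by (simp add: t_def)
  have "(1 + c') / (1 + c) > 1" using c c' by (simp add: field_simps)
  then obtain k where k: "2 / t < ((1 + c') / (1 + c)) ^ k"
    using real_arch_pow by blast
  hence k': "2 * (1 + c) ^ k < t * (1 + c') ^ k"
    using t c by (simp add: power_divide field_simps)
  define f where "f = (\<lambda>z. (c - y z) * (1 + y z) ^ k)"
  have fb: "f z \<le> 2 * (1 + c) ^ k - (c' - c) * (1 + c') ^ k * indicator E z" if "z \<in> space M" for z
  proof -
    have yb: "\<bar>y z\<bar> \<le> 1" using abs_Re_mult_cnj_le[OF s1] that by (simp add: y_def space_M del: times_complex.simps)
    consider "y z \<le> c" | "c < y z" "y z \<le> c'" | "c' < y z" by linarith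
    thus ?thesis
    proof cases
      case 1
      have "(c - y z) * (1 + y z) ^ k \<le> 2 * (1 + c) ^ k"
        using 1 yb c by (intro mult_mono power_mono) auto
      thus ?thesis using 1 c' by (simp add: f_def E_def)
    next
      case 2
      hence "f z \<le> 0" unfolding f_def using yb by (intro mult_nonpos_nonneg) auto
      moreover have "0 \<le> 2 * (1 + c) ^ k" using c by simp
      ultimately show ?thesis using 2 unfolding E_def by simp
    next
      case 3
      have "(c' - c) * (1 + c') ^ k \<le> (y z - c) * (1 + y z) ^ k"
        using 3 c c' by (intro mult_mono power_mono) auto
      moreover have "0 \<le> 2 * (1 + c) ^ k" using c by simp
      moreover have "f z = - ((y z - c) * (1 + y z) ^ k)" by (simp add: f_def algebra_simps)
      moreover have "indicator E z = (1::real)" using 3 that by (simp add: E_def)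
      ultimately show ?thesis by simp
    qed
  qed
  have "(LINT z|M. f z) \<le> (LINT z|M. 2 * (1 + c) ^ k - (c' - c) * (1 + c') ^ k * indicator E z)"
  proof (rule integral_mono)
    show "integrable M f" unfolding f_def by (intro integrable_continuous continuous_intros yc)
    show "integrable M (\<lambda>z. 2 * (1 + c) ^ k - (c' - c) * (1 + c') ^ k * indicator E z)"
      using E by (intro Bochner_Integration.integrable_diff integrable_mult_right integrable_const
          integrable_real_indicator) (auto simp: emeasure_eq_measure)
  qed (rule fb)
  also have "\<dots> = 2 * (1 + c) ^ k - (c' - c) * (1 + c') ^ k * prob E"
    using E prob_space
    by (subst Bochner_Integration.integral_diff)
      (auto simp: emeasure_eq_measure intro!: integrable_real_indicator)
  also have "\<dots> < 0" using k' by (simp add: t_def mult_ac)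
  finally show ?thesis unfolding f_def y_def by blast
qed

end

section \<open>Counting zeros and support points by lifted angles\<close>

lemma ang_theta_2pi_nat: "ang a (\<theta> + 2 * pi * real k) x n = ang a \<theta> x n + pi * (real n * real k)"
proof (induction k)
  case (Suc k)
  have "ang a (\<theta> + 2 * pi * real (Suc k)) x n = ang a ((\<theta> + 2 * pi * real k) + 2 * pi) x n"
    by (simp add: algebra_simps)
  thus ?case unfolding ang_theta_2pi Suc by (simp add: algebra_simps)
qed simp

lemma ang_theta_2pi_int: "ang a (\<theta> + 2 * pi * of_int k) x n = ang a \<theta> x n + pi * of_int (int n * k)"
proof (cases "k \<ge> 0")
  case True
  thus ?thesis using ang_theta_2pi_nat[of a \<theta> "nat k" x n] by simp
next
  case False
  thus ?thesis using ang_theta_2pi_nat[of a "\<theta> + 2 * pi * of_int k" "nat (- k)" x n] by simp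
qed

lemma cis_eq_iff_int: "cis s = cis t \<longleftrightarrow> (\<exists>k::int. s = t + 2 * pi * of_int k)"
proof -
  have "cis s = cis t \<longleftrightarrow> sin s = sin t \<and> cos s = cos t" by (auto simp: complex_eq_iff)
  thus ?thesis using sin_cos_eq_iff[of s t] by (simp add: mult_ac)
qed

lemma cos_le_cos_outside_arc:
  assumes "0 \<le> \<epsilon>" "\<And>k::int. \<bar>u + 2 * pi * of_int k\<bar> \<ge> \<epsilon>" "\<epsilon> \<le> pi"
  shows "cos u \<le> cos \<epsilon>"
proof -
  define k where "k = - round (u / (2 * pi))"
  define x where "x = u + 2 * pi * of_int k"
  have "\<bar>of_int (round (u / (2 * pi))) - u / (2 * pi)\<bar> \<le> 1/2" by (rule of_int_round_abs_le)
  hence "(2 * pi) * \<bar>of_int (round (u / (2 * pi))) - u / (2 * pi)\<bar> \<le> (2 * pi) * (1/2)"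
    by (intro mult_left_mono) auto
  also have "(2 * pi) * \<bar>of_int (round (u / (2 * pi))) - u / (2 * pi)\<bar>
      = \<bar>(2 * pi) * (of_int (round (u / (2 * pi))) - u / (2 * pi))\<bar>"
    by (simp only: abs_mult) simp
  also have "(2 * pi) * (of_int (round (u / (2 * pi))) - u / (2 * pi)) = - x"
    by (simp add: x_def k_def field_simps)
  finally have "\<bar>x\<bar> \<le> pi" by simp
  moreover have "\<bar>x\<bar> \<ge> \<epsilon>" unfolding x_def by (rule assms(2))
  ultimately have "cos \<bar>x\<bar> \<le> cos \<epsilon>" using assms(1) by (intro cos_monotone_0_pi_le) auto
  moreover have "cis x = cis u" unfolding x_def cis_eq_iff_int by blast
  hence "cos x = cos u" by (simp add: complex_eq_iff)
  ultimately show ?thesis by simp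
qed

lemma finite_pos_lower_bound:
  fixes F :: "real set"
  assumes "finite F" "\<And>x. x \<in> F \<Longrightarrow> x > 0"
  shows "\<exists>e>0. \<forall>x\<in>F. e \<le> x"
  using assms by (intro exI[of _ "Min (insert 1 F)"]) (auto simp: Min_gr_iff)

lemma card_int_interval_le:
  fixes lo hi :: real
  assumes "finite J" "\<And>j. j \<in> J \<Longrightarrow> lo \<le> of_int j \<and> of_int j \<le> hi" "lo \<le> hi"
  shows "real (card J) \<le> hi - lo + 1"
proof -
  have "J \<subseteq> {\<lceil>lo\<rceil>..\<lfloor>hi\<rfloor>}"
    using assms(2) by (auto simp: ceiling_le_iff le_floor_iff)
  hence "card J \<le> card {\<lceil>lo\<rceil>..\<lfloor>hi\<rfloor>}" by (intro card_mono) auto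
  also have "\<dots> = nat (\<lfloor>hi\<rfloor> + 1 - \<lceil>lo\<rceil>)" by simp
  finally have "real (card J) \<le> real (nat (\<lfloor>hi\<rfloor> + 1 - \<lceil>lo\<rceil>))" by simp
  also have "\<dots> \<le> hi - lo + 1" using assms(3) by linarith
  finally show ?thesis .
qed

context circle_measure
begin

text \<open>In polar form the polynomial and its reversal have opposite phases times a common
  factor, so their quotient has twice the angle as phase and only the angle modulo pi
  matters.\<close>

lemma para_OP_zero:
  assumes "ang (verblunsky M) \<theta> 0 n = c + pi * of_int j"
  shows "poly (para_OP n (cis (2 * c))) (cis \<theta>) = 0"
proof -
  obtain s where s: "s > 0" "sol (verblunsky M) \<theta> 1 n = of_real s * cis (ang (verblunsky M) \<theta> 0 n)"
    using sol_polar[where a="verblunsky M" and r=1 and x=0 and \<theta>=\<theta> and n=n, OF verblunsky_less_1] by auto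
  define e where "e = cis (real n * \<theta> / 2)"
  define N where "N = complex_of_real (sqrt (sqn (OP n)))"
  have "cis \<theta> ^ n = e * e"
    by (simp add: e_def Complex.DeMoivre cis_mult mult.commute[of \<theta>])
  moreover have "e * cnj e = 1" by (simp add: e_def unit_mult_cnj)
  ultimately have pw: "cis \<theta> ^ n * cnj e = e" by (simp add: mult.assoc)
  have "cis (2 * c) * cis (- (c + pi * of_int j)) = cis (c - pi * of_int j)"
    by (simp add: cis_mult)
  also have "\<dots> = cis (c + pi * of_int j)"
    unfolding cis_eq_iff_int by (intro exI[of _ "- j"]) simp
  finally have ph: "cis (2 * c) * cnj (cis (c + pi * of_int j)) = cis (c + pi * of_int j)"
    by (simp add: cis_cnj)
  have P: "poly (OP n) (cis \<theta>) = N * (e * (of_real s * cis (c + pi * of_int j)))"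
    unfolding poly_OP_cis s(2) assms by (simp add: N_def e_def)
  have "cis (2 * c) * (cis \<theta> ^ n * cnj (poly (OP n) (cis \<theta>)))
      = N * (cis \<theta> ^ n * cnj e) * of_real s * (cis (2 * c) * cnj (cis (c + pi * of_int j)))"
    unfolding P by (simp add: N_def mult_ac)
  also have "\<dots> = poly (OP n) (cis \<theta>)" unfolding pw ph P by (simp add: mult_ac)
  finally show ?thesis by (simp add: para_OP_def poly_star_OP)
qed

text \<open>With no node in the arc, a test function peaked at \<open>cis t\<close> would be
  nonnegative at all nodes, and quadrature would contradict its negative integral.\<close>

lemma support_arc_zero:
  assumes s: "cis t \<in> measure_support M" and e: "0 < \<epsilon>" "\<epsilon> < pi"
  shows "\<exists>n0. \<forall>n\<ge>n0. \<exists>\<theta> j::int. \<bar>\<theta> - t\<bar> < \<epsilon> \<and>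
    ang (verblunsky M) \<theta> 0 n = ang (verblunsky M) 0 0 n + pi * of_int j"
proof -
  define \<psi> where "\<psi> = (\<lambda>n \<theta>. ang (verblunsky M) \<theta> 0 n)"
  have c: "- 1 < cos \<epsilon>" "cos \<epsilon> < 1"
    using cos_monotone_0_pi[of 0 \<epsilon>] cos_monotone_0_pi[of \<epsilon> pi] e by auto
  obtain k where k: "(LINT z|M. (cos \<epsilon> - Re (cnj (cis t) * z)) * (1 + Re (cnj (cis t) * z)) ^ k) < 0"
    using bump_integral_negative[OF s c] by blast
  \<comment> \<open>The test function has trigonometric degree \<open>k + 1\<close> and
    \<open>n\<close> nodes serve up to degree \<open>n - 1\<close>; hence
    \<open>n \<ge> k + 2\<close>.\<close>
  have "\<exists>\<theta> j::int. \<bar>\<theta> - t\<bar> < \<epsilon> \<and> \<psi> n \<theta> = \<psi> n 0 + pi * of_int j" if n: "n \<ge> k + 2" for n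
  proof (rule ccontr)
    assume none: "\<not> ?thesis"
    obtain m where m: "n = Suc m" "Suc k \<le> m" using n by (cases n) auto
    have top: "\<psi> n (2 * pi) = \<psi> n 0 + pi * real n"
      using ang_theta_2pi[of "verblunsky M" 0 0 n] by (simp add: \<psi>_def)
    \<comment> \<open>The angle grows by \<open>pi * n\<close> over one turn, so intermediate values
      give \<open>n\<close> nodes. Excluding 2 pi keeps the points of the circle distinct.\<close>
    have "\<exists>\<theta>. 0 \<le> \<theta> \<and> \<theta> < 2 * pi \<and> \<psi> n \<theta> = \<psi> n 0 + pi * real j" if "j < n" for j
    proof -
      have jn: "pi * real j < pi * real n" using that by simp
      have "continuous_on {0..2 * pi} (\<psi> n)"
        unfolding \<psi>_def by (intro continuous_on_ang verblunsky_less_1)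
      then obtain \<theta> where \<theta>: "0 \<le> \<theta>" "\<theta> \<le> 2 * pi" "\<psi> n \<theta> = \<psi> n 0 + pi * real j"
        using IVT'[of "\<psi> n" 0 "\<psi> n 0 + pi * real j" "2 * pi"] top jn by auto
      moreover have "\<theta> \<noteq> 2 * pi" using \<theta>(3) top jn by auto
      ultimately show ?thesis by (intro exI[of _ \<theta>]) auto
    qed
    then obtain th where th: "\<And>j. j < n \<Longrightarrow> 0 \<le> th j" "\<And>j. j < n \<Longrightarrow> th j < 2 * pi"
      "\<And>j. j < n \<Longrightarrow> \<psi> n (th j) = \<psi> n 0 + pi * real j" by metis
    define Z where "Z = (\<lambda>j. cis (th j)) ` {..<n}"
    have "inj_on (\<lambda>j. cis (th j)) {..<n}"
    proof (rule inj_onI)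
      fix i j assume ij: "i \<in> {..<n}" "j \<in> {..<n}" "cis (th i) = cis (th j)"
      then obtain l :: int where l: "th i = th j + 2 * pi * of_int l" unfolding cis_eq_iff_int by blast
      have "2 * pi * of_int l < 2 * pi * 1" "2 * pi * (- 1) < 2 * pi * of_int l"
        using l ij(1,2) th(1,2)[of i] th(1,2)[of j] unfolding lessThan_iff by linarith+
      hence "real_of_int l < 1" "- 1 < real_of_int l"
        by (simp_all only: mult_less_cancel_left_pos pi_gt_zero zero_less_mult_iff zero_less_numeral simp_thms)
      hence "l = 0" by linarith
      hence "\<psi> n (th i) = \<psi> n (th j)" using l by simp
      thus "i = j" using th(3)[of i] th(3)[of j] ij by simp
    qed
    hence cZ: "card Z = Suc m" unfolding Z_def m(1)[symmetric] by (simp add: card_image)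
    obtain Q where Q: "degree Q \<le> 2 * m" "\<And>z. cmod z = 1 \<Longrightarrow>
        poly Q z = z ^ m * of_real ((cos \<epsilon> - Re (cnj (cis t) * z)) * (1 + Re (cnj (cis t) * z)) ^ k)"
      using bump_polynomial[OF m(2), of "cis t" "cos \<epsilon>"] by auto
    have "(LINT z|M. (cos \<epsilon> - Re (cnj (cis t) * z)) * (1 + Re (cnj (cis t) * z)) ^ k) \<ge> 0"
    proof (rule quadrature_nonneg[where \<tau> = "cis (2 * \<psi> n 0)" and Z = Z, OF _ _ cZ _ _ Q])
      show "poly (para_OP (Suc m) (cis (2 * \<psi> n 0))) z = 0" if "z \<in> Z" for z
      proof -
        obtain j where j: "j < n" "z = cis (th j)" using \<open>z \<in> Z\<close> by (auto simp: Z_def)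
        show ?thesis unfolding j(2) m(1)[symmetric]
          by (rule para_OP_zero[where j = "int j"]) (use th(3)[OF j(1)] in \<open>simp add: \<psi>_def\<close>)
      qed
      show "0 \<le> (cos \<epsilon> - Re (cnj (cis t) * z)) * (1 + Re (cnj (cis t) * z)) ^ k" if "z \<in> Z" for z
      proof -
        obtain j where j: "j < n" "z = cis (th j)" using \<open>z \<in> Z\<close> by (auto simp: Z_def)
        have "cnj (cis t) * z = cis (th j - t)" by (simp add: j(2) cis_cnj cis_mult)
        hence re: "Re (cnj (cis t) * z) = cos (th j - t)" by (simp only:) simp
        have "cos (th j - t) \<le> cos \<epsilon>"
        proof (rule cos_le_cos_outside_arc)
          fix l :: int
          have "\<psi> n (th j + 2 * pi * of_int l) = \<psi> n 0 + pi * of_int (int j + int n * l)"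
            unfolding \<psi>_def ang_theta_2pi_int using th(3)[OF j(1)] by (simp add: \<psi>_def algebra_simps)
          hence "\<not> \<bar>(th j + 2 * pi * of_int l) - t\<bar> < \<epsilon>" using none by blast
          thus "\<bar>th j - t + 2 * pi * of_int l\<bar> \<ge> \<epsilon>" by (simp add: algebra_simps)
        qed (use e in auto)
        moreover have "- 1 \<le> cos (th j - t)" by simp
        ultimately show ?thesis unfolding re by (intro mult_nonneg_nonneg zero_le_power) linarith+
      qed
    qed (auto simp: Z_def)
    thus False using k by simp
  qed
  thus ?thesis unfolding \<psi>_def by blast
qed

text \<open>Disjoint arcs around the support points each contain a zero, and strict monotonicity
  assigns distinct levels modulo pi to distinct zeros. It remains to count multiples of pi in an
  interval.\<close>

lemma card_support_le:
  assumes S: "finite S" "S \<noteq> {}" "S \<subseteq> {a<..<b}" "\<And>t. t \<in> S \<Longrightarrow> cis t \<in> measure_support M"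
  shows "\<exists>n0. \<forall>n\<ge>n0. real (card S) \<le> (ang (verblunsky M) b 0 n - ang (verblunsky M) a 0 n) / pi + 1"
proof -
  define \<psi> where "\<psi> = (\<lambda>n \<theta>. ang (verblunsky M) \<theta> 0 n)"
  \<comment> \<open>Half a lower bound for these distances makes the arcs disjoint and keeps them
    inside the interval; the entry 1 keeps the radius below pi.\<close>
  define F where "F = (\<lambda>t. t - a) ` S \<union> (\<lambda>t. b - t) ` S \<union> (\<lambda>(t, t'). \<bar>t - t'\<bar>) ` {x \<in> S \<times> S. fst x \<noteq> snd x} \<union> {1}"
  have "finite F" unfolding F_def using S(1) by auto
  moreover have "x > 0" if "x \<in> F" for x using that S(3) by (auto simp: F_def)
  ultimately obtain e where e: "e > 0" "\<And>x. x \<in> F \<Longrightarrow> e \<le> x"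
    using finite_pos_lower_bound[of F] by blast
  define \<epsilon> where "\<epsilon> = e / 2"
  have \<epsilon>: "0 < \<epsilon>" "\<epsilon> < pi" using e(1) e(2)[of 1] pi_gt3 by (auto simp: \<epsilon>_def F_def)
  have sep: "2 * \<epsilon> \<le> \<bar>t - t'\<bar>" if "t \<in> S" "t' \<in> S" "t \<noteq> t'" for t t'
    using e(2)[of "\<bar>t - t'\<bar>"] that by (force simp: \<epsilon>_def F_def)
  have ins: "a + 2 * \<epsilon> \<le> t" "t + 2 * \<epsilon> \<le> b" if "t \<in> S" for t
    using e(2)[of "t - a"] e(2)[of "b - t"] that by (auto simp: \<epsilon>_def F_def)
  have "\<forall>t\<in>S. \<exists>n0. \<forall>n\<ge>n0. \<exists>\<theta> j::int. \<bar>\<theta> - t\<bar> < \<epsilon> \<and> \<psi> n \<theta> = \<psi> n 0 + pi * of_int j"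
    unfolding \<psi>_def using support_arc_zero[OF S(4) \<epsilon>] by blast
  then obtain n0 where n0: "\<And>t n. t \<in> S \<Longrightarrow> n \<ge> n0 t \<Longrightarrow> \<exists>\<theta> j::int. \<bar>\<theta> - t\<bar> < \<epsilon> \<and> \<psi> n \<theta> = \<psi> n 0 + pi * of_int j"
    by metis
  \<comment> \<open>\<open>insert 1\<close> forces \<open>n \<ge> 1\<close>: at time 0 the angle
    does not depend on \<theta>, so strict monotonicity fails.\<close>
  have "real (card S) \<le> (\<psi> n b - \<psi> n a) / pi + 1" if n: "n \<ge> Max (insert 1 (n0 ` S))" for n
  proof -
    have "n \<ge> 1" "\<And>t. t \<in> S \<Longrightarrow> n \<ge> n0 t" using n S(1) by auto
    hence "\<forall>t\<in>S. \<exists>\<theta> j::int. \<bar>\<theta> - t\<bar> < \<epsilon> \<and> \<psi> n \<theta> = \<psi> n 0 + pi * of_int j" using n0 by blast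
    then obtain th and j :: "real \<Rightarrow> int" where th: "\<And>t. t \<in> S \<Longrightarrow> \<bar>th t - t\<bar> < \<epsilon>"
      "\<And>t. t \<in> S \<Longrightarrow> \<psi> n (th t) = \<psi> n 0 + pi * of_int (j t)" by metis
    have mono: "\<psi> n x < \<psi> n y" if "x < y" for x y
      using ang_mono_theta[where a="verblunsky M", OF verblunsky_less_1 that, of 0 "n - 1"] \<open>n \<ge> 1\<close>
      by (simp add: \<psi>_def del: ang.simps)
    have less: "j t < j t'" if "t \<in> S" "t' \<in> S" "t < t'" for t t'
    proof -
      have "th t < th t'" using sep[of t t'] th(1)[of t] th(1)[of t'] that by linarith
      from mono[OF this] show ?thesis using th(2) that by simp
    qed
    have "inj_on j S" by (rule inj_onI) (metis less less_irrefl linorder_neqE)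
    hence "real (card S) = real (card (j ` S))" by (simp add: card_image)
    also have "\<dots> \<le> (\<psi> n b - \<psi> n 0) / pi - (\<psi> n a - \<psi> n 0) / pi + 1"
    proof (rule card_int_interval_le)
      fix i assume "i \<in> j ` S"
      then obtain t where t: "t \<in> S" "i = j t" by blast
      have "a < th t" "th t < b" using ins[OF t(1)] th(1)[OF t(1)] \<epsilon>(1) by linarith+
      from mono[OF this(1)] mono[OF this(2)]
      show "(\<psi> n a - \<psi> n 0) / pi \<le> of_int i \<and> of_int i \<le> (\<psi> n b - \<psi> n 0) / pi"
        unfolding th(2)[OF t(1)] t(2) by (simp add: field_simps)
    next
      have "a < b" using S(2,3) by fastforce
      from mono[OF this] show "(\<psi> n a - \<psi> n 0) / pi \<le> (\<psi> n b - \<psi> n 0) / pi"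
        by (intro divide_right_mono) auto
    qed (use S in auto)
    finally show ?thesis by (simp add: diff_divide_distrib)
  qed
  thus ?thesis unfolding \<psi>_def by blast
qed

text \<open>Boundedness lets the Christoffel sum grow only linearly in \<open>n\<close>, while a
  massless neighbourhood would make the norms of the test polynomials decay geometrically.\<close>

lemma bounded_solution_support:
  assumes "\<And>n. cmod (sol (verblunsky M) \<theta> 1 n) \<le> C"
  shows "cis \<theta> \<in> measure_support M"
proof (rule ccontr)
  assume "cis \<theta> \<notin> measure_support M"
  then obtain e0 where e0: "e0 > 0" "emeasure M (ball (cis \<theta>) e0 \<inter> space M) = 0"
    by (auto simp: measure_support_def space_M zero_less_iff_neq_zero)
  define e where "e = min e0 1"
  have e: "0 < e" "e \<le> 1" "e \<le> e0" using e0(1) by (auto simp: e_def)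
  define y where "y = (\<lambda>z. Re (cnj (cis \<theta>) * z))"
  \<comment> \<open>Off the ball of radius \<open>e\<close> the linear factor has squared modulus
    \<open>(1 + cos) / 2 \<le> 1 - e^2 / 4\<close>. The cap \<open>e \<le> 1\<close> keeps
    \<open>q\<close> positive.\<close>
  define q where "q = 1 - e\<^sup>2 / 4"
  have "e\<^sup>2 \<le> 1" using e by (simp add: power_le_one)
  hence q: "0 < q" "q < 1" using e(1) by (auto simp: q_def)
  have meas: "ball (cis \<theta>) e0 \<inter> space M \<in> sets M"
    by (auto simp: sets_M space_M sets_restrict_space image_iff Int_commute intro!: bexI[of _ "ball (cis \<theta>) e0"])
  have "ball (cis \<theta>) e0 \<inter> space M \<in> null_sets M" using e0(2) meas by (simp add: null_sets_def)
  hence ae: "AE z in M. z \<notin> ball (cis \<theta>) e0 \<inter> space M" by (rule AE_not_in)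
  have main: "1 \<le> q ^ n * (real (Suc n) * C\<^sup>2)" for n
  proof -
    define P where "P = [:1 / 2, cnj (cis \<theta>) / 2:] ^ n"
    have "degree P \<le> n" unfolding P_def by (rule order_trans[OF degree_power_le]) simp
    from christoffel_bound[OF this, of \<theta>]
    have "(cmod (poly P (cis \<theta>)))\<^sup>2 \<le> sqn P * (\<Sum>j\<le>n. (cmod (sol (verblunsky M) \<theta> 1 j))\<^sup>2)" .
    moreover have "poly P (cis \<theta>) = 1"
      using unit_mult_cnj[of "cis \<theta>"] by (simp add: P_def poly_power mult.commute)
    moreover have "(\<Sum>j\<le>n. (cmod (sol (verblunsky M) \<theta> 1 j))\<^sup>2) \<le> (\<Sum>j\<le>n. C\<^sup>2)"
      using assms by (intro sum_mono power_mono) auto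
    moreover have "sqn P \<le> q ^ n"
    proof -
      have "sqn P \<le> (LINT z|M. q ^ n)"
        unfolding sqn_def
      proof (rule integral_mono_AE)
        show "integrable M (\<lambda>z. (cmod (poly P z))\<^sup>2)" by (intro integrable_continuous continuous_intros)
        show "AE z in M. (cmod (poly P z))\<^sup>2 \<le> q ^ n"
          using ae AE_space
        proof eventually_elim
          case (elim z)
          hence z: "cmod z = 1" "e0 \<le> cmod (z - cis \<theta>)" by (auto simp: space_M dist_norm norm_minus_commute)
          hence "e\<^sup>2 \<le> (cmod (z - cis \<theta>))\<^sup>2" using e by (intro power_mono) auto
          hence y: "e\<^sup>2 \<le> 2 - 2 * y z" using Re_mult_cnj_dist[of "cis \<theta>" z] z(1) by (simp add: y_def del: times_complex.simps)
          have "(cmod (1 + cnj (cis \<theta>) * z))\<^sup>2 = 1 + 2 * y z + (cmod (cnj (cis \<theta>) * z))\<^sup>2"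
            unfolding cmod_power2 y_def by (simp add: power2_eq_square algebra_simps)
          hence "(cmod (1 + cnj (cis \<theta>) * z))\<^sup>2 = 2 + 2 * y z" using z(1) by (simp add: norm_mult)
          moreover have "poly [:1 / 2, cnj (cis \<theta>) / 2:] z = (1 + cnj (cis \<theta>) * z) / 2"
            by (simp add: field_simps)
          ultimately have "(cmod (poly [:1 / 2, cnj (cis \<theta>) / 2:] z))\<^sup>2 = (2 + 2 * y z) / 4"
            by (simp only: norm_divide power_divide) simp
          also have "\<dots> \<le> q" using y by (simp add: q_def field_simps)
          finally have "((cmod (poly [:1 / 2, cnj (cis \<theta>) / 2:] z))\<^sup>2) ^ n \<le> q ^ n"
            by (intro power_mono) auto
          thus ?case unfolding P_def poly_power norm_power by (metis power_mult mult.commute)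
        qed
      qed simp
      thus ?thesis using prob_space by simp
    qed
    ultimately have "1 \<le> sqn P * (\<Sum>j\<le>n. (cmod (sol (verblunsky M) \<theta> 1 j))\<^sup>2)" by simp
    also have "\<dots> \<le> q ^ n * (\<Sum>j\<le>n. C\<^sup>2)"
      using \<open>sqn P \<le> q ^ n\<close> \<open>(\<Sum>j\<le>n. _) \<le> _\<close> q by (intro mult_mono sum_nonneg) auto
    finally show ?thesis by simp
  qed
  have "(\<lambda>n. real n * q ^ n) \<longlonglongrightarrow> 0" using q by (intro powser_times_n_limit_0) auto
  hence "(\<lambda>n. C\<^sup>2 * (real n * q ^ n + q ^ n)) \<longlonglongrightarrow> C\<^sup>2 * (0 + 0)"
    using q by (intro tendsto_intros LIMSEQ_realpow_zero) auto
  hence "\<forall>\<^sub>F n in sequentially. C\<^sup>2 * (real n * q ^ n + q ^ n) < 1"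
    by (rule order_tendstoD) simp
  then obtain n where "C\<^sup>2 * (real n * q ^ n + q ^ n) < 1"
    unfolding eventually_sequentially by blast
  thus False using main[of n] by (simp add: algebra_simps)
qed

end

section \<open>Bands and gaps\<close>

lemma unit_eq_cis: "cmod z = 1 \<Longrightarrow> \<exists>t. z = cis t"
  by (metis mult_1 of_real_1 rcis_cmod_Arg rcis_def)

lemma tm_diag_Suc: "tm_diag a \<theta> (Suc n)
    = (cis (\<theta>/2) * tm_diag a \<theta> n - cnj (a n * cis (\<theta>/2)) * cnj (tm_off a \<theta> n)) / of_real (szego_rho (a n))"
  unfolding tm_diag_def[of a \<theta> "Suc n"] sol.simps szego_step_def sol_eq_tm[of a \<theta> _ n]
  by (simp add: field_simps add_divide_distrib diff_divide_distrib)

lemma tm_off_Suc: "tm_off a \<theta> (Suc n)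
    = (cis (\<theta>/2) * tm_off a \<theta> n - cnj (a n * cis (\<theta>/2)) * cnj (tm_diag a \<theta> n)) / of_real (szego_rho (a n))"
  unfolding tm_off_def[of a \<theta> "Suc n"] sol.simps szego_step_def sol_eq_tm[of a \<theta> _ n]
  by (simp add: field_simps add_divide_distrib diff_divide_distrib)

text \<open>Each part of the map is updated with the conjugate of the other, so conjugating
  \<open>tm_off\<close> yields a recursion free of conjugation, in which half-angle factors combine
  into powers of \<open>cis \<theta>\<close>.\<close>

lemma tm_polynomials:
  "\<exists>P R. degree P \<le> n \<and> degree R \<le> n \<and>
     (\<forall>\<theta>. poly P (cis \<theta>) = cis (real n * \<theta> / 2) * tm_diag a \<theta> n \<and>
          poly R (cis \<theta>) = cis (real n * \<theta> / 2) * cnj (tm_off a \<theta> n))"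
proof (induction n)
  case 0
  show ?case by (intro exI[of _ 1] exI[of _ 0]) (simp add: tm_diag_def tm_off_def)
next
  case (Suc n)
  then obtain P R where PR: "degree P \<le> n" "degree R \<le> n"
    "\<And>\<theta>. poly P (cis \<theta>) = cis (real n * \<theta> / 2) * tm_diag a \<theta> n"
    "\<And>\<theta>. poly R (cis \<theta>) = cis (real n * \<theta> / 2) * cnj (tm_off a \<theta> n)" by blast
  define r where "r = complex_of_real (1 / szego_rho (a n))"
  define P' where "P' = smult r (pCons 0 P - smult (cnj (a n)) R)"
  define R' where "R' = smult r (R - smult (a n) (pCons 0 P))"
  have dP: "degree (pCons 0 P) \<le> Suc n" using degree_pCons_le[of 0 P] PR(1) by linarith
  have "degree P' \<le> Suc n" "degree R' \<le> Suc n"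
    unfolding P'_def R'_def using PR(2) dP
    by (auto intro!: order_trans[OF degree_smult_le] degree_diff_le)
  moreover have "poly P' (cis \<theta>) = cis (real (Suc n) * \<theta> / 2) * tm_diag a \<theta> (Suc n)"
    and "poly R' (cis \<theta>) = cis (real (Suc n) * \<theta> / 2) * cnj (tm_off a \<theta> (Suc n))" for \<theta>
  proof -
    define h where "h = cis (\<theta> / 2)"
    define e where "e = cis (real n * \<theta> / 2)"
    have e: "cis (real (Suc n) * \<theta> / 2) = e * h"
      by (simp add: e_def h_def cis_mult algebra_simps add_divide_distrib)
    have h: "cis \<theta> = h * h" "h * cnj h = 1" by (simp_all add: h_def cis_mult unit_mult_cnj)
    have "e * h * tm_diag a \<theta> (Suc n)
        = r * ((h * h) * (e * tm_diag a \<theta> n) - cnj (a n) * (h * cnj h) * (e * cnj (tm_off a \<theta> n)))"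
      unfolding tm_diag_Suc h_def[symmetric] by (simp add: r_def field_simps)
    thus "poly P' (cis \<theta>) = cis (real (Suc n) * \<theta> / 2) * tm_diag a \<theta> (Suc n)"
      unfolding e by (simp add: P'_def PR h(2) e_def) (simp add: h(1) mult_ac)
    have "e * h * cnj (tm_off a \<theta> (Suc n))
        = r * ((h * cnj h) * (e * cnj (tm_off a \<theta> n)) - a n * ((h * h) * (e * tm_diag a \<theta> n)))"
      unfolding tm_off_Suc h_def[symmetric] by (simp add: r_def field_simps)
    thus "poly R' (cis \<theta>) = cis (real (Suc n) * \<theta> / 2) * cnj (tm_off a \<theta> (Suc n))"
      unfolding e by (simp add: R'_def PR h(2) e_def) (simp add: h(1) mult_ac)
  qed
  ultimately show ?case by blast
qed

context periodic_coefficients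
begin

text \<open>Twice the half-trace is \<open>tm_diag\<close> plus its conjugate, and reflection makes
  the conjugate a polynomial; squaring removes the remaining half-angle. Roots on the circle are the
  points with half-trace plus or minus 1.\<close>

lemma discriminant_polynomial:
  "\<exists>Q. degree Q \<le> 2 * p \<and> (\<forall>\<theta>. poly Q (cis \<theta>) = cis (real p * \<theta>) * of_real ((half_trace \<theta>)\<^sup>2 - 1))"
proof -
  obtain P where P: "degree P \<le> p" "\<And>\<theta>. poly P (cis \<theta>) = cis (real p * \<theta> / 2) * tm_diag b \<theta> p"
    using tm_polynomials[of p b] by blast
  obtain S where S: "degree S \<le> p" "\<And>z. cmod z = 1 \<Longrightarrow> poly S z = z ^ p * cnj (poly P z)"
    using conj_reflection[OF P(1)] by blast
  define W where "W = P + S"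
  define Q where "Q = smult (1 / 4) (W * W) - monom 1 p"
  have "degree W \<le> p" unfolding W_def using P(1) S(1) by (rule degree_add_le)
  hence "degree (W * W) \<le> 2 * p" using degree_mult_le[of W W] by linarith
  hence "degree Q \<le> 2 * p" unfolding Q_def
    by (intro degree_diff_le order_trans[OF degree_smult_le]) (auto intro: order_trans[OF degree_monom_le])
  moreover have "poly Q (cis \<theta>) = cis (real p * \<theta>) * of_real ((half_trace \<theta>)\<^sup>2 - 1)" for \<theta>
  proof -
    define e where "e = cis (real p * \<theta> / 2)"
    have ee: "cis \<theta> ^ p = e * e"
      by (simp add: e_def Complex.DeMoivre cis_mult mult.commute[of \<theta>])
    have "e * cnj e = 1" by (simp add: e_def unit_mult_cnj)
    hence "poly S (cis \<theta>) = e * cnj (tm_diag b \<theta> p)"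
      by (simp add: S(2) P(2) e_def[symmetric] ee)
    hence "poly W (cis \<theta>) = e * (tm_diag b \<theta> p + cnj (tm_diag b \<theta> p))"
      by (simp add: W_def P(2) e_def[symmetric] distrib_left)
    also have "\<dots> = e * (2 * of_real (half_trace \<theta>))"
      unfolding half_trace_def complex_add_cnj by simp
    finally have "poly Q (cis \<theta>) = e * e * (of_real (half_trace \<theta>))\<^sup>2 - e * e"
      by (simp add: Q_def poly_monom ee power2_eq_square)
    moreover have "e * e = cis (real p * \<theta>)" by (simp add: e_def cis_mult mult.commute[of \<theta>])
    ultimately show ?thesis by (simp add: algebra_simps)
  qed
  ultimately show ?thesis by blast
qed

text \<open>The half-trace itself changes sign under a shift by 2 pi when \<open>p\<close> is odd;
  its square depends on \<open>cis \<theta>\<close> alone.\<close>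

lemma abs_half_trace_2pi: "\<bar>half_trace (\<theta> + 2 * pi * of_int k)\<bar> = \<bar>half_trace \<theta>\<bar>"
proof -
  obtain Q where Q: "\<And>\<theta>. poly Q (cis \<theta>) = cis (real p * \<theta>) * of_real ((half_trace \<theta>)\<^sup>2 - 1)"
    using discriminant_polynomial by blast
  have "cis (\<theta> + 2 * pi * of_int k) = cis \<theta>" unfolding cis_eq_iff_int by blast
  moreover have "cis (real p * (\<theta> + 2 * pi * of_int k)) = cis (real p * \<theta>)"
    unfolding cis_eq_iff_int by (intro exI[of _ "int p * k"]) (simp add: algebra_simps)
  ultimately have "cis (real p * \<theta>) * of_real ((half_trace (\<theta> + 2 * pi * of_int k))\<^sup>2 - 1)
      = cis (real p * \<theta>) * of_real ((half_trace \<theta>)\<^sup>2 - 1)"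
    using Q[of \<theta>] Q[of "\<theta> + 2 * pi * of_int k"] by metis
  hence "(half_trace (\<theta> + 2 * pi * of_int k))\<^sup>2 = (half_trace \<theta>)\<^sup>2"
    by (simp only: mult_cancel_left cis_neq_zero simp_thms of_real_eq_iff)
  thus ?thesis by (metis real_sqrt_abs)
qed

definition band :: "real set" where
  "band = {\<theta>. \<bar>half_trace \<theta>\<bar> < 1}"

text \<open>Taking the closure absorbs closed gaps: a point with half-trace plus or minus 1 and
  bands on both sides produces no gap.\<close>

definition spectrum :: "real set" where
  "spectrum = closure band"

definition gap_interval :: "real \<Rightarrow> real \<Rightarrow> bool" where
  "gap_interval s t \<longleftrightarrow> s < t \<and> s \<in> spectrum \<and> t \<in> spectrum \<and> {s<..<t} \<inter> spectrum = {}"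

lemma open_band: "open band"
  unfolding band_def
  by (intro open_Collect_less continuous_intros continuous_on_half_trace)

lemma spectrum_abs_le: "\<theta> \<in> spectrum \<Longrightarrow> \<bar>half_trace \<theta>\<bar> \<le> 1"
proof -
  have "closed {\<theta>. \<bar>half_trace \<theta>\<bar> \<le> 1}"
    by (intro closed_Collect_le continuous_intros continuous_on_half_trace)
  moreover have "band \<subseteq> {\<theta>. \<bar>half_trace \<theta>\<bar> \<le> 1}" by (auto simp: band_def)
  ultimately show "\<theta> \<in> spectrum \<Longrightarrow> \<bar>half_trace \<theta>\<bar> \<le> 1"
    unfolding spectrum_def by (metis closure_minimal mem_Collect_eq subsetD)
qed

lemma spectrum_2pi: "\<theta> + 2 * pi * of_int k \<in> spectrum \<longleftrightarrow> \<theta> \<in> spectrum"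
proof -
  have imp: "\<theta> + 2 * pi * of_int k \<in> spectrum" if "\<theta> \<in> spectrum" for \<theta> k
    unfolding spectrum_def closure_approachable
  proof (intro allI impI)
    fix e :: real assume "e > 0"
    then obtain y where y: "y \<in> band" "dist y \<theta> < e"
      using \<open>\<theta> \<in> spectrum\<close> unfolding spectrum_def closure_approachable by blast
    hence "y + 2 * pi * of_int k \<in> band" by (simp add: band_def abs_half_trace_2pi)
    moreover have "dist (y + 2 * pi * of_int k) (\<theta> + 2 * pi * of_int k) < e"
      using y(2) by (simp add: dist_real_def)
    ultimately show "\<exists>y\<in>band. dist y (\<theta> + 2 * pi * of_int k) < e" by blast
  qed
  show ?thesis using imp[of \<theta> k] imp[of "\<theta> + 2 * pi * of_int k" "- k"] by auto
qed

lemma cis_in_spectrum_iff: "cis \<theta> \<in> cis ` spectrum \<longleftrightarrow> \<theta> \<in> spectrum"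
proof
  assume "cis \<theta> \<in> cis ` spectrum"
  then obtain x where x: "x \<in> spectrum" "cis \<theta> = cis x" by blast
  then obtain k :: int where "\<theta> = x + 2 * pi * of_int k" unfolding cis_eq_iff_int by blast
  thus "\<theta> \<in> spectrum" using x(1) spectrum_2pi by simp
qed (rule imageI)

lemma gap_interval_half_trace:
  assumes "gap_interval s t"
  shows "\<And>\<theta>. \<theta> \<in> {s..t} \<Longrightarrow> \<bar>half_trace \<theta>\<bar> \<ge> 1" "\<bar>half_trace s\<bar> = 1" "\<bar>half_trace t\<bar> = 1"
proof -
  have st: "s < t" "s \<in> spectrum" "t \<in> spectrum" using assms by (auto simp: gap_interval_def)
  have "band \<subseteq> spectrum" unfolding spectrum_def by (rule closure_subset)
  hence "{s<..<t} \<inter> band = {}" using assms unfolding gap_interval_def by blast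
  hence "{s<..<t} \<subseteq> {\<theta>. 1 \<le> \<bar>half_trace \<theta>\<bar>}"
    unfolding band_def by force
  moreover have "closed {\<theta>. 1 \<le> \<bar>half_trace \<theta>\<bar>}"
    by (intro closed_Collect_le continuous_intros continuous_on_half_trace)
  ultimately have "closure {s<..<t} \<subseteq> {\<theta>. 1 \<le> \<bar>half_trace \<theta>\<bar>}" by (rule closure_minimal)
  thus ge: "\<And>\<theta>. \<theta> \<in> {s..t} \<Longrightarrow> \<bar>half_trace \<theta>\<bar> \<ge> 1"
    using st(1) by (auto simp: closure_greaterThanLessThan)
  show "\<bar>half_trace s\<bar> = 1" "\<bar>half_trace t\<bar> = 1"
    using ge[of s] ge[of t] st spectrum_abs_le by fastforce+
qed

text \<open>Translates of a band by multiples of 2 pi lie on both sides of \<open>x\<close>, so the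
  nearest spectral points exist by closedness.\<close>

lemma gap_interval_exists:
  assumes "x \<notin> spectrum"
  obtains s t where "gap_interval s t" "x \<in> {s<..<t}" "t \<le> s + 2 * pi"
proof -
  obtain \<theta> where "\<theta> \<in> band" using band_nonempty by (auto simp: band_def)
  hence th: "\<theta> \<in> spectrum" unfolding spectrum_def using closure_subset by blast
  define k where "k = \<lfloor>(x - \<theta>) / (2 * pi)\<rfloor>"
  have "of_int k \<le> (x - \<theta>) / (2 * pi)" "(x - \<theta>) / (2 * pi) < of_int k + 1" by (auto simp: k_def)
  hence k: "\<theta> + 2 * pi * of_int k \<le> x" "x < \<theta> + 2 * pi * of_int k + 2 * pi"
    by (simp_all add: field_simps)
  define y where "y = \<theta> + 2 * pi * of_int k"
  have y: "y \<in> spectrum" "y \<le> x" "x < y + 2 * pi" using k th by (auto simp: y_def spectrum_2pi)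
  have y': "y + 2 * pi \<in> spectrum" using y(1) spectrum_2pi[of y 1] by simp
  have cl: "closed spectrum" by (simp add: spectrum_def)
  define s where "s = Sup (spectrum \<inter> {..x})"
  define t where "t = Inf (spectrum \<inter> {x..})"
  have bs: "bdd_above (spectrum \<inter> {..x})" and bt: "bdd_below (spectrum \<inter> {x..})"
    by (auto intro: bdd_aboveI bdd_belowI)
  have s: "s \<in> spectrum \<inter> {..x}"
    unfolding s_def using y cl bs by (intro closed_contains_Sup closed_Int) auto
  have t: "t \<in> spectrum \<inter> {x..}"
    unfolding t_def using y y' cl bt by (intro closed_contains_Inf closed_Int) auto
  have sub: "u \<le> s" if "u \<in> spectrum" "u \<le> x" for u
    unfolding s_def using that by (intro cSup_upper bs) auto
  have tlb: "t \<le> u" if "u \<in> spectrum" "x \<le> u" for u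
    unfolding t_def using that by (intro cInf_lower bt) auto
  have sx: "s < x" and xt: "x < t" using s t assms by (auto simp: less_le)
  have "{s<..<t} \<inter> spectrum = {}"
  proof (rule ccontr)
    assume "{s<..<t} \<inter> spectrum \<noteq> {}"
    then obtain u where "s < u" "u < t" "u \<in> spectrum" by auto
    thus False using sub[of u] tlb[of u] by (cases "u \<le> x") auto
  qed
  hence "gap_interval s t" using s t sx xt by (auto simp: gap_interval_def)
  moreover have "s + 2 * pi \<in> spectrum" using s spectrum_2pi[of s 1] by simp
  hence "t \<le> s + 2 * pi" using tlb sub[OF y(1,2)] y(3) by auto
  ultimately show ?thesis using that sx xt by auto
qed

text \<open>The arc over a lifted gap is connected, hence inside the component. Conversely, two
  closed arcs cover the circle and meet only at spectral endpoints, so a connected set avoiding the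
  spectrum lies in one of them.\<close>

lemma component_gap_interval:
  assumes "G \<in> components (unit_circle - cis ` spectrum)"
  obtains s t where "gap_interval s t" "G = cis ` {s<..<t}"
proof -
  have G: "connected G" "G \<subseteq> unit_circle - cis ` spectrum" "G \<noteq> {}"
    using assms in_components_connected in_components_subset in_components_nonempty by blast+
  then obtain z where z: "z \<in> G" by blast
  hence "cmod z = 1" using G(2) by auto
  then obtain x where x: "z = cis x" using unit_eq_cis by blast
  have "x \<notin> spectrum" using z G(2) x by auto
  then obtain s t where st: "gap_interval s t" "x \<in> {s<..<t}" "t \<le> s + 2 * pi"
    using gap_interval_exists by blast
  have ends: "s < t" "cis s \<in> cis ` spectrum" "cis t \<in> cis ` spectrum"
    using st(1) by (auto simp: gap_interval_def)
  have "cis ` {s<..<t} \<subseteq> unit_circle - cis ` spectrum"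
    using st(1) cis_in_spectrum_iff by (auto simp: gap_interval_def)
  moreover have "connected (cis ` {s<..<t})"
    by (intro connected_continuous_image continuous_intros connected_Ioo)
  moreover have "z \<in> G \<inter> cis ` {s<..<t}" using z x st(2) by auto
  ultimately have "cis ` {s<..<t} \<subseteq> G" using components_maximal[OF assms] by blast
  moreover have "G \<subseteq> cis ` {s<..<t}"
  proof -
    define C1 where "C1 = cis ` {s..t}"
    define C2 where "C2 = cis ` {t..s + 2 * pi}"
    have cl: "closed C1" "closed C2" unfolding C1_def C2_def
      by (auto intro!: compact_imp_closed compact_continuous_image continuous_intros)
    have "C1 \<inter> C2 \<subseteq> {cis s, cis t}"
    proof
      fix w assume "w \<in> C1 \<inter> C2"
      then obtain u v where uv: "u \<in> {s..t}" "v \<in> {t..s + 2 * pi}" "w = cis u" "cis u = cis v"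
        by (auto simp: C1_def C2_def)
      then obtain k :: int where k: "v = u + 2 * pi * of_int k" using cis_eq_iff_int by metis
      show "w \<in> {cis s, cis t}"
      proof (cases "k \<le> 0")
        case True
        hence "2 * pi * of_int k \<le> 0" by (simp add: mult_nonneg_nonpos)
        hence "u = t" using k uv(1,2) by auto
        thus ?thesis using uv(3) by simp
      next
        case False
        hence "2 * pi * 1 \<le> 2 * pi * of_int k" by (intro mult_left_mono) auto
        hence "u = s" using k uv(1,2) unfolding atLeastAtMost_iff by linarith
        thus ?thesis using uv by simp
      qed
    qed
    hence disj: "C1 \<inter> C2 \<inter> G = {}" using ends G(2) by blast
    have "G \<subseteq> C1 \<union> C2"
    proof
      fix w assume "w \<in> G"
      hence "cmod w = 1" using G(2) by auto
      then obtain u where u: "w = cis u" using unit_eq_cis by blast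
      define k where "k = - \<lfloor>(u - s) / (2 * pi)\<rfloor>"
      have "of_int (- k) \<le> (u - s) / (2 * pi)" "(u - s) / (2 * pi) < of_int (- k) + 1" unfolding k_def by linarith+
      hence "s \<le> u + 2 * pi * of_int k" "u + 2 * pi * of_int k \<le> s + 2 * pi"
        by (simp_all add: field_simps)
      moreover have "w = cis (u + 2 * pi * of_int k)"
        unfolding u cis_eq_iff_int by (intro exI[of _ "- k"]) simp
      ultimately show "w \<in> C1 \<union> C2" unfolding C1_def C2_def by (cases "u + 2 * pi * of_int k \<le> t") auto
    qed
    hence "C1 \<inter> G = {} \<or> C2 \<inter> G = {}" using connected_closedD[OF G(1) disj _ cl] by blast
    moreover have "z \<in> C1" using x st(2) by (auto simp: C1_def)
    ultimately have GC: "G \<subseteq> C1" using z \<open>G \<subseteq> C1 \<union> C2\<close> by blast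
    show ?thesis
    proof
      fix w assume w: "w \<in> G"
      then obtain u where u: "u \<in> {s..t}" "w = cis u" using GC by (auto simp: C1_def)
      moreover have "u \<noteq> s" "u \<noteq> t" using w u(2) ends G(2) by auto
      ultimately show "w \<in> cis ` {s<..<t}" by auto
    qed
  qed
  ultimately show ?thesis using that st(1) by blast
qed

text \<open>A common endpoint would be isolated in the closure of the bands without lying in a band.
  The two gaps may coincide, so the ends of a single gap are separated as well.\<close>

lemma gap_endpoints_distinct:
  assumes "gap_interval s t" "gap_interval s' t'"
  shows "cis s \<noteq> cis t'"
proof
  assume "cis s = cis t'"
  then obtain k :: int where k: "s = t' + 2 * pi * of_int k" unfolding cis_eq_iff_int by blast
  define e where "e = min (t - s) (t' - s')"
  have e: "e > 0" using assms by (auto simp: e_def gap_interval_def)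
  have "s \<in> spectrum" using assms by (simp add: gap_interval_def)
  then obtain y where y: "y \<in> band" "dist y s < e"
    using e unfolding spectrum_def closure_approachable by blast
  have ys: "y \<in> spectrum" using y(1) closure_subset unfolding spectrum_def by blast
  consider "y < s" | "y = s" | "y > s" by linarith
  thus False
  proof cases
    case 1
    hence "y + 2 * pi * of_int (- k) \<in> {s'<..<t'}"
      using y(2) k by (auto simp: dist_real_def e_def)
    moreover have "y + 2 * pi * of_int (- k) \<in> spectrum" using ys spectrum_2pi by blast
    ultimately show False using assms(2) unfolding gap_interval_def by blast
  next
    case 2
    thus False using y(1) gap_interval_half_trace(2)[OF assms(1)] by (simp add: band_def)
  next
    case 3
    hence "y \<in> {s<..<t}" using y(2) by (auto simp: dist_real_def e_def)
    thus False using ys assms(1) unfolding gap_interval_def by blast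
  qed
qed

lemma cis_gap_eq_if_meet:
  assumes "G \<in> components U" "G' \<in> components U" "z \<in> G" "z \<in> G'"
  shows "G = G'"
  using assms components_nonoverlap by blast

lemma gaps_card:
  "finite (components (unit_circle - cis ` spectrum)) \<and> card (components (unit_circle - cis ` spectrum)) \<le> p"
proof -
  define Gs where "Gs = components (unit_circle - cis ` spectrum)"
  have "\<forall>G\<in>Gs. \<exists>s t. gap_interval s t \<and> G = cis ` {s<..<t}"
    unfolding Gs_def using component_gap_interval by metis
  then obtain l r where lr: "\<And>G. G \<in> Gs \<Longrightarrow> gap_interval (l G) (r G)"
    "\<And>G. G \<in> Gs \<Longrightarrow> G = cis ` {l G<..<r G}" by metis
  have lt: "l G < r G" if "G \<in> Gs" for G using lr(1)[OF that] by (simp add: gap_interval_def)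
  obtain Q where Q: "degree Q \<le> 2 * p" "\<And>\<theta>. poly Q (cis \<theta>) = cis (real p * \<theta>) * of_real ((half_trace \<theta>)\<^sup>2 - 1)"
    using discriminant_polynomial by blast
  define R where "R = {z. poly Q z = 0}"
  obtain \<theta> where th: "\<bar>half_trace \<theta>\<bar> < 1" using band_nonempty by blast
  hence "(half_trace \<theta>)\<^sup>2 < 1" by (simp add: abs_square_less_1)
  \<comment> \<open>A band point shows that \<open>Q\<close> is not the zero polynomial, so its
    roots can be counted by degree.\<close>
  hence "poly Q (cis \<theta>) \<noteq> 0" unfolding Q(2) by (simp del: of_real_diff of_real_power)
  hence "Q \<noteq> 0" by auto
  hence R: "finite R" "card R \<le> 2 * p"
    using poly_roots_finite card_poly_roots_bound[of Q] Q(1) by (auto simp: R_def)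
  have inR: "cis \<theta> \<in> R" if "\<bar>half_trace \<theta>\<bar> = 1" for \<theta>
  proof -
    have "(half_trace \<theta>)\<^sup>2 = 1" using that by (metis power2_abs one_power2)
    thus ?thesis by (simp add: R_def Q(2))
  qed
  have same: "G = G'" if G: "G \<in> Gs" "G' \<in> Gs" and u: "u \<in> {l G<..<r G}" "u + 2 * pi * of_int k \<in> {l G'<..<r G'}" for G G' u and k :: int
  proof -
    have "cis u = cis (u + 2 * pi * of_int k)" unfolding cis_eq_iff_int by (intro exI[of _ "- k"]) simp
    hence "cis u \<in> G" "cis u \<in> G'" using lr(2)[OF G(1)] lr(2)[OF G(2)] u by blast+
    thus ?thesis using cis_gap_eq_if_meet G unfolding Gs_def by blast
  qed
  have injl: "inj_on (\<lambda>G. cis (l G)) Gs"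
  proof (rule inj_onI)
    fix G G' assume G: "G \<in> Gs" "G' \<in> Gs" "cis (l G) = cis (l G')"
    then obtain k :: int where k: "l G' = l G + 2 * pi * of_int k" using cis_eq_iff_int by metis
    \<comment> \<open>Half the shorter length, so that the shifted point lies inside both
      gaps.\<close>
    define d where "d = min (r G - l G) (r G' - l G') / 2"
    have "l G + d \<in> {l G<..<r G}" "l G + d + 2 * pi * of_int k \<in> {l G'<..<r G'}"
      using k lt[OF G(1)] lt[OF G(2)] by (auto simp: d_def min_def field_simps)
    thus "G = G'" using same G by blast
  qed
  have injr: "inj_on (\<lambda>G. cis (r G)) Gs"
  proof (rule inj_onI)
    fix G G' assume G: "G \<in> Gs" "G' \<in> Gs" "cis (r G) = cis (r G')"
    then obtain k :: int where k: "r G' = r G + 2 * pi * of_int k" using cis_eq_iff_int by metis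
    define d where "d = min (r G - l G) (r G' - l G') / 2"
    have "r G - d \<in> {l G<..<r G}" "r G - d + 2 * pi * of_int k \<in> {l G'<..<r G'}"
      using k lt[OF G(1)] lt[OF G(2)] by (auto simp: d_def min_def field_simps)
    thus "G = G'" using same G by blast
  qed
  define L where "L = (\<lambda>G. cis (l G)) ` Gs"
  define T where "T = (\<lambda>G. cis (r G)) ` Gs"
  have sub: "L \<subseteq> R" "T \<subseteq> R"
    unfolding L_def T_def using inR gap_interval_half_trace lr(1) by blast+
  have fin: "finite L" "finite T" using sub R(1) finite_subset by blast+
  have "finite Gs" using finite_imageD[OF _ injl] fin(1) by (simp add: L_def)
  have disj: "L \<inter> T = {}"
    unfolding L_def T_def using gap_endpoints_distinct[OF lr(1) lr(1)] by auto
  have "card Gs + card Gs = card L + card T"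
    unfolding L_def T_def by (simp add: card_image injl injr)
  also have "\<dots> = card (L \<union> T)" using fin disj by (simp add: card_Un_disjoint)
  also have "\<dots> \<le> card R" using sub R(1) by (intro card_mono) auto
  finally have "card Gs \<le> p" using R(2) by linarith
  thus ?thesis using \<open>finite Gs\<close> unfolding Gs_def by blast
qed

end

section \<open>The main theorem\<close>

locale perturbed_periodic = circle_measure M + periodic_coefficients b p
  for M :: "complex measure" and b :: "nat \<Rightarrow> complex" and p :: nat +
  assumes moment: "summable (\<lambda>j. real j * cmod (verblunsky M j - b j))"
begin

lemma perturbation_summable: "summable (\<lambda>n. cmod (verblunsky M n - b n))"
proof (rule summable_comparison_test_ev[OF _ moment])
  show "\<forall>\<^sub>F n in sequentially. norm (cmod (verblunsky M n - b n)) \<le> real n * cmod (verblunsky M n - b n)"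
    using eventually_ge_at_top[of 1]
  proof eventually_elim
    case (elim n)
    hence "1 * cmod (verblunsky M n - b n) \<le> real n * cmod (verblunsky M n - b n)"
      by (intro mult_right_mono) auto
    thus ?case by simp
  qed
qed

text \<open>The tail of the Verblunsky coefficients is within \<open>(1 - r0) / 2\<close> of a
  sequence bounded by \<open>r0\<close>; the finitely many others are individually below 1.\<close>

lemma uniform_radius:
  obtains r where "r < 1" "\<And>n. cmod (verblunsky M n) \<le> r" "\<And>n. cmod (b n) \<le> r"
proof -
  obtain r0 where r0: "r0 < 1" "\<And>n. cmod (b n) \<le> r0" using b_uniform by blast
  have "\<forall>\<^sub>F n in sequentially. cmod (verblunsky M n - b n) < (1 - r0) / 2"
    using summable_LIMSEQ_zero[OF perturbation_summable] r0(1) by (intro order_tendstoD(2)) auto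
  then obtain N where N: "\<And>n. n \<ge> N \<Longrightarrow> cmod (verblunsky M n - b n) < (1 - r0) / 2"
    unfolding eventually_sequentially by blast
  define r where "r = Max (insert ((1 + r0) / 2) ((\<lambda>n. cmod (verblunsky M n)) ` {..<N}))"
  have r1: "(1 + r0) / 2 \<le> r" unfolding r_def by (intro Max_ge) auto
  show ?thesis
  proof (rule that)
    show "r < 1" unfolding r_def using r0(1) verblunsky_less_1 by (subst Max_less_iff) auto
    have "r0 \<le> (1 + r0) / 2" using r0(1) by (simp add: field_simps)
    thus "cmod (b n) \<le> r" for n using r0(2) r1 by (meson order_trans)
    show "cmod (verblunsky M n) \<le> r" for n
    proof (cases "n < N")
      case True
      thus ?thesis unfolding r_def by (intro Max_ge) auto
    next
      case False
      thus ?thesis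
        using N[of n] r0(2)[of n] r1 norm_triangle_sub[of "verblunsky M n" "b n"] by simp
    qed
  qed
qed

lemma band_in_support:
  assumes "\<theta> \<in> band"
  shows "cis \<theta> \<in> measure_support M"
proof -
  obtain r where r: "r < 1" "\<And>n. cmod (verblunsky M n) \<le> r" "\<And>n. cmod (b n) \<le> r"
    using uniform_radius by blast
  have "\<bar>half_trace \<theta>\<bar> < 1" using assms by (simp add: band_def)
  from perturbed_bounded[where a="verblunsky M", OF r(2,3,1) perturbation_summable band_bounded[OF this]]
  show ?thesis using bounded_solution_support by blast
qed

lemma spectrum_essential:
  assumes "\<theta> \<in> spectrum"
  shows "cis \<theta> \<in> essential_support M"
  unfolding essential_support_def
proof (intro CollectI allI impI)
  fix e :: real assume e: "e > 0"
  obtain y where y: "y \<in> band" "dist y \<theta> < e / 2"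
    using assms e unfolding spectrum_def closure_approachable by (metis half_gt_zero)
  obtain d where d: "d > 0" "ball y d \<subseteq> band" using open_band y(1) open_contains_ball by blast
  \<comment> \<open>Width at most 1 makes \<open>cis\<close> injective, \<open>d\<close> keeps the
    arc in the band, and \<open>e / 2\<close> keeps it in the ball.\<close>
  define c where "c = min 1 (min d (e / 2))"
  have c: "0 < c" "c \<le> 1" "c \<le> d" "c \<le> e / 2" using d(1) e by (auto simp: c_def)
  have "inj_on cis {y<..<y + c}"
  proof (rule inj_onI)
    fix u v assume uv: "u \<in> {y<..<y + c}" "v \<in> {y<..<y + c}" "cis u = cis v"
    then obtain k :: int where k: "u = v + 2 * pi * of_int k" using cis_eq_iff_int by blast
    have "k = 0"
    proof (rule ccontr)
      assume "k \<noteq> 0"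
      hence "1 \<le> \<bar>real_of_int k\<bar>" by linarith
      hence "2 * pi * 1 \<le> 2 * pi * \<bar>real_of_int k\<bar>" by (intro mult_left_mono) auto
      moreover have "\<bar>u - v\<bar> = 2 * pi * \<bar>real_of_int k\<bar>" by (simp add: k abs_mult)
      moreover have "\<bar>u - v\<bar> < 1" using uv(1,2) c(2) by auto
      ultimately show False using pi_gt3 by linarith
    qed
    thus "u = v" using k by simp
  qed
  hence "infinite (cis ` {y<..<y + c})"
    using c(1) by (simp add: finite_image_iff infinite_Ioo)
  moreover have "cis ` {y<..<y + c} \<subseteq> ball (cis \<theta>) e \<inter> measure_support M"
  proof
    fix z assume "z \<in> cis ` {y<..<y + c}"
    then obtain u where u: "u \<in> {y<..<y + c}" "z = cis u" by blast
    have "cmod (cis \<theta> - cis u) \<le> \<bar>\<theta> - u\<bar>" by (rule cmod_cis_diff_le)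
    also have "\<dots> < e" using u(1) y(2) c(4) unfolding dist_real_def greaterThanLessThan_iff by linarith
    finally have "z \<in> ball (cis \<theta>) e" by (simp add: u(2) dist_norm)
    moreover have "u \<in> band" using u(1) c(3) d(2) by (auto simp: dist_real_def subset_iff)
    hence "z \<in> measure_support M" unfolding u(2) by (rule band_in_support)
    ultimately show "z \<in> ball (cis \<theta>) e \<inter> measure_support M" by blast
  qed
  ultimately show "infinite (ball (cis \<theta>) e \<inter> measure_support M)" using finite_subset by blast
qed

lemma finite_support_in_gap:
  assumes g: "gap_interval s t"
  shows "finite {\<theta> \<in> {s<..<t}. cis \<theta> \<in> measure_support M}" (is "finite ?S")
proof (rule ccontr)
  assume inf: "infinite ?S"
  obtain r where r: "r < 1" "\<And>n. cmod (verblunsky M n) \<le> r" "\<And>n. cmod (b n) \<le> r"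
    using uniform_radius by blast
  obtain Cs Ns where s: "\<And>n. n \<ge> Ns \<Longrightarrow> \<bar>ang (verblunsky M) s 0 n - ang b s 0 n\<bar> \<le> Cs"
    using edge_phase[where a="verblunsky M", OF r(2,3,1) moment gap_interval_half_trace(2)[OF g]] by blast
  obtain Ct Nt where t: "\<And>n. n \<ge> Nt \<Longrightarrow> \<bar>ang (verblunsky M) t 0 n - ang b t 0 n\<bar> \<le> Ct"
    using edge_phase[where a="verblunsky M", OF r(2,3,1) moment gap_interval_half_trace(3)[OF g]] by blast
  have st: "s \<le> t" using g by (simp add: gap_interval_def)
  define K where "K = nat \<lceil>(Cs + Ct + 4 * pi) / pi + 2\<rceil>"
  obtain F where F: "finite F" "card F = Suc K" "F \<subseteq> ?S"
    using infinite_arbitrarily_large[OF inf] by blast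
  have "\<exists>n0. \<forall>n\<ge>n0. real (card F) \<le> (ang (verblunsky M) t 0 n - ang (verblunsky M) s 0 n) / pi + 1"
    by (rule card_support_le) (use F in auto)
  then obtain n0 where n0: "\<And>n. n \<ge> n0 \<Longrightarrow>
      real (card F) \<le> (ang (verblunsky M) t 0 n - ang (verblunsky M) s 0 n) / pi + 1" by blast
  \<comment> \<open>Beyond all three thresholds, and a multiple of \<open>p\<close> because the
    rotation estimate is made at full periods.\<close>
  define n where "n = (n0 + Ns + Nt) * p"
  have "1 * (n0 + Ns + Nt) \<le> n" unfolding n_def using p_pos by (subst mult.commute) (intro mult_right_mono, auto)
  hence n: "n0 \<le> n" "Ns \<le> n" "Nt \<le> n" by auto
  have "\<bar>ang b t 0 n - ang b s 0 n\<bar> \<le> 4 * pi"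
    unfolding n_def using gap_interval_half_trace(1)[OF g] by (intro rotation_locally_constant st) auto
  hence "ang (verblunsky M) t 0 n - ang (verblunsky M) s 0 n \<le> Cs + Ct + 4 * pi"
    using s[OF n(2)] t[OF n(3)] by linarith
  hence "(ang (verblunsky M) t 0 n - ang (verblunsky M) s 0 n) / pi \<le> (Cs + Ct + 4 * pi) / pi"
    by (intro divide_right_mono) auto
  hence "real (Suc K) \<le> (Cs + Ct + 4 * pi) / pi + 1" using n0[OF n(1)] F(2) by simp
  moreover have "(Cs + Ct + 4 * pi) / pi + 2 \<le> real K" unfolding K_def by linarith
  ultimately show False by simp
qed

text \<open>Bands consist of support points, so their closure is essential. A gap point has a ball
  meeting the circle only inside the gap, where the support is finite.\<close>

lemma unit_circle_minus_essential:
  "unit_circle - essential_support M = unit_circle - cis ` spectrum"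
proof -
  have "z \<notin> essential_support M" if z: "z \<in> unit_circle" "z \<notin> cis ` spectrum" for z
  proof -
    define U where "U = unit_circle - cis ` spectrum"
    obtain G where G: "G \<in> components U" "z \<in> G"
      using z Union_components[of U] unfolding U_def by (metis DiffI UnionE)
    obtain s t where st: "gap_interval s t" "G = cis ` {s<..<t}"
      using component_gap_interval G(1) unfolding U_def by blast
    obtain x where x: "x \<in> {s<..<t}" "z = cis x" using G(2) st(2) by blast

    \<comment> \<open>The open arc of half-width \<open>d\<close> stays in the gap and its closed
      complement misses \<open>z\<close>; \<open>d \<le> 1 < pi\<close> keeps the complementary
      parameter interval nonempty.\<close>
    define d where "d = min 1 (min (x - s) (t - x))"
    have "closed (cis ` {x + d..x - d + 2 * pi})"
      by (auto intro!: compact_imp_closed compact_continuous_image continuous_intros)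
    moreover have "z \<notin> cis ` {x + d..x - d + 2 * pi}"
    proof
      assume "z \<in> cis ` {x + d..x - d + 2 * pi}"
      then obtain u where u: "u \<in> {x + d..x - d + 2 * pi}" "cis u = cis x" using x(2) by auto
      then obtain k :: int where k: "u = x + 2 * pi * of_int k" using cis_eq_iff_int by blast
      have "d > 0" using x(1) by (auto simp: d_def)
      hence "0 < 2 * pi * of_int k" "2 * pi * of_int k < 2 * pi * 1"
        using u(1) k unfolding atLeastAtMost_iff by linarith+
      hence "0 < real_of_int k" "real_of_int k < 1"
        by (simp_all only: mult_less_cancel_left_pos pi_gt_zero zero_less_mult_iff zero_less_numeral simp_thms) auto
      hence "0 < k" "k < 1" by simp_all
      thus False by simp
    qed
    ultimately obtain e where e: "e > 0" "ball z e \<subseteq> - cis ` {x + d..x - d + 2 * pi}"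
      by (metis ComplI open_Compl open_contains_ball)
    have "ball z e \<inter> measure_support M \<subseteq> cis ` {\<theta> \<in> {s<..<t}. cis \<theta> \<in> measure_support M}"
    proof
      fix w assume w: "w \<in> ball z e \<inter> measure_support M"
      hence "cmod w = 1" by (auto simp: measure_support_def space_M)
      then obtain u where u: "w = cis u" using unit_eq_cis by blast
      define k where "k = - \<lfloor>(u - (x - d)) / (2 * pi)\<rfloor>"
      define v where "v = u + 2 * pi * of_int k"
      have "of_int (- k) \<le> (u - (x - d)) / (2 * pi)" "(u - (x - d)) / (2 * pi) < of_int (- k) + 1"
        unfolding k_def by linarith+
      hence v: "x - d \<le> v" "v < x - d + 2 * pi" by (simp_all add: v_def field_simps)
      have wv: "w = cis v" unfolding u v_def cis_eq_iff_int by (intro exI[of _ "- k"]) simp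
      have "w \<notin> cis ` {x + d..x - d + 2 * pi}" using w e(2) by blast
      hence "v < x + d" using v wv by (force simp: not_le)
      moreover have "v \<noteq> x - d"
      proof
        assume "v = x - d"
        hence "w = cis (x - d + 2 * pi)" unfolding wv cis_eq_iff_int by (intro exI[of _ "-1"]) simp
        moreover have "x + d \<le> x - d + 2 * pi" using pi_gt3 by (auto simp: d_def)
        ultimately show False using \<open>w \<notin> cis ` {x + d..x - d + 2 * pi}\<close> by auto
      qed
      ultimately have "v \<in> {s<..<t}" using v by (auto simp: d_def)
      thus "w \<in> cis ` {\<theta> \<in> {s<..<t}. cis \<theta> \<in> measure_support M}" using w wv by auto
    qed
    hence "finite (ball z e \<inter> measure_support M)"
      using finite_support_in_gap[OF st(1)] finite_subset by blast
    thus ?thesis using e(1) by (auto simp: essential_support_def)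
  qed
  thus ?thesis using spectrum_essential by auto
qed

lemma mass_points_support: "mass_points M \<subseteq> measure_support M"
proof
  fix z assume "z \<in> mass_points M"
  hence z: "z \<in> space M" "emeasure M {z} > 0" by (auto simp: mass_points_def)
  have "emeasure M (ball z e \<inter> space M) > 0" if "e > 0" for e
  proof -
    have "ball z e \<inter> space M \<in> sets M"
      by (auto simp: sets_M space_M sets_restrict_space image_iff Int_commute intro!: bexI[of _ "ball z e"])
    hence "emeasure M {z} \<le> emeasure M (ball z e \<inter> space M)"
      using z(1) that by (intro emeasure_mono) auto
    thus ?thesis using z(2) by (rule less_le_trans[rotated])
  qed
  thus "z \<in> measure_support M" using z(1) by (simp add: measure_support_def)
qed

text \<open>Finiteness accompanies the cardinality bound because \<open>card\<close> is 0 on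
  infinite sets.\<close>

lemma gaps_finite_card_mass_points:
  "finite (gaps M) \<and> card (gaps M) \<le> p \<and> (\<forall>G\<in>gaps M. finite (G \<inter> mass_points M))"
proof -
  have gaps: "gaps M = components (unit_circle - cis ` spectrum)"
    by (simp only: gaps_def unit_circle_minus_essential)
  have "finite (G \<inter> mass_points M)" if "G \<in> gaps M" for G
  proof -
    obtain s t where st: "gap_interval s t" "G = cis ` {s<..<t}"
      using component_gap_interval \<open>G \<in> gaps M\<close> unfolding gaps by blast
    have "G \<inter> mass_points M \<subseteq> cis ` {\<theta> \<in> {s<..<t}. cis \<theta> \<in> measure_support M}"
      using mass_points_support st(2) by auto
    thus ?thesis using finite_support_in_gap[OF st(1)] finite_subset by blast
  qed
  thus ?thesis using gaps_card unfolding gaps by blast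
qed

end

theorem theorem4p11:
  fixes M :: "complex measure" and \<beta> :: "nat \<Rightarrow> complex" and p :: nat
  assumes "circle_prob M" and "nontrivial_measure M"
    and "p > 0"
    and "\<And>j. \<beta> j \<in> ball 0 1"
    and "\<And>j. \<beta> (j + p) = \<beta> j"
    and "summable (\<lambda>j. real j * cmod (verblunsky M j - \<beta> j))"
  shows "finite (gaps M) \<and> card (gaps M) \<le> p \<and>
         (\<forall>G\<in>gaps M. finite (G \<inter> mass_points M))"
proof -
  interpret perturbed_periodic M \<beta> p
    by unfold_locales (use assms in auto)
  show ?thesis by (rule gaps_finite_card_mass_points)
qed

end
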